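(* Let $d\in\mathbb{N}^+$ and let $\dim$ be one of $\dim_H$ or $\dim_P$. Assume that $K$ is a non-exploding compact metric space and there is a continuous mass distribution $\mu$ on $K$ such that $\dim\mu=\dim K$. Then for the prevalent $f\in C(K,\mathbb{R}^d)$ there is an open set $U_f\subset\mathbb{R}^d$ such that $\mu(f^{-1}(U_f))=\mu(K)$ and for all $y\in U_f$ we have $$\dim f^{-1}(y)=\dim K.$$
   Context: Prevalence: for an abelian Polish group $G$, a set $A\subset G$ is shy if there exist a Borel set $B\supset A$ in $G$ and a Borel probability measure $\nu$ on $G$ with $\nu(B+x)=0$ for all $x\in G$; complements of shy sets are prevalent. "For the prevalent $f\in G$ property $P$ holds" means that $\{f\in G: P(f)\}$ is prevalent. For compact metric $K$, $C(K,\mathbb{R}^d)$ is the Banach space of continuous maps $K\to\mathbb{R}^d$ with the maximum norm (an abelian Polish group under addition). Dimensions: $\dim_H$ is Hausdorff dimension, with $\dim_H\emptyset=-1$. For a non-empty totally bounded metric space $X$, $N_\delta(X)$ is the smallest number of closed balls of radius $\delta$ covering $X$, and $\overline{\dim}_B X=\limsup_{\delta\to0+}\log N_\delta(X)/\log(1/\delta)$; $\overline{\dim}_B\emptyset=-1$ and $\overline{\dim}_B X=\infty$ if $X$ is not totally bounded. $\dim_P X=\inf\{\sup_i\overline{\dim}_B X_i: X=\bigcup_{i=1}^\infty X_i\}$ (so $\dim_P\emptyset=-1$). Measures: a mass distribution on a metric space $X$ is a Borel measure $\mu$ with $0<\mu(X)<\infty$; it is continuous if $\mu(\{x\})=0$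 for all $x\in X$. For a mass distribution $\mu$ on a compact metric space $K$, $\dim_H\mu=\inf\{\dim_H B: B\subset K\text{ Borel},\ \mu(B)>0\}$ and $\dim_P\mu=\inf\{\dim_P B: B\subset K\text{ Borel},\ \mu(B)>0\}$. Non-exploding: for a metric space $X$ and $r>0$ let $N(r)$ be the minimal number such that every closed ball $B(x,r)$ can be covered by $N(r)$ closed balls of radius $r/2$. $X$ is non-exploding if $\lim_{r\to0+}\frac{\log N(r)}{\log r}=0$. *)

theory Defs
  imports "HOL-Probability.Probability"
begin

text \<open>A compact metric space \<open>K\<close> is a type \<open>'a::metric_space\<close> with \<open>compact (UNIV :: 'a set)\<close>;
  then every continuous map on \<open>K\<close> is bounded, and \<open>'a \<Rightarrow>\<^sub>C (real ^ 'n)\<close> (with the supremum norm) is the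
  Banach space of all continuous maps from \<open>K\<close> to the Euclidean space of dimension \<open>CARD('n)\<close>.
  Subspaces of \<open>K\<close> are sets \<open>X :: 'a set\<close>.\<close>

definition shy :: "'g::topological_ab_group_add set \<Rightarrow> bool" where
  "shy A \<longleftrightarrow> (\<exists>B \<in> sets borel. A \<subseteq> B \<and>
     (\<exists>\<nu>. prob_space \<nu> \<and> sets \<nu> = sets borel \<and>
       (\<forall>x. emeasure \<nu> ((\<lambda>b. b + x) ` B) = 0)))"

definition prevalent :: "'g::topological_ab_group_add set \<Rightarrow> bool" where
  "prevalent A \<longleftrightarrow> shy (- A)"

text \<open>\<open>(diam U)\<^sup>s\<close> with the conventions \<open>0\<^sup>0 = 1\<close> for nonempty \<open>U\<close> and \<open>0\<close> for empty \<open>U\<close>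
  (note that \<open>0 powr 0 = 0\<close>).\<close>

definition diam_pow :: "real \<Rightarrow> 'a::metric_space set \<Rightarrow> ennreal" where
  "diam_pow s U =
     (if U = {} then 0 else if s = 0 then 1 else ennreal (diameter U powr s))"

text \<open>Boundedness is required explicitly because \<open>diameter\<close> is unspecified on unbounded sets.\<close>

definition hausdorff_premeasure :: "real \<Rightarrow> real \<Rightarrow> 'a::metric_space set \<Rightarrow> ennreal" where
  "hausdorff_premeasure s \<delta> X =
     Inf {\<Sum>i. diam_pow s (U i) | U :: nat \<Rightarrow> 'a set.
            X \<subseteq> (\<Union>i. U i) \<and> (\<forall>i. bounded (U i) \<and> diameter (U i) \<le> \<delta>)}"

definition hausdorff_measure :: "real \<Rightarrow> 'a::metric_space set \<Rightarrow> ennreal" where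
  "hausdorff_measure s X = (SUP \<delta>\<in>{0<..}. hausdorff_premeasure s \<delta> X)"

definition hausdorff_dim :: "'a::metric_space set \<Rightarrow> ereal" where
  "hausdorff_dim X =
     (if X = {} then -1
      else Inf (ereal ` {s. 0 \<le> s \<and> hausdorff_measure s X = 0}))"

text \<open>Only meaningful if some finite cover exists, as is the case for totally bounded \<open>X\<close> and
  \<open>\<delta> > 0\<close>. The centres lie in \<open>X\<close>, so these are balls of the metric space \<open>X\<close> itself.\<close>

definition covering_number :: "real \<Rightarrow> 'a::metric_space set \<Rightarrow> nat" where
  "covering_number \<delta> X =
     (LEAST n. \<exists>C. C \<subseteq> X \<and> finite C \<and> card C = n \<and> X \<subseteq> (\<Union>c\<in>C. cball c \<delta>))"

definition upper_box_dim :: "'a::metric_space set \<Rightarrow> ereal" where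
  "upper_box_dim X =
     (if X = {} then -1
      else if totally_bounded X then
        Limsup (at_right 0) (\<lambda>\<delta>. ereal (ln (real (covering_number \<delta> X)) / ln (1 / \<delta>)))
      else \<infinity>)"

definition packing_dim :: "'a::metric_space set \<Rightarrow> ereal" where
  "packing_dim X =
     Inf {(SUP i. upper_box_dim (Y i)) | Y :: nat \<Rightarrow> 'a set. X = (\<Union>i. Y i)}"

definition mass_distribution :: "'a::metric_space measure \<Rightarrow> bool" where
  "mass_distribution \<mu> \<longleftrightarrow>
     sets \<mu> = sets borel \<and> 0 < emeasure \<mu> UNIV \<and> emeasure \<mu> UNIV < \<infinity>"

definition continuous_measure :: "'a::metric_space measure \<Rightarrow> bool" where
  "continuous_measure \<mu> \<longleftrightarrow> (\<forall>x. emeasure \<mu> {x} = 0)"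

definition measure_dim :: "('a::metric_space set \<Rightarrow> ereal) \<Rightarrow> 'a measure \<Rightarrow> ereal" where
  "measure_dim Dim \<mu> = Inf {Dim B | B. B \<in> sets borel \<and> emeasure \<mu> B > 0}"

definition halving_cover :: "'a::metric_space set \<Rightarrow> real \<Rightarrow> nat \<Rightarrow> bool" where
  "halving_cover X r n \<longleftrightarrow>
     (\<forall>x\<in>X. \<exists>C. C \<subseteq> X \<and> finite C \<and> card C \<le> n \<and>
        cball x r \<inter> X \<subseteq> (\<Union>c\<in>C. cball c (r / 2)))"

text \<open>The first conjunct says that the minimal number \<open>N(r)\<close> is finite for all small \<open>r\<close>, so that
  the \<open>LEAST\<close> in the second one is attained; it is automatic for compact \<open>X\<close>.\<close>

definition non_exploding :: "'a::metric_space set \<Rightarrow> bool" where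
  "non_exploding X \<longleftrightarrow>
     (\<forall>\<^sub>F r in at_right 0. \<exists>n. halving_cover X r n) \<and>
     ((\<lambda>r. ln (real (LEAST n. halving_cover X r n)) / ln r) \<longlongrightarrow> 0) (at_right 0)"

end

theory Submission
  imports Defs "HOL-Real_Asymp.Real_Asymp"
begin

text \<open>Let \<open>h = f + g\<close>, where \<open>f\<close> is a very rough random series and \<open>g\<close> is an arbitrary continuous map.
  The drift \<open>g\<close> only multiplies the integrand \<open>cis (u \<bullet> f)\<close> by factors of modulus one, so the second moment
  of the integral of \<open>cis (u \<bullet> h)\<close> over a set \<open>V\<close> has a bound that does not depend on \<open>g\<close>. Since \<open>\<mu>\<close> has no
  atoms, \<open>f\<close> can be chosen so rough that the integral is of order \<open>exp (- a * sqrt \<bar>u\<bar>)\<close>, for all \<open>V\<close> inside a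
  closed set of almost full measure. Hence almost surely the image measure of \<open>\<mu>\<close> under \<open>h\<close> has a continuous
  density \<open>L\<close> (a local time), and the open set is \<open>{y. 0 < L y}\<close>. Integrals of a summability kernel in
  \<open>h - y\<close> play the role of a measure on the fiber over \<open>y\<close>. The trivial bound \<open>\<mu> V\<close> for low frequencies and
  the decay for high ones show that a ball of radius \<open>1 / 2 ^ n\<close> carries at most its \<open>\<mu>\<close>-measure times a
  power of \<open>n\<close>, plus \<open>O(1 / 2 ^ (n * n))\<close>. So the fibers over \<open>{y. 0 < L y}\<close> inherit the local dimension bounds
  of \<open>\<mu>\<close>, and the mass distribution principle applies. Non-explosion enters only through the bound
  \<open>O(2 ^ (n * n))\<close> for the number of balls of radius \<open>1 / 2 ^ n\<close> that have to be controlled.\<close>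

section \<open>Hausdorff and packing dimension\<close>

text \<open>A shy set must be null for all translates of one measure. So every estimate has to be
  uniform in \<open>g\<close>, while the null set of exceptional \<open>f\<close> may depend on
  \<open>g\<close> and only countably many conditions can be imposed. This is why the data are
  countable: lattice frequencies instead of an integral over all frequencies, and sets
  \<open>V\<close> built from nets. The decay rate comes from the shape of \<open>f\<close>. Level
  \<open>l\<close> adds up \<open>2 ^ l\<close> independent signs of size
  \<open>(1/4) ^ Suc l\<close> on each piece of a partition. Their sum is at most
  \<open>(1/2) ^ l\<close>, so the series converges uniformly; at a frequency of size
  \<open>4 ^ l\<close> each sign damps the correlation of two pieces by \<open>cos (1/4)\<close>,
  and \<open>2 ^ l\<close> is of the order of the square root of that frequency. The obstacle is
  continuity: a level is constant only on plateaus, and the layers between them are out of control.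
  They are discarded level by level, which leaves closed sets \<open>D j\<close> where decay is
  available from frequency \<open>4 ^ j\<close> on. Closed sets are kept throughout so that the part
  of a fiber inside \<open>D j\<close> is compact: no limit measure is built on it, finite subcovers
  are used instead.\<close>

lemma hausdorff_premeasure_mono:
  "X \<subseteq> Y \<Longrightarrow> hausdorff_premeasure s \<delta> X \<le> hausdorff_premeasure s \<delta> Y"
  unfolding hausdorff_premeasure_def by (intro Inf_superset_mono) blast

lemma hausdorff_dim_nonneg: "X \<noteq> {} \<Longrightarrow> 0 \<le> hausdorff_dim X"
  unfolding hausdorff_dim_def by (auto intro!: Inf_greatest)

lemma hausdorff_dim_mono:
  assumes "X \<subseteq> Y"
  shows "hausdorff_dim X \<le> hausdorff_dim Y"
proof (cases "X = {}")
  case True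
  show ?thesis
  proof (cases "Y = {}")
    case False
    have "(-1 :: ereal) \<le> 0" by simp
    also have "0 \<le> hausdorff_dim Y" by (rule hausdorff_dim_nonneg[OF False])
    finally show ?thesis using True by (simp add: hausdorff_dim_def)
  qed (use True in simp)
next
  case False
  have "hausdorff_measure s X \<le> hausdorff_measure s Y" for s
    unfolding hausdorff_measure_def using hausdorff_premeasure_mono[OF assms] by (intro SUP_mono) auto
  then have "{s. 0 \<le> s \<and> hausdorff_measure s Y = 0} \<subseteq> {s. 0 \<le> s \<and> hausdorff_measure s X = 0}"
    by auto (metis le_zero_eq)
  then show ?thesis
    using False assms unfolding hausdorff_dim_def by (auto intro!: Inf_superset_mono)
qed

lemma hausdorff_dim_lessD:
  assumes "hausdorff_dim X < a" "X \<noteq> {}"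
  obtains t where "0 \<le> t" "ereal t < a"
    "\<And>\<delta> \<eta>. 0 < \<delta> \<Longrightarrow> 0 < \<eta> \<Longrightarrow> \<exists>U :: nat \<Rightarrow> 'a::metric_space set. X \<subseteq> (\<Union>i. U i) \<and> (\<forall>i. bounded (U i) \<and> diameter (U i) \<le> \<delta>) \<and> (\<Sum>i. diam_pow t (U i)) < \<eta>"
proof -
  obtain t where t: "0 \<le> t" "hausdorff_measure t X = 0" "ereal t < a"
    using assms unfolding hausdorff_dim_def by (auto simp: Inf_less_iff)
  show thesis
  proof (rule that[OF t(1,3)])
    fix \<delta> :: real and \<eta> :: ennreal assume *: "0 < \<delta>" "0 < \<eta>"
    have "hausdorff_premeasure t \<delta> X \<le> hausdorff_measure t X"
      unfolding hausdorff_measure_def using * by (intro SUP_upper) auto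
    then have "hausdorff_premeasure t \<delta> X < \<eta>" using t * by simp
    then show "\<exists>U. X \<subseteq> (\<Union>i. U i) \<and> (\<forall>i. bounded (U i) \<and> diameter (U i) \<le> \<delta>) \<and> (\<Sum>i. diam_pow t (U i)) < \<eta>"
      unfolding hausdorff_premeasure_def Inf_less_iff by auto
  qed
qed

lemma hausdorff_dim_leI:
  assumes "0 \<le> t" "\<And>\<delta> \<eta>. 0 < \<delta> \<Longrightarrow> 0 < \<eta> \<Longrightarrow> hausdorff_premeasure t \<delta> X \<le> ennreal \<eta>"
  shows "hausdorff_dim X \<le> ereal t"
proof (cases "X = {}")
  case True
  then show ?thesis using assms(1) by (simp add: hausdorff_dim_def one_ereal_def)
next
  case False
  have "hausdorff_premeasure t \<delta> X = 0" if "0 < \<delta>" for \<delta>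
  proof -
    have "hausdorff_premeasure t \<delta> X \<le> 0"
    proof (rule ennreal_le_epsilon)
      fix \<eta> :: real assume "0 < \<eta>"
      then show "hausdorff_premeasure t \<delta> X \<le> 0 + ennreal \<eta>"
        using assms(2)[OF \<open>0 < \<delta>\<close>] by simp
    qed
    then show ?thesis by simp
  qed
  then have "hausdorff_measure t X = 0"
    unfolding hausdorff_measure_def by (simp add: SUP_eq_const[of "{0<..}"])
  then show ?thesis using False assms(1) unfolding hausdorff_dim_def by (auto intro!: Inf_lower)
qed

section \<open>Covers by balls and the upper box dimension\<close>

lemma finite_cball_recenter:
  fixes X :: "'a::metric_space set"
  assumes "finite C" "X \<subseteq> (\<Union>c\<in>C. cball c r)"
  obtains C' where "C' \<subseteq> X" "finite C'" "card C' \<le> card C" "X \<subseteq> (\<Union>c\<in>C'. cball c (2 * r))"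
proof -
  define B where "B = {c \<in> C. X \<inter> cball c r \<noteq> {}}"
  have "\<forall>c\<in>B. \<exists>x. x \<in> X \<inter> cball c r" unfolding B_def by auto
  then obtain f where f: "\<And>c. c \<in> B \<Longrightarrow> f c \<in> X \<inter> cball c r" by metis
  have B: "finite B" "card B \<le> card C" unfolding B_def using assms(1) by (auto intro: card_mono)
  show thesis
  proof (rule that[of "f ` B"])
    show "card (f ` B) \<le> card C" using B card_image_le[of B f] by simp
    show "X \<subseteq> (\<Union>c\<in>f ` B. cball c (2 * r))"
    proof
      fix x assume x: "x \<in> X"
      then obtain c where c: "c \<in> C" "x \<in> cball c r" using assms(2) by auto
      then have cB: "c \<in> B" using x unfolding B_def by auto
      have "dist (f c) x \<le> dist (f c) c + dist c x" by (rule dist_triangle)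
      also have "\<dots> \<le> 2 * r" using f[OF cB] c by (auto simp: dist_commute)
      finally show "x \<in> (\<Union>c\<in>f ` B. cball c (2 * r))" using cB by auto
    qed
  qed (use f B in auto)
qed

lemma totally_bounded_of_compact:
  assumes "compact (UNIV :: 'a::metric_space set)"
  shows "totally_bounded (X :: 'a set)"
proof -
  have "totally_bounded (UNIV :: 'a set)"
    unfolding totally_bounded_metric
  proof (intro allI impI)
    fix e :: real assume e: "0 < e"
    have "(UNIV :: 'a set) \<subseteq> (\<Union>x\<in>UNIV. ball x e)" using e by auto
    then obtain C where "C \<subseteq> UNIV" "finite C" "(UNIV :: 'a set) \<subseteq> (\<Union>x\<in>C. ball x e)"
      by (rule compactE_image[OF assms open_ball]) (rule that, assumption+)
    then show "\<exists>k. finite k \<and> (UNIV :: 'a set) \<subseteq> (\<Union>x\<in>k. {y. dist x y < e})"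
      by (auto simp: ball_def)
  qed
  then show ?thesis by (rule totally_bounded_subset) simp
qed

lemma covering_number_attained:
  fixes X :: "'a::metric_space set"
  assumes "totally_bounded X" "0 < \<delta>"
  obtains C where "C \<subseteq> X" "finite C" "card C = covering_number \<delta> X" "X \<subseteq> (\<Union>c\<in>C. cball c \<delta>)"
proof -
  obtain k where k: "finite k" "X \<subseteq> (\<Union>x\<in>k. {y. dist x y < \<delta> / 2})"
    using assms(1)[unfolded totally_bounded_metric, rule_format, of "\<delta> / 2"] assms(2) by auto
  have "{y. dist x y < \<delta> / 2} \<subseteq> cball x (\<delta> / 2)" for x by auto
  then have "X \<subseteq> (\<Union>x\<in>k. cball x (\<delta> / 2))" using k(2) by blast
  then obtain C where "C \<subseteq> X" "finite C" "card C \<le> card k" "X \<subseteq> (\<Union>c\<in>C. cball c (2 * (\<delta> / 2)))"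
    by (rule finite_cball_recenter[OF k(1)])
  then have "\<exists>n C. C \<subseteq> X \<and> finite C \<and> card C = n \<and> X \<subseteq> (\<Union>c\<in>C. cball c \<delta>)"
    by auto
  from LeastI_ex[OF this]
  have "\<exists>C. C \<subseteq> X \<and> finite C \<and> card C = covering_number \<delta> X \<and> X \<subseteq> (\<Union>c\<in>C. cball c \<delta>)"
    unfolding covering_number_def .
  then show thesis using that by auto
qed

lemma covering_number_le:
  assumes "C \<subseteq> X" "finite C" "X \<subseteq> (\<Union>c\<in>C. cball c \<delta>)"
  shows "covering_number \<delta> X \<le> card C"
  unfolding covering_number_def using assms by (intro Least_le) auto

lemma eventually_at_right_less: "0 < a \<Longrightarrow> \<forall>\<^sub>F \<delta> in at_right (0 :: real). \<delta> < a"
  by (rule eventually_at_rightI[of 0 a]) auto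

lemma upper_box_dim_nonneg:
  assumes "X \<noteq> {}"
  shows "0 \<le> upper_box_dim X"
proof (cases "totally_bounded X")
  case True
  have "0 = Limsup (at_right (0::real)) (\<lambda>\<delta>. 0 :: ereal)"
    by (rule Limsup_const[symmetric]) simp
  also have "\<dots> \<le> Limsup (at_right 0) (\<lambda>\<delta>. ereal (ln (real (covering_number \<delta> X)) / ln (1 / \<delta>)))"
  proof (rule Limsup_mono)
    have "\<forall>\<^sub>F \<delta> in at_right (0 :: real). 0 < \<delta> \<and> \<delta> < 1"
      using eventually_at_right_less[of 1] eventually_at_right_less
      by (intro eventually_conj) (auto simp: eventually_at_filter)
    then show "\<forall>\<^sub>F \<delta> in at_right 0. 0 \<le> ereal (ln (real (covering_number \<delta> X)) / ln (1 / \<delta>))"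
    proof (rule eventually_mono)
      fix \<delta> :: real assume \<delta>: "0 < \<delta> \<and> \<delta> < 1"
      have "0 \<le> ln (real n)" for n by (cases "n = 0") auto
      moreover have "0 \<le> ln (1 / \<delta>)" using \<delta> by simp
      ultimately show "0 \<le> ereal (ln (real (covering_number \<delta> X)) / ln (1 / \<delta>))"
        by simp
    qed
  qed
  finally show ?thesis using True assms by (simp add: upper_box_dim_def)
qed (use assms in \<open>simp add: upper_box_dim_def\<close>)

lemma upper_box_dim_lessD:
  fixes X :: "'a::metric_space set"
  assumes "upper_box_dim X < ereal t" "totally_bounded X"
  shows "\<exists>n0. \<forall>n\<ge>n0. \<exists>C\<subseteq>X. finite C \<and> real (card C) \<le> 2 powr (real n * t) \<and> X \<subseteq> (\<Union>c\<in>C. cball c (1 / 2 ^ n))"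
proof (cases "X = {}")
  case True
  then show ?thesis by auto
next
  case False
  have "\<forall>\<^sub>F \<delta> in at_right 0. ereal (ln (real (covering_number \<delta> X)) / ln (1 / \<delta>)) < ereal t"
    using assms False by (intro Limsup_lessD) (simp add: upper_box_dim_def)
  then obtain b where b: "0 < b" "\<And>\<delta>. 0 < \<delta> \<Longrightarrow> \<delta> < b \<Longrightarrow> ln (real (covering_number \<delta> X)) / ln (1 / \<delta>) < t"
    unfolding eventually_at_right_field by auto
  obtain n0 where n0: "(1 / 2) ^ n0 < min b 1"
    using real_arch_pow_inv[of "min b 1" "1/2"] b by auto
  show ?thesis
  \<comment> \<open>\<open>Suc n0\<close> makes \<open>n\<close> positive, so that
    \<open>real n * ln 2\<close>, the logarithm of the reciprocal radius, can be multiplied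
    out.\<close>
  proof (intro exI[of _ "Suc n0"] allI impI)
    fix n assume n: "Suc n0 \<le> n"
    have "(1 / 2 :: real) ^ n \<le> (1 / 2) ^ n0" using n by (intro power_decreasing) auto
    then have \<delta>: "(1 / 2) ^ n < b" using n0 by linarith
    obtain C where C: "C \<subseteq> X" "finite C" "card C = covering_number ((1 / 2) ^ n) X" "X \<subseteq> (\<Union>c\<in>C. cball c ((1 / 2) ^ n))"
      by (rule covering_number_attained[OF assms(2), of "(1 / 2) ^ n"]) auto
    have pos: "0 < real (card C)" using C False by (auto simp: card_gt_0_iff)
    have l: "ln (1 / (1 / 2) ^ n) = real n * ln 2" by (simp add: power_divide ln_realpow)
    have "0 < real n * ln 2" using n by simp
    then have "ln (real (card C)) < t * (real n * ln 2)"
      using b(2)[OF _ \<delta>] unfolding l C(3) by (simp add: pos_divide_less_eq)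
    then have "real (card C) < exp (t * (real n * ln 2))" using pos by (metis exp_less_cancel_iff exp_ln)
    also have "\<dots> = 2 powr (real n * t)" by (simp add: powr_def mult_ac)
    finally show "\<exists>C\<subseteq>X. finite C \<and> real (card C) \<le> 2 powr (real n * t) \<and> X \<subseteq> (\<Union>c\<in>C. cball c (1 / 2 ^ n))"
      using C by (intro exI[of _ C]) (auto simp: power_divide)
  qed
qed

text \<open>Control at the dyadic radii \<open>a / 2 ^ n\<close> suffices: rounding a radius to one
  of them changes the bound by a bounded factor, and bounded factors vanish after division by
  \<open>ln (1 / \<delta>)\<close>.\<close>

lemma upper_box_dim_leI:
  fixes X :: "'a::metric_space set"
  assumes "totally_bounded X" "0 \<le> t" "0 < a" "0 < B"
    and cov: "\<And>n. n0 \<le> n \<Longrightarrow>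
      \<exists>C\<subseteq>X. finite C \<and> real (card C) \<le> B * 2 powr (real n * t) \<and> X \<subseteq> (\<Union>c\<in>C. cball c (a / 2 ^ n))"
  shows "upper_box_dim X \<le> ereal t"
proof (cases "X = {}")
  case True
  then show ?thesis using assms(2) by (simp add: upper_box_dim_def one_ereal_def)
next
  case False
  define B' where "B' = B * (2 * a) powr t"
  have B': "0 < B'" using assms unfolding B'_def by simp
  have bound: "ln (real (covering_number \<delta> X)) / ln (1 / \<delta>) \<le> ln B' / ln (1 / \<delta>) + t"
    if \<delta>: "0 < \<delta>" "\<delta> < 1" "\<delta> < a / 2 ^ n0" for \<delta>
  proof -
    have "\<exists>n. a / 2 ^ n \<le> \<delta>"
    proof -
      obtain n where "(1 / 2) ^ n < \<delta> / a" using real_arch_pow_inv[of "\<delta> / a" "1/2"] \<delta> assms by auto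
      then have "a / 2 ^ n \<le> \<delta>" using assms by (simp add: power_divide field_simps)
      then show ?thesis by auto
    qed
    \<comment> \<open>The least such \<open>n\<close> satisfies
      \<open>2 ^ n \<le> 2 * a / \<delta>\<close>; this is where \<open>(2 * a) powr t\<close> in
      \<open>B'\<close> comes from.\<close>
    then obtain n where n: "a / 2 ^ n \<le> \<delta>" "\<And>m. m < n \<Longrightarrow> \<delta> < a / 2 ^ m"
      using exists_least_iff[of "\<lambda>n. a / 2 ^ n \<le> \<delta>"] by (auto simp: not_le)
    have nn: "n0 < n"
    proof (rule ccontr)
      assume "\<not> n0 < n"
      then have "a / 2 ^ n0 \<le> a / 2 ^ n" using assms(3) by (intro divide_left_mono power_increasing) auto
      then show False using n \<delta> by linarith
    qed
    obtain C where C: "C \<subseteq> X" "finite C" "real (card C) \<le> B * 2 powr (real n * t)" "X \<subseteq> (\<Union>c\<in>C. cball c (a / 2 ^ n))"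
      using cov[of n] nn by auto
    have "cball c (a / 2 ^ n) \<subseteq> cball c \<delta>" for c using n(1) by (rule subset_cball)
    then have "X \<subseteq> (\<Union>c\<in>C. cball c \<delta>)" using C(4) by blast
    then have "real (covering_number \<delta> X) \<le> real (card C)" using covering_number_le[OF C(1,2)] by simp
    also have "\<dots> \<le> B * 2 powr (real n * t)" by (rule C)
    also have "2 powr (real n * t) = (2 ^ n) powr t" by (simp add: powr_powr[symmetric] powr_realpow)
    also have "(2 ^ n) powr t \<le> (2 * a / \<delta>) powr t"
    proof (rule powr_mono2[OF assms(2)])
      have "\<delta> < a / 2 ^ (n - 1)" using n(2)[of "n - 1"] nn by simp
      moreover have "(2 :: real) ^ n = 2 * 2 ^ (n - 1)" using nn by (cases n) auto
      ultimately show "2 ^ n \<le> 2 * a / \<delta>" using \<delta> by (simp add: field_simps)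
    qed simp
    also have "B * (2 * a / \<delta>) powr t = B' * (1 / \<delta>) powr t"
      unfolding B'_def using \<delta> assms by (simp add: powr_divide mult.assoc)
    finally have le: "real (covering_number \<delta> X) \<le> B' * (1 / \<delta>) powr t" using assms by simp
    have pos: "0 < ln (1 / \<delta>)" using \<delta> by simp
    have cn: "0 < real (covering_number \<delta> X)"
    proof -
      obtain C where C: "C \<subseteq> X" "finite C" "card C = covering_number \<delta> X" "X \<subseteq> (\<Union>c\<in>C. cball c \<delta>)"
        by (rule covering_number_attained[OF assms(1) \<delta>(1)])
      then have "C \<noteq> {}" using False by auto
      then show ?thesis using C(2) unfolding C(3)[symmetric] by (simp add: card_gt_0_iff)
    qed
    have "ln (real (covering_number \<delta> X)) \<le> ln (B' * (1 / \<delta>) powr t)"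
      using le cn by simp
    also have "\<dots> = ln B' + t * ln (1 / \<delta>)" using B' \<delta> by (simp add: ln_mult ln_powr)
    finally show ?thesis using pos by (simp add: field_simps)
  qed
  have "upper_box_dim X = Limsup (at_right 0) (\<lambda>\<delta>. ereal (ln (real (covering_number \<delta> X)) / ln (1 / \<delta>)))"
    using False assms by (simp add: upper_box_dim_def)
  also have "\<dots> \<le> Limsup (at_right 0) (\<lambda>\<delta>. ereal (ln B' / ln (1 / \<delta>) + t))"
  proof (rule Limsup_mono, rule eventually_at_rightI[of 0 "min 1 (a / 2 ^ n0)"])
    show "0 < min 1 (a / 2 ^ n0)" using assms by simp
  qed (use bound in auto)
  also have "\<dots> = ereal t"
  proof (rule lim_imp_Limsup)
    have "((\<lambda>\<delta>. ln B' / ln (1 / \<delta>) + t) \<longlongrightarrow> t) (at_right 0)" by real_asymp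
    then show "((\<lambda>\<delta>. ereal (ln B' / ln (1 / \<delta>) + t)) \<longlongrightarrow> ereal t) (at_right 0)" by simp
  qed simp
  finally show ?thesis .
qed

text \<open>Covering numbers with centres inside the set are not monotone under inclusion. Moving
  the centres into the subset doubles the radius, which the constant \<open>a\<close> of
  \<open>upper_box_dim_leI\<close> absorbs.\<close>

lemma upper_box_dim_mono:
  fixes Y :: "'a::metric_space set"
  assumes "totally_bounded Y" "X \<subseteq> Y"
  shows "upper_box_dim X \<le> upper_box_dim Y"
proof (cases "X = {}")
  case True
  then show ?thesis
    using upper_box_dim_nonneg[of Y] order_trans[of "-1" "0::ereal" "upper_box_dim Y"]
    by (cases "Y = {}") (auto simp: upper_box_dim_def[of "{}"])
next
  case False
  show ?thesis
  proof (rule ccontr)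
    assume "\<not> ?thesis"
    then have "upper_box_dim Y < upper_box_dim X" by simp
    then obtain t where t: "upper_box_dim Y < ereal t" "ereal t < upper_box_dim X"
      using ereal_dense2 by blast
    have tX: "totally_bounded X" using assms totally_bounded_subset by blast
    obtain n0 where n0: "\<And>n. n0 \<le> n \<Longrightarrow>
      \<exists>C\<subseteq>Y. finite C \<and> real (card C) \<le> 2 powr (real n * t) \<and> Y \<subseteq> (\<Union>c\<in>C. cball c (1 / 2 ^ n))"
      using upper_box_dim_lessD[OF t(1) assms(1)] by blast
    have "0 \<le> upper_box_dim Y" using False assms by (intro upper_box_dim_nonneg) auto
    then have "0 < ereal t" using t(1) by (rule order.strict_trans1)
    then have t0: "0 \<le> t" by simp
    have "upper_box_dim X \<le> ereal t"
    proof (rule upper_box_dim_leI[OF tX t0, of 2 1 n0])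
      fix n assume "n0 \<le> n"
      then obtain C where C: "finite C" "real (card C) \<le> 2 powr (real n * t)" "Y \<subseteq> (\<Union>c\<in>C. cball c (1 / 2 ^ n))"
        using n0[OF \<open>n0 \<le> n\<close>] by blast
      have "X \<subseteq> (\<Union>c\<in>C. cball c (1 / 2 ^ n))" using assms C by auto
      then obtain C' where
        C': "C' \<subseteq> X" "finite C'" "card C' \<le> card C" "X \<subseteq> (\<Union>c\<in>C'. cball c (2 * (1 / 2 ^ n)))"
        by (rule finite_cball_recenter[OF C(1)])
      then show "\<exists>C\<subseteq>X. finite C \<and> real (card C) \<le> 1 * 2 powr (real n * t) \<and> X \<subseteq> (\<Union>c\<in>C. cball c (2 / 2 ^ n))"
        using C(2) by (intro exI[of _ C']) auto
    qed auto
    then show False using t by simp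
  qed
qed

lemma packing_dim_mono:
  fixes X :: "'a::metric_space set"
  assumes "compact (UNIV :: 'a set)" "X \<subseteq> Y"
  shows "packing_dim X \<le> packing_dim Y"
  unfolding packing_dim_def
proof (rule Inf_mono)
  fix b assume "b \<in> {SUP i. upper_box_dim (Z i) |Z :: nat \<Rightarrow> 'a set. Y = (\<Union>i. Z i)}"
  then obtain Z :: "nat \<Rightarrow> 'a set" where Z: "b = (SUP i. upper_box_dim (Z i))" "Y = (\<Union>i. Z i)" by auto
  have "(SUP i. upper_box_dim (X \<inter> Z i)) \<le> b"
    unfolding Z(1) by (intro SUP_mono exI[of _ "_ :: nat"]) (auto intro: upper_box_dim_mono totally_bounded_of_compact assms)
  moreover have "X = (\<Union>i. X \<inter> Z i)" using Z assms by auto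
  ultimately show "\<exists>a\<in>{SUP i. upper_box_dim (Y i) |Y :: nat \<Rightarrow> 'a set. X = (\<Union>i. Y i)}. a \<le> b"
    by (intro bexI[of _ "SUP i. upper_box_dim (X \<inter> Z i)"]) auto
qed

text \<open>A maximal \<open>8/2\<^sup>n\<close>-separated subset of \<open>X\<close> is the set of centres of pairwise disjoint balls,
  each of which carries much mass.\<close>

lemma heavy_points_cover:
  fixes \<mu> :: "'a::metric_space measure"
  assumes mu: "finite_measure \<mu>" "sets \<mu> = sets borel"
    and heavy: "\<And>x. x \<in> X \<Longrightarrow> 2 powr (- (real n * s)) < measure \<mu> (ball x (4 / 2 ^ n))"
  shows "\<exists>C\<subseteq>X. finite C \<and> real (card C) \<le> measure \<mu> UNIV * 2 powr (real n * s) \<and> X \<subseteq> (\<Union>c\<in>C. cball c (8 / 2 ^ n))"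
proof -
  interpret finite_measure \<mu> by fact
  have space: "space \<mu> = UNIV" using sets_eq_imp_space_eq[OF mu(2)] by simp
  define sep where "sep = (\<lambda>C. C \<subseteq> X \<and> finite C \<and> (\<forall>c\<in>C. \<forall>c'\<in>C. c \<noteq> c' \<longrightarrow> 8 / 2 ^ n < dist c c'))"
  have card_le: "real (card C) \<le> measure \<mu> UNIV * 2 powr (real n * s)" if C: "sep C" for C
  proof -
    have disj: "disjoint_family_on (\<lambda>c. ball c (4 / 2 ^ n)) C"
      unfolding disjoint_family_on_def
    proof (intro ballI impI)
      fix c c' assume "c \<in> C" "c' \<in> C" "c \<noteq> c'"
      then have d: "8 / 2 ^ n < dist c c'" using C unfolding sep_def by auto
      have "False" if "dist c z < 4 / 2 ^ n" "dist c' z < 4 / 2 ^ n" for z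
        using dist_triangle2[of c c' z] that d by simp
      then show "ball c (4 / 2 ^ n) \<inter> ball c' (4 / 2 ^ n) = {}" by auto
    qed
    have "real (card C) * 2 powr (- (real n * s)) = (\<Sum>c\<in>C. 2 powr (- (real n * s)))" by simp
    also have "\<dots> \<le> (\<Sum>c\<in>C. measure \<mu> (ball c (4 / 2 ^ n)))"
      using C heavy unfolding sep_def by (intro sum_mono less_imp_le) auto
    also have "\<dots> = measure \<mu> (\<Union>c\<in>C. ball c (4 / 2 ^ n))"
      using C disj unfolding sep_def by (intro finite_measure_finite_Union[symmetric]) (auto simp: mu(2))
    also have "\<dots> \<le> measure \<mu> UNIV" using bounded_measure[of "\<Union>c\<in>C. ball c (4 / 2 ^ n)"] unfolding space .
    finally show ?thesis by (simp add: powr_minus field_simps)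
  qed
  obtain b :: nat where b: "measure \<mu> UNIV * 2 powr (real n * s) \<le> real b" using real_arch_simple by auto
  have "sep {}" unfolding sep_def by auto
  moreover have "\<forall>C. sep C \<longrightarrow> card C < Suc b" using card_le b by (meson of_nat_le_iff order_trans le_imp_less_Suc)
  ultimately obtain C where C: "sep C" "\<And>C'. sep C' \<Longrightarrow> card C' \<le> card C"
    using ex_has_greatest_nat[of sep "{}" card "Suc b"] by blast
  have "X \<subseteq> (\<Union>c\<in>C. cball c (8 / 2 ^ n))"
  proof (rule ccontr)
    assume "\<not> ?thesis"
    then obtain x where "x \<in> X" "x \<notin> (\<Union>c\<in>C. cball c (8 / 2 ^ n))" by blast
    then have x: "x \<in> X" "\<And>c. c \<in> C \<Longrightarrow> 8 / 2 ^ n < dist c x" by (auto simp: not_le)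
    then have "x \<notin> C" by fastforce
    have "sep (insert x C)" using C(1) x unfolding sep_def by (auto simp: dist_commute)
    then have "card (insert x C) \<le> card C" by (rule C(2))
    then show False using \<open>x \<notin> C\<close> C(1) unfolding sep_def by simp
  qed
  then show ?thesis using C(1) card_le[OF C(1)] unfolding sep_def by (intro exI[of _ C]) auto
qed

section \<open>Dimension of the sets where a measure has large local mass\<close>

lemma hausdorff_premeasure_le_double_sum:
  fixes U :: "nat \<Rightarrow> nat \<Rightarrow> 'a::metric_space set"
  assumes "X \<subseteq> (\<Union>n i. U n i)" "\<And>n i. bounded (U n i) \<and> diameter (U n i) \<le> \<delta>"
  shows "hausdorff_premeasure s \<delta> X \<le> (\<Sum>n. \<Sum>i. diam_pow s (U n i))"
proof -
  define V where "V = (\<lambda>j. case_prod U (prod_decode j))"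
  have "X \<subseteq> (\<Union>j. V j)"
  proof
    fix x assume "x \<in> X"
    then obtain n i where "x \<in> U n i" using assms(1) by auto
    then have "x \<in> V (prod_encode (n, i))" unfolding V_def by simp
    then show "x \<in> (\<Union>j. V j)" by auto
  qed
  then have "hausdorff_premeasure s \<delta> X \<le> (\<Sum>j. diam_pow s (V j))"
    unfolding hausdorff_premeasure_def using assms(2)
    by (intro Inf_lower CollectI exI[of _ V]) (auto simp: V_def split: prod.split)
  also have "\<dots> = (\<Sum>n. \<Sum>i. diam_pow s (U n i))"
  proof -
    have "(\<Sum>j. (\<lambda>(n, i). diam_pow s (U n i)) (prod_decode j)) = (\<Sum>n. \<Sum>i. diam_pow s (U n i))"
      by (rule suminf_ennreal_2dimen) simp
    then show ?thesis unfolding V_def by (simp add: split_def)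
  qed
  finally show ?thesis .
qed

lemma finite_cball_cover_diam_pow:
  fixes C :: "'a::metric_space set"
  assumes "finite C" "0 \<le> r" "0 < s"
  obtains U :: "nat \<Rightarrow> 'a set" where "(\<Union>c\<in>C. cball c r) = (\<Union>i. U i)" "\<And>i. bounded (U i)" "\<And>i. diameter (U i) \<le> 2 * r"
    "(\<Sum>i. diam_pow s (U i)) \<le> ennreal (real (card C) * (2 * r) powr s)"
proof -
  obtain f where f: "bij_betw f {0..<card C} C" using ex_bij_betw_nat_finite[OF assms(1)] by blast
  \<comment> \<open>The sequence is padded with empty sets, which \<open>diam_pow\<close> counts as
    0.\<close>
  define U where "U = (\<lambda>i. if i < card C then cball (f i) r else {})"
  have diam: "diameter (cball x r) \<le> 2 * r" for x :: 'a
  proof -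
    have "dist y z \<le> 2 * r" if "y \<in> cball x r" "z \<in> cball x r" for y z
      using dist_triangle3[of y z x] that by simp
    then show ?thesis using assms(2) unfolding diameter_def by (auto intro!: cSUP_least)
  qed
  show thesis
  proof (rule that[of U])
    have "C = f ` {0..<card C}" using f by (simp add: bij_betw_def)
    then have "(\<Union>c\<in>C. cball c r) = (\<Union>c\<in>f ` {0..<card C}. cball c r)" by (rule arg_cong)
    also have "\<dots> = (\<Union>i\<in>{0..<card C}. cball (f i) r)" by (rule image_image[THEN arg_cong])
    also have "\<dots> = (\<Union>i. U i)" unfolding U_def by (auto split: if_splits)
    finally show "(\<Union>c\<in>C. cball c r) = (\<Union>i. U i)" .
    show "bounded (U i)" for i unfolding U_def by auto
    show "diameter (U i) \<le> 2 * r" for i unfolding U_def using diam assms by auto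
    have "(\<Sum>i. diam_pow s (U i)) = (\<Sum>i<card C. diam_pow s (U i))"
      by (rule suminf_finite) (auto simp: U_def diam_pow_def)
    also have "\<dots> \<le> (\<Sum>i<card C. ennreal ((2 * r) powr s))"
    proof (rule sum_mono)
      fix i assume i: "i \<in> {..<card C}"
      have "diameter (U i) powr s \<le> (2 * r) powr s"
        using diam assms i unfolding U_def by (intro powr_mono2) (auto intro!: diameter_ge_0)
      then show "diam_pow s (U i) \<le> ennreal ((2 * r) powr s)"
        using assms by (auto simp: diam_pow_def intro: ennreal_leI)
    qed
    also have "\<dots> = ennreal (real (card C) * (2 * r) powr s)"
      by (simp add: ennreal_mult ennreal_of_nat_eq_real_of_nat)
    finally show "(\<Sum>i. diam_pow s (U i)) \<le> ennreal (real (card C) * (2 * r) powr s)" .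
  qed
qed

text \<open>The radius \<open>4 / 2 ^ n\<close> leaves room for a net: a ball of radius
  \<open>1 / 2 ^ n\<close> about \<open>x\<close> lies in a ball of radius \<open>3 / 2 ^ n\<close>
  about a nearby net point, and that ball lies in this one. The ball is open so that the light
  points form a closed set.\<close>

abbreviation light :: "'a::metric_space measure \<Rightarrow> real \<Rightarrow> nat \<Rightarrow> 'a \<Rightarrow> bool" where
  "light \<mu> s n x \<equiv> measure \<mu> (ball x (4 / 2 ^ n)) \<le> 2 powr (- (real n * s))"

text \<open>A Borel-Cantelli cover: the heavy points of level \<open>n\<close> need at most a
  constant times \<open>2 powr (real n * s)\<close> balls, each of cost about
  \<open>2 powr (- (real n * t))\<close>. The costs form a geometric series in \<open>n\<close>, and
  every tail of it covers the limsup set.\<close>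

lemma hausdorff_dim_frequently_heavy:
  fixes \<mu> :: "'a::metric_space measure"
  assumes mu: "finite_measure \<mu>" "sets \<mu> = sets borel" and s: "0 \<le> s" "s < t"
  shows "hausdorff_dim {x. \<forall>m. \<exists>n\<ge>m. \<not> light \<mu> s n x} \<le> ereal t"
proof (rule hausdorff_dim_leI)
  show "0 \<le> t" using s by simp
  fix \<delta> \<eta> :: real assume \<delta>: "0 < \<delta>" and \<eta>: "0 < \<eta>"
  let ?X = "{x. \<forall>m. \<exists>n\<ge>m. \<not> light \<mu> s n x}"
  define M where "M = measure \<mu> UNIV"
  \<comment> \<open>16 is \<open>2 ^ n\<close> times the diameter bound for the balls of radius
    \<open>8 / 2 ^ n\<close> in \<open>heavy_points_cover\<close>.\<close>
  define K where "K = M * 16 powr t"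
  define q where "q = 2 powr (s - t)"
  have q: "0 < q" "q < 1" unfolding q_def using s by (auto simp: powr_less_one)
  have M: "0 \<le> M" unfolding M_def by simp
  have "(\<lambda>m. 16 * (1/2 :: real) ^ m) \<longlonglongrightarrow> 16 * 0" by (intro tendsto_mult_left LIMSEQ_power_zero) simp
  then have e1: "\<forall>\<^sub>F m in sequentially. 16 * (1/2 :: real) ^ m < \<delta>" using \<delta> by (intro order_tendstoD(2)) auto
  have "(\<lambda>m. K / (1 - q) * q ^ m) \<longlonglongrightarrow> K / (1 - q) * 0" using q by (intro tendsto_mult_left LIMSEQ_power_zero) simp
  then have e2: "\<forall>\<^sub>F m in sequentially. K / (1 - q) * q ^ m < \<eta>" using \<eta> by (intro order_tendstoD(2)) auto
  obtain m where m: "16 * (1/2 :: real) ^ m < \<delta>" "K / (1 - q) * q ^ m < \<eta>"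
    using eventually_happens'[OF sequentially_bot eventually_conj[OF e1 e2]] by blast
  define P where "P = (\<lambda>n (U :: nat \<Rightarrow> 'a set). {x. \<not> light \<mu> s n x} \<subseteq> (\<Union>i. U i) \<and> (\<forall>i. bounded (U i)) \<and>
     (\<forall>i. diameter (U i) \<le> 16 * (1/2) ^ n) \<and> (\<Sum>i. diam_pow t (U i)) \<le> ennreal (K * q ^ n))"
  have "\<exists>U. P n U" for n
  proof -
    obtain C where C: "finite C" "real (card C) \<le> M * 2 powr (real n * s)" "{x. \<not> light \<mu> s n x} \<subseteq> (\<Union>c\<in>C. cball c (8 / 2 ^ n))"
      using heavy_points_cover[OF mu, of "{x. \<not> light \<mu> s n x}" n s] unfolding M_def by (auto simp: not_le)
    obtain U :: "nat \<Rightarrow> 'a set" where U: "(\<Union>c\<in>C. cball c (8 / 2 ^ n)) = (\<Union>i. U i)" "\<And>i. bounded (U i)" "\<And>i. diameter (U i) \<le> 2 * (8 / 2 ^ n)"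
      "(\<Sum>i. diam_pow t (U i)) \<le> ennreal (real (card C) * (2 * (8 / 2 ^ n)) powr t)"
      using finite_cball_cover_diam_pow[OF C(1), of "8 / 2 ^ n" t] s by auto
    have eq: "(2 * (8 / 2 ^ n) :: real) powr t = 16 powr t * 2 powr (- (real n * t))"
    proof -
      have "(2 * (8 / 2 ^ n) :: real) = 16 * 2 powr (- real n)" by (simp add: powr_minus powr_realpow divide_inverse)
      then show ?thesis by (simp add: powr_mult powr_powr)
    qed
    have "real (card C) * (2 * (8 / 2 ^ n)) powr t \<le> M * 2 powr (real n * s) * (16 powr t * 2 powr (- (real n * t)))"
      unfolding eq using C(2) by (intro mult_right_mono) auto
    also have "M * 2 powr (real n * s) * (16 powr t * 2 powr (- (real n * t))) = K * (2 powr (real n * s) * 2 powr (- (real n * t)))"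
      unfolding K_def by simp
    also have "2 powr (real n * s) * 2 powr (- (real n * t)) = q ^ n"
      unfolding q_def by (simp add: powr_add[symmetric] powr_powr powr_realpow[symmetric] algebra_simps)
    finally have le: "real (card C) * (2 * (8 / 2 ^ n)) powr t \<le> K * q ^ n" .
    have "(\<Sum>i. diam_pow t (U i)) \<le> ennreal (K * q ^ n)" by (rule order_trans[OF U(4) ennreal_leI[OF le]])
    then have "P n U" unfolding P_def using U C(3) by (auto simp: power_divide)
    then show ?thesis by (rule exI[where x = U])
  qed
  then have "\<forall>n. \<exists>U. P n U" by blast
  from choice[OF this] obtain U where PU: "\<forall>n. P n (U n)" by blast
  have U: "{x. \<not> light \<mu> s n x} \<subseteq> (\<Union>i. U n i)" "bounded (U n i)"
     "diameter (U n i) \<le> 16 * (1/2) ^ n" "(\<Sum>i. diam_pow t (U n i)) \<le> ennreal (K * q ^ n)" for n i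
    using PU[rule_format, of n] unfolding P_def by blast+
  have "hausdorff_premeasure t \<delta> ?X \<le> (\<Sum>n. \<Sum>i. diam_pow t (U (n + m) i))"
  proof (rule hausdorff_premeasure_le_double_sum)
    show "?X \<subseteq> (\<Union>n i. U (n + m) i)"
    proof
      fix x assume "x \<in> ?X"
      then obtain n where "m \<le> n" "\<not> light \<mu> s n x" by blast
      then obtain i where "x \<in> U n i" using U(1)[of n] by blast
      then have "x \<in> U ((n - m) + m) i" using \<open>m \<le> n\<close> by simp
      then show "x \<in> (\<Union>n i. U (n + m) i)" by blast
    qed
    show "bounded (U (n + m) i) \<and> diameter (U (n + m) i) \<le> \<delta>" for n i
    proof -
      have "16 * (1/2 :: real) ^ (n + m) \<le> 16 * (1/2) ^ m" by (intro mult_left_mono power_decreasing) auto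
      then show ?thesis using U(2)[of "n + m" i] U(3)[of "n + m" i] m(1) by linarith
    qed
  qed
  also have "\<dots> \<le> (\<Sum>n. ennreal (K * q ^ (n + m)))"
    by (intro suminf_le U) auto
  also have "\<dots> = ennreal (\<Sum>n. K * q ^ (n + m))"
    using q M unfolding K_def by (intro suminf_ennreal2) (auto simp: power_add intro!: summable_mult summable_mult2 summable_geometric)
  also have "(\<Sum>n. K * q ^ (n + m)) = K / (1 - q) * q ^ m"
    using q by (simp add: power_add suminf_mult suminf_mult2[symmetric] summable_geometric suminf_geometric mult.assoc[symmetric])
  also have "ennreal \<dots> \<le> ennreal \<eta>" using m by (intro ennreal_leI) auto
  finally show "hausdorff_premeasure t \<delta> ?X \<le> ennreal \<eta>" .
qed

text \<open>The points heavy at every level from \<open>m\<close> on have small covers at all small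
  scales, which bounds an upper box dimension; packing dimension allows the countable union over
  \<open>m\<close>.\<close>

lemma packing_dim_eventually_heavy:
  fixes \<mu> :: "'a::metric_space measure"
  assumes cpt: "compact (UNIV :: 'a set)" and mu: "finite_measure \<mu>" "sets \<mu> = sets borel" and s: "0 \<le> s"
  shows "packing_dim {x. \<exists>m. \<forall>n\<ge>m. \<not> light \<mu> s n x} \<le> ereal s"
proof -
  define Y where "Y = (\<lambda>m. {x. \<forall>n\<ge>m. \<not> light \<mu> s n x})"
  have "packing_dim {x. \<exists>m. \<forall>n\<ge>m. \<not> light \<mu> s n x} \<le> (SUP m. upper_box_dim (Y m))"
    unfolding packing_dim_def by (intro Inf_lower CollectI exI[of _ Y] conjI refl) (auto simp: Y_def)
  also have "\<dots> \<le> ereal s"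
  proof (rule SUP_least)
    fix m
    show "upper_box_dim (Y m) \<le> ereal s"
    \<comment> \<open>8 is the radius constant of \<open>heavy_points_cover\<close>; the summand 1
      makes the other constant positive.\<close>
    proof (rule upper_box_dim_leI[OF totally_bounded_of_compact[OF cpt] s, of 8 "measure \<mu> UNIV + 1" m])
      fix n assume "m \<le> n"
      then have "\<exists>C\<subseteq>Y m. finite C \<and> real (card C) \<le> measure \<mu> UNIV * 2 powr (real n * s) \<and> Y m \<subseteq> (\<Union>c\<in>C. cball c (8 / 2 ^ n))"
        by (intro heavy_points_cover[OF mu]) (auto simp: Y_def not_le)
      moreover have "measure \<mu> UNIV * 2 powr (real n * s) \<le> (measure \<mu> UNIV + 1) * 2 powr (real n * s)"
        by (intro mult_right_mono) auto
      ultimately show "\<exists>C\<subseteq>Y m. finite C \<and> real (card C) \<le> (measure \<mu> UNIV + 1) * 2 powr (real n * s) \<and> Y m \<subseteq> (\<Union>c\<in>C. cball c (8 / 2 ^ n))"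
        by (meson order_trans)
    qed (auto intro: add_nonneg_pos)
  qed
  finally show ?thesis .
qed


text \<open>The measure of \<open>ball x r\<close> is lower semicontinuous in \<open>x\<close>: the
  balls of radius \<open>r - 1 / Suc n\<close> about a limit point exhaust \<open>ball x r\<close>,
  and each lies in the balls of radius \<open>r\<close> about sufficiently close points.\<close>

lemma closed_light:
  fixes \<mu> :: "'a::metric_space measure"
  assumes mu: "finite_measure \<mu>" "sets \<mu> = sets borel"
  shows "closed {x. measure \<mu> (ball x r) \<le> c}"
  unfolding closed_sequential_limits
proof (intro allI impI, elim conjE)
  fix f :: "nat \<Rightarrow> 'a" and x assume f: "\<forall>n. f n \<in> {x. measure \<mu> (ball x r) \<le> c}" and lim: "f \<longlonglongrightarrow> x"
  interpret finite_measure \<mu> by fact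
  have B: "ball y s \<in> sets \<mu>" for y s unfolding mu(2) by simp
  have "(\<lambda>n. measure \<mu> (ball x (r - 1 / real (Suc n)))) \<longlonglongrightarrow> measure \<mu> (\<Union>n. ball x (r - 1 / real (Suc n)))"
  proof (rule finite_Lim_measure_incseq)
    show "incseq (\<lambda>n. ball x (r - 1 / real (Suc n)))"
      unfolding incseq_def by (intro allI impI subset_ball diff_left_mono frac_le) auto
  qed (use B in auto)
  moreover have "(\<Union>n. ball x (r - 1 / real (Suc n))) = ball x r"
  proof
    show "ball x r \<subseteq> (\<Union>n. ball x (r - 1 / real (Suc n)))"
    proof
      fix y assume "y \<in> ball x r"
      then have "0 < r - dist x y" by simp
      from reals_Archimedean[OF this] obtain n where "inverse (real (Suc n)) < r - dist x y" by auto
      then have "y \<in> ball x (r - 1 / real (Suc n))" by (simp add: inverse_eq_divide)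
      then show "y \<in> (\<Union>n. ball x (r - 1 / real (Suc n)))" by blast
    qed
    show "(\<Union>n. ball x (r - 1 / real (Suc n))) \<subseteq> ball x r"
      by (intro UN_least subset_ball) simp
  qed
  ultimately have L: "(\<lambda>n. measure \<mu> (ball x (r - 1 / real (Suc n)))) \<longlonglongrightarrow> measure \<mu> (ball x r)" by simp
  have "measure \<mu> (ball x (r - 1 / real (Suc n))) \<le> c" for n
  proof -
    have "\<forall>\<^sub>F k in sequentially. dist (f k) x < 1 / real (Suc n)" using lim by (intro tendstoD) auto
    then obtain k where k: "dist (f k) x < 1 / real (Suc n)" using eventually_happens'[OF sequentially_bot] by blast
    have "ball x (r - 1 / real (Suc n)) \<subseteq> ball (f k) r"
    proof
      fix y assume "y \<in> ball x (r - 1 / real (Suc n))"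
      then show "y \<in> ball (f k) r" using dist_triangle[of "f k" y x] k by simp
    qed
    then have "measure \<mu> (ball x (r - 1 / real (Suc n))) \<le> measure \<mu> (ball (f k) r)"
      using B by (intro finite_measure_mono) auto
    also have "\<dots> \<le> c" using f by auto
    finally show ?thesis .
  qed
  then have "measure \<mu> (ball x r) \<le> c" by (intro LIMSEQ_le_const2[OF L]) auto
  then show "x \<in> {x. measure \<mu> (ball x r) \<le> c}" by simp
qed

text \<open>Egorov's argument: condition \<open>q\<close> may cost
  \<open>\<epsilon> * (1/2) ^ Suc q\<close>, and the intersection over all \<open>q\<close> is still
  closed.\<close>

lemma closed_egorov:
  fixes \<mu> :: "'a::topological_space measure" and S :: "nat \<Rightarrow> nat \<Rightarrow> 'a set"
  assumes mu: "finite_measure \<mu>" "sets \<mu> = sets borel" and \<epsilon>: "0 < \<epsilon>"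
    and S: "\<And>q m. closed (S q m)" "\<And>q. incseq (S q)" "\<And>q. emeasure \<mu> (- (\<Union>m. S q m)) = 0"
  shows "\<exists>E. closed E \<and> measure \<mu> (- E) \<le> \<epsilon> \<and> (\<forall>q. \<exists>m. E \<subseteq> S q m)"
proof -
  interpret finite_measure \<mu> by fact
  have B: "- S q m \<in> sets \<mu>" for q m using S(1) unfolding mu(2) by auto
  have "\<exists>m. measure \<mu> (- S q m) < \<epsilon> * (1/2) ^ Suc q" for q
  proof -
    have "(\<lambda>m. measure \<mu> (- S q m)) \<longlonglongrightarrow> measure \<mu> (\<Inter>m. - S q m)"
      by (rule finite_Lim_measure_decseq) (use B S(2) in \<open>auto simp: decseq_def incseq_def\<close>)
    moreover have "measure \<mu> (\<Inter>m. - S q m) = 0"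
    proof -
      have eq: "(\<Inter>m. - S q m) = - (\<Union>m. S q m)" by blast
      show ?thesis unfolding eq measure_def S(3) by simp
    qed
    ultimately have "(\<lambda>m. measure \<mu> (- S q m)) \<longlonglongrightarrow> 0" by simp
    then have "\<forall>\<^sub>F m in sequentially. measure \<mu> (- S q m) < \<epsilon> * (1/2) ^ Suc q"
      using \<epsilon> by (intro order_tendstoD(2)) auto
    then show ?thesis using eventually_happens'[OF sequentially_bot] by blast
  qed
  then have "\<forall>q. \<exists>m. measure \<mu> (- S q m) < \<epsilon> * (1/2) ^ Suc q" by blast
  from choice[OF this] obtain m where "\<forall>q. measure \<mu> (- S q (m q)) < \<epsilon> * (1/2) ^ Suc q" ..
  then have m: "measure \<mu> (- S q (m q)) < \<epsilon> * (1/2) ^ Suc q" for q ..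
  define E where "E = (\<Inter>q. S q (m q))"
  have half: "(\<lambda>q. \<epsilon> * (1/2) ^ Suc q) sums \<epsilon>"
    using sums_mult[OF power_half_series, of \<epsilon>] by simp
  have summ: "summable (\<lambda>q. measure \<mu> (- S q (m q)))"
    using m by (intro summable_comparison_test'[OF sums_summable[OF half], of 0]) (auto simp: less_imp_le)
  have "- E = (\<Union>q. - S q (m q))" unfolding E_def by auto
  then have "measure \<mu> (- E) \<le> (\<Sum>q. measure \<mu> (- S q (m q)))"
    using finite_measure_subadditive_countably[of "\<lambda>q. - S q (m q)"] summ B by auto
  also have "\<dots> \<le> (\<Sum>q. \<epsilon> * (1/2) ^ Suc q)"
    using m by (intro suminf_le summ sums_summable[OF half]) (auto simp: less_imp_le)
  also have "\<dots> = \<epsilon>" using half by (simp add: sums_iff)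
  finally have "measure \<mu> (- E) \<le> \<epsilon>" .
  moreover have "closed E" unfolding E_def using S(1) by auto
  moreover have "\<forall>q. \<exists>m. E \<subseteq> S q m" unfolding E_def by blast
  ultimately show ?thesis by blast
qed

section \<open>Closed sets of almost full measure on which the local mass is small\<close>

lemma null_of_dim_less:
  assumes "B \<in> sets borel" "Dim B < measure_dim Dim \<mu>"
  shows "emeasure \<mu> B = 0"
proof (rule ccontr)
  assume "emeasure \<mu> B \<noteq> 0"
  then have "measure_dim Dim \<mu> \<le> Dim B"
    unfolding measure_dim_def using assms(1) by (intro Inf_lower) (auto simp: zero_less_iff_neq_zero)
  then show False using assms(2) by simp
qed

lemma rat_below:
  assumes "ereal s < a"
  obtains q where "s < real_of_rat (nat_to_rat_surj q)" "ereal (real_of_rat (nat_to_rat_surj q)) < a"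
proof -
  obtain t where t: "ereal s < ereal t" "ereal t < a" using ereal_dense2[OF assms] by auto
  then obtain r where r: "s < real_of_rat r" "real_of_rat r < t" using of_rat_dense[of s t] by auto
  obtain q where "r = nat_to_rat_surj q" using surj_nat_to_rat_surj by (metis surj_def)
  then show thesis using that[of q] r t(2) by (metis ereal_less_eq(3) less_imp_le order.strict_trans1)
qed

lemma light_mono: "light \<mu> r n x \<Longrightarrow> s \<le> r \<Longrightarrow> light \<mu> s n x"
  by (erule order_trans) (auto intro!: powr_mono mult_left_mono)

text \<open>The exponents form a continuum, but the rational ones suffice because lightness is
  monotone in the exponent. For each of these the points that are heavy infinitely often form a set
  of dimension below that of \<mu>, hence a null set.\<close>

lemma uniformly_light_hausdorff:
  fixes \<mu> :: "'a::metric_space measure"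
  assumes mu: "finite_measure \<mu>" "sets \<mu> = sets borel" and \<epsilon>: "0 < \<epsilon>"
  shows "\<exists>E. closed E \<and> measure \<mu> (- E) \<le> \<epsilon> \<and>
    (\<forall>s. 0 \<le> s \<and> ereal s < measure_dim hausdorff_dim \<mu> \<longrightarrow> (\<exists>m. \<forall>x\<in>E. \<forall>n\<ge>m. light \<mu> s n x))"
proof -
  define r where "r = (\<lambda>q. real_of_rat (nat_to_rat_surj q))"
  define ok where "ok = (\<lambda>q. 0 \<le> r q \<and> ereal (r q) < measure_dim hausdorff_dim \<mu>)"
  \<comment> \<open>Rational exponents outside the admissible range impose no condition.\<close>
  define S where "S = (\<lambda>q m. if ok q then {x. \<forall>n\<ge>m. light \<mu> (r q) n x} else UNIV)"
  have cl: "closed {x. \<forall>n\<ge>m. light \<mu> s n x}" for m :: nat and s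
  proof -
    have "{x. \<forall>n\<ge>m. light \<mu> s n x} = (\<Inter>n\<in>{m..}. {x. light \<mu> s n x})" by auto
    then show ?thesis using closed_light[OF mu] by auto
  qed
  have "\<exists>E. closed E \<and> measure \<mu> (- E) \<le> \<epsilon> \<and> (\<forall>q. \<exists>m. E \<subseteq> S q m)"
  proof (rule closed_egorov[OF mu \<epsilon>])
    show "closed (S q m)" for q m unfolding S_def using cl by auto
    show "incseq (S q)" for q unfolding S_def incseq_def by auto
    fix q
    show "emeasure \<mu> (- (\<Union>m. S q m)) = 0"
    proof (cases "ok q")
      case True
      have eq: "- (\<Union>m. S q m) = {x. \<forall>m. \<exists>n\<ge>m. \<not> light \<mu> (r q) n x}"
        using True unfolding S_def by auto
      obtain t where t: "ereal (r q) < ereal t" "ereal t < measure_dim hausdorff_dim \<mu>"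
        using True ereal_dense2 unfolding ok_def by blast
      show ?thesis
      proof (rule null_of_dim_less)
        have "closed (S q m)" for m unfolding S_def using cl by auto
        then have "(\<Union>m. S q m) \<in> sets borel" by auto
        then show "- (\<Union>m. S q m) \<in> sets borel" by (rule borel_comp)
        have "hausdorff_dim (- (\<Union>m. S q m)) \<le> ereal t"
          unfolding eq by (rule hausdorff_dim_frequently_heavy[OF mu]) (use True t in \<open>auto simp: ok_def\<close>)
        then show "hausdorff_dim (- (\<Union>m. S q m)) < measure_dim hausdorff_dim \<mu>" using t(2) by (rule order.strict_trans1)
      qed
    qed (auto simp: S_def)
  qed
  then obtain E where E: "closed E" "measure \<mu> (- E) \<le> \<epsilon>" "\<And>q. \<exists>m. E \<subseteq> S q m" by blast
  have "\<exists>m. \<forall>x\<in>E. \<forall>n\<ge>m. light \<mu> s n x" if s: "0 \<le> s" "ereal s < measure_dim hausdorff_dim \<mu>" for s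
  proof -
    obtain q where q: "s < r q" "ereal (r q) < measure_dim hausdorff_dim \<mu>"
      unfolding r_def by (rule rat_below[OF s(2)])
    then have "ok q" unfolding ok_def using s by auto
    then obtain m where "E \<subseteq> {x. \<forall>n\<ge>m. light \<mu> (r q) n x}" using E(3)[of q] unfolding S_def by auto
    then have "\<forall>x\<in>E. \<forall>n\<ge>m. light \<mu> s n x" using light_mono[OF _ less_imp_le[OF q(1)]] by blast
    then show ?thesis by blast
  qed
  then show ?thesis using E by blast
qed

text \<open>Lightness at infinitely many levels is a countable intersection of increasing unions.
  The index \<open>p\<close> therefore codes a pair \<open>(q, m)\<close>: for each exponent and
  each start \<open>m\<close> a light level is sought between \<open>m\<close> and \<open>k\<close>,
  with \<open>k\<close> growing.\<close>

lemma frequently_light_packing: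
  fixes \<mu> :: "'a::metric_space measure"
  assumes cpt: "compact (UNIV :: 'a set)" and mu: "finite_measure \<mu>" "sets \<mu> = sets borel" and \<epsilon>: "0 < \<epsilon>"
  shows "\<exists>E. closed E \<and> measure \<mu> (- E) \<le> \<epsilon> \<and>
    (\<forall>s. 0 \<le> s \<and> ereal s < measure_dim packing_dim \<mu> \<longrightarrow> (\<forall>m. \<forall>x\<in>E. \<exists>n\<ge>m. light \<mu> s n x))"
proof -
  define r where "r = (\<lambda>q. real_of_rat (nat_to_rat_surj q))"
  define ok where "ok = (\<lambda>q. 0 \<le> r q \<and> ereal (r q) < measure_dim packing_dim \<mu>)"
  define S where "S = (\<lambda>p k. if ok (fst (prod_decode p))
      then {x. \<exists>n\<in>{snd (prod_decode p)..k}. light \<mu> (r (fst (prod_decode p))) n x} else UNIV)"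
  have cl: "closed {x. \<exists>n\<in>{m..k}. light \<mu> s n x}" for m k :: nat and s
  proof -
    have "{x. \<exists>n\<in>{m..k}. light \<mu> s n x} = (\<Union>n\<in>{m..k}. {x. light \<mu> s n x})" by auto
    then show ?thesis using closed_light[OF mu] by (auto intro!: closed_UN)
  qed
  have "\<exists>E. closed E \<and> measure \<mu> (- E) \<le> \<epsilon> \<and> (\<forall>p. \<exists>k. E \<subseteq> S p k)"
  proof (rule closed_egorov[OF mu \<epsilon>])
    show "closed (S p k)" for p k unfolding S_def using cl by auto
    show "incseq (S p)" for p unfolding S_def incseq_def by fastforce
    fix p
    obtain q m where p: "prod_decode p = (q, m)" by fastforce
    show "emeasure \<mu> (- (\<Union>k. S p k)) = 0"
    proof (cases "ok q")
      case True
      have sub: "- (\<Union>k. S p k) \<subseteq> {x. \<exists>m. \<forall>n\<ge>m. \<not> light \<mu> (r q) n x}"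
      proof
        fix x assume "x \<in> - (\<Union>k. S p k)"
        then have x: "\<not> light \<mu> (r q) n x" if "n \<in> {m..k}" for n k
          using True p that unfolding S_def by auto
        have "\<forall>n\<ge>m. \<not> light \<mu> (r q) n x" using x[of _ "_"] by (metis atLeastAtMost_iff order_refl)
        then show "x \<in> {x. \<exists>m. \<forall>n\<ge>m. \<not> light \<mu> (r q) n x}" by blast
      qed
      show ?thesis
      proof (rule null_of_dim_less)
        have "closed (S p k)" for k unfolding S_def using cl by auto
        then have "(\<Union>k. S p k) \<in> sets borel" by auto
        then show "- (\<Union>k. S p k) \<in> sets borel" by (rule borel_comp)
        have "packing_dim (- (\<Union>k. S p k)) \<le> packing_dim {x. \<exists>m. \<forall>n\<ge>m. \<not> light \<mu> (r q) n x}"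
          by (rule packing_dim_mono[OF cpt sub])
        also have "\<dots> \<le> ereal (r q)"
          by (rule packing_dim_eventually_heavy[OF cpt mu]) (use True in \<open>auto simp: ok_def\<close>)
        also have "\<dots> < measure_dim packing_dim \<mu>" using True unfolding ok_def by simp
        finally show "packing_dim (- (\<Union>k. S p k)) < measure_dim packing_dim \<mu>" .
      qed
    qed (auto simp: S_def p)
  qed
  then obtain E where E: "closed E" "measure \<mu> (- E) \<le> \<epsilon>" "\<And>p. \<exists>k. E \<subseteq> S p k" by blast
  have "\<exists>n\<ge>m. light \<mu> s n x" if s: "0 \<le> s" "ereal s < measure_dim packing_dim \<mu>" and x: "x \<in> E" for s m x
  proof -
    obtain q where q: "s < r q" "ereal (r q) < measure_dim packing_dim \<mu>"
      unfolding r_def by (rule rat_below[OF s(2)])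
    then have "ok q" unfolding ok_def using s by auto
    obtain k where "E \<subseteq> S (prod_encode (q, m)) k" using E(3) by blast
    then have "E \<subseteq> {x. \<exists>n\<in>{m..k}. light \<mu> (r q) n x}" using \<open>ok q\<close> unfolding S_def by simp
    then have "x \<in> {x. \<exists>n\<in>{m..k}. light \<mu> (r q) n x}" using x by (rule subsetD)
    then have "\<exists>n\<ge>m. light \<mu> (r q) n x" by fastforce
    then show ?thesis using light_mono[OF _ less_imp_le[OF q(1)]] by blast
  qed
  then show ?thesis using E by blast
qed

section \<open>A summability kernel\<close>

text \<open>The power of the cosine is normalised to have constant Fourier coefficient 1. Unlike the Fejer
  kernel it decays exponentially away from 0, so that a product over the coordinates is small as soon
  as one coordinate is far from 0.\<close>

definition cosker :: "nat \<Rightarrow> real \<Rightarrow> real" where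
  "cosker N z = 4 ^ N / real ((2 * N) choose N) * cos (z / 2) ^ (2 * N)"

text \<open>The Fourier coefficients of \<open>cosker N\<close>: binomial coefficients of order
  \<open>2 * N\<close>, recentred at the middle one and divided by it. They lie in the unit interval
  and tend to 1 for fixed \<open>j\<close>, as a summability method requires.\<close>

definition wt :: "nat \<Rightarrow> int \<Rightarrow> real" where
  "wt N j = (if \<bar>j\<bar> \<le> int N then real ((2 * N) choose nat (int N + j)) / real ((2 * N) choose N) else 0)"

lemma central_binomial_pos: "0 < real ((2 * N) choose N)"
  by simp

lemma wt_nonneg: "0 \<le> wt N j"
  by (simp add: wt_def)

lemma wt_le_1: "wt N j \<le> 1"
  using central_binomial_pos[of N] binomial_maximum'[of N "nat (int N + j)"]
  by (auto simp: wt_def divide_simps)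

lemma wt_uminus: "wt N (- j) = wt N j"
proof (cases "\<bar>j\<bar> \<le> int N")
  case True
  have "nat (int N - j) \<le> 2 * N" "2 * N - nat (int N - j) = nat (int N + j)"
    using True by auto
  then have "(2 * N) choose nat (int N - j) = (2 * N) choose nat (int N + j)"
    using binomial_symmetric[of "nat (int N - j)" "2 * N"] by simp
  then show ?thesis using True by (simp add: wt_def)
qed (auto simp: wt_def)

lemma wt_Suc:
  assumes "Suc j \<le> N"
  shows "wt N (int (Suc j)) = wt N (int j) * ((real N - real j) / (real N + real j + 1))"
proof -
  obtain b where b: "N = Suc (j + b)"
    using assms by (metis add_Suc le_iff_add)
  have "Suc (N + j) * (Suc ((N + j) + b) choose Suc (N + j)) = Suc b * (Suc ((N + j) + b) choose (N + j))"
    by (rule Suc_times_binomial_add)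
  moreover have "Suc ((N + j) + b) = 2 * N" using b by simp
  ultimately have "Suc (N + j) * ((2 * N) choose Suc (N + j)) = Suc b * ((2 * N) choose (N + j))" by simp
  then have "real (Suc (N + j)) * real ((2 * N) choose Suc (N + j)) = real (Suc b) * real ((2 * N) choose (N + j))"
    by (metis of_nat_mult)
  moreover have "real (Suc b) = real N - real j" using b by simp
  ultimately have "(real N + real j + 1) * real ((2 * N) choose Suc (N + j)) = (real N - real j) * real ((2 * N) choose (N + j))"
    by (simp add: add_ac)
  then have "real ((2 * N) choose Suc (N + j)) = real ((2 * N) choose (N + j)) * ((real N - real j) / (real N + real j + 1))"
    by (simp add: field_simps)
  moreover have "nat (int N + int (Suc j)) = Suc (N + j)" "nat (int N + int j) = N + j" by auto
  ultimately show ?thesis using assms unfolding wt_def by simp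
qed

text \<open>The ratio of neighbouring coefficients tends to 1, so the limit passes from
  \<open>j\<close> to \<open>Suc j\<close>.\<close>

lemma wt_tendsto_nat: "(\<lambda>N. wt N (int j)) \<longlonglongrightarrow> 1"
proof (induction j)
  case 0
  have "wt N 0 = 1" for N by (simp add: wt_def)
  then show ?case by simp
next
  case (Suc j)
  have "(\<lambda>N. (real N - real j) / (real N + real j + 1)) \<longlonglongrightarrow> 1"
    by real_asymp
  from tendsto_mult[OF Suc this]
  have "(\<lambda>N. wt N (int j) * ((real N - real j) / (real N + real j + 1))) \<longlonglongrightarrow> 1" by simp
  moreover have "\<forall>\<^sub>F N in sequentially. wt N (int j) * ((real N - real j) / (real N + real j + 1)) = wt N (int (Suc j))"
    using eventually_ge_at_top[of "Suc j"] by eventually_elim (metis wt_Suc)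
  ultimately show ?case by (rule Lim_transform_eventually)
qed

lemma wt_tendsto: "(\<lambda>N. wt N j) \<longlonglongrightarrow> 1"
  by (cases j rule: int_cases2) (use wt_tendsto_nat wt_uminus in auto)

text \<open>Euler's formula and the binomial theorem; only integer frequencies occur because the
  exponent is even.\<close>

lemma cosker_fourier: "complex_of_real (cosker N z) = (\<Sum>j\<in>{- int N..int N}. wt N j * cis (of_int j * z))"
proof -
  have "complex_of_real (cos (z / 2)) = (cis (z / 2) + cis (- (z / 2))) / 2"
    by (simp add: complex_eq_iff)
  then have "complex_of_real (4 ^ N * cos (z / 2) ^ (2 * N)) = 4 ^ N * ((cis (z / 2) + cis (- (z / 2))) / 2) ^ (2 * N)"
    by (simp only: of_real_mult of_real_power of_real_numeral)
  also have "\<dots> = (cis (z / 2) + cis (- (z / 2))) ^ (2 * N)"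
    by (simp add: power_divide power_mult)
  also have "\<dots> = (\<Sum>k\<le>2 * N. of_nat ((2 * N) choose k) * cis (z / 2) ^ k * cis (- (z / 2)) ^ (2 * N - k))"
    by (rule binomial_ring)
  also have "\<dots> = (\<Sum>k\<le>2 * N. of_nat ((2 * N) choose k) * cis (of_int (int k - int N) * z))"
  proof (rule sum.cong[OF refl])
    fix k assume "k \<in> {..2 * N}"
    then have "real k * (z / 2) + real (2 * N - k) * (- (z / 2)) = of_int (int k - int N) * z"
      by (auto simp: of_nat_diff field_simps)
    then have "cis (z / 2) ^ k * cis (- (z / 2)) ^ (2 * N - k) = cis (of_int (int k - int N) * z)"
      by (simp only: Complex.DeMoivre cis_mult)
    then show "of_nat ((2 * N) choose k) * cis (z / 2) ^ k * cis (- (z / 2)) ^ (2 * N - k) =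
        of_nat ((2 * N) choose k) * cis (of_int (int k - int N) * z)" by (metis mult.assoc)
  qed
  also have "\<dots> = (\<Sum>j\<in>{- int N..int N}. of_nat ((2 * N) choose nat (int N + j)) * cis (of_int j * z))"
    by (rule sum.reindex_bij_witness[of _ "\<lambda>j. nat (int N + j)" "\<lambda>k. int k - int N"]) auto
  finally have *: "complex_of_real (4 ^ N * cos (z / 2) ^ (2 * N)) =
    (\<Sum>j\<in>{- int N..int N}. of_nat ((2 * N) choose nat (int N + j)) * cis (of_int j * z))" .
  have "complex_of_real (cosker N z) = complex_of_real (4 ^ N * cos (z / 2) ^ (2 * N)) / of_nat ((2 * N) choose N)"
    by (simp add: cosker_def)
  also have "\<dots> = (\<Sum>j\<in>{- int N..int N}. wt N j * cis (of_int j * z))"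
    unfolding * sum_divide_distrib by (rule sum.cong) (auto simp: wt_def)
  finally show ?thesis .
qed

lemma cosker_nonneg: "0 \<le> cosker N z"
  by (simp add: cosker_def power_mult)

lemma cosker_le:
  assumes "\<bar>cos (z / 2)\<bar> \<le> q" "0 < N"
  shows "cosker N z \<le> 2 * real N * q ^ (2 * N)"
proof -
  have "4 ^ N / real ((2 * N) choose N) \<le> 2 * real N"
    using central_binomial_lower_bound[OF assms(2)] assms(2) central_binomial_pos[of N] by (simp add: field_simps)
  moreover have "cos (z / 2) ^ (2 * N) \<le> q ^ (2 * N)"
    using power_mono[OF assms(1), of "2 * N"] by (simp add: power_even_abs)
  ultimately show ?thesis
    unfolding cosker_def by (intro mult_mono) (auto simp: power_mult)
qed

text \<open>This gives the kernel a peak of height at least \<open>sqrt (2 * N + 1)\<close>; squares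
  avoid the root. The induction step amounts to
  \<open>(2 * N + 1) * (2 * N + 3) \<le> (2 * N + 2) ^ 2\<close>.\<close>

lemma central_binomial_upper: "real ((2 * N) choose N) ^ 2 * (2 * real N + 1) \<le> (4 ^ N) ^ 2"
proof (induction N)
  case (Suc N)
  have "Suc N * (Suc (Suc N + N) choose Suc N) = Suc (Suc N + N) * ((Suc N + N) choose N)"
    using Suc_times_binomial[of N "Suc N + N"] by simp
  moreover have "Suc N * (Suc (N + N) choose Suc N) = Suc (N + N) * ((N + N) choose N)"
    using Suc_times_binomial[of N "N + N"] by simp
  moreover have "(Suc N + N) choose N = (Suc N + N) choose Suc N"
    using binomial_symmetric[of N "Suc N + N"] by simp
  moreover define a b c where "a = (2 * Suc N) choose Suc N" "b = (2 * N) choose N" "c = (Suc N + N) choose N"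
  ultimately have "Suc N * a = (2 * Suc N) * c" "Suc N * c = (2 * N + 1) * b"
    by (simp_all add: mult_2 del: binomial_Suc_Suc)
  then have "real (Suc N) * real a = real (2 * Suc N) * real c" "real (Suc N) * real c = real (2 * N + 1) * real b"
    by (metis of_nat_mult)+
  then have "(real N + 1) * (real a - 2 * real c) = 0" "(real N + 1) * real c = (2 * real N + 1) * real b"
    by (simp_all add: algebra_simps)
  then have "real a = 2 * real c" "(real N + 1) * real c = (2 * real N + 1) * real b"
    by simp_all
  then have "real a = 2 * (2 * real N + 1) / (real N + 1) * real b"
    by (simp add: field_simps)
  then have "real ((2 * Suc N) choose Suc N) = 2 * (2 * real N + 1) / (real N + 1) * real ((2 * N) choose N)" (is "?a = ?r * ?b")
    unfolding a_b_c_def .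
  then have "?a ^ 2 * (2 * real (Suc N) + 1) = (?b ^ 2 * (2 * real N + 1)) * (4 * (2 * real N + 1) * (2 * real N + 3) / (real N + 1)^2)"
    by (simp only: power_mult_distrib power_divide power2_eq_square) (simp add: algebra_simps del: binomial_Suc_Suc)
  also have "\<dots> \<le> (4 ^ N)^2 * 16"
  proof (rule mult_mono[OF Suc])
    show "4 * (2 * real N + 1) * (2 * real N + 3) / (real N + 1)^2 \<le> 16"
      by (subst pos_divide_le_eq, simp, simp add: power2_eq_square algebra_simps)
  qed auto
  finally show ?case by (simp add: power2_eq_square)
qed simp

text \<open>The kernel of order \<open>N\<close> has a peak of height about \<open>sqrt N\<close>
  and width about \<open>1 / sqrt N\<close>; the order \<open>m ^ 2\<close> turns both into powers
  of \<open>m\<close>. On the window Bernoulli's inequality loses only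
  \<open>2 * m ^ 2 / (8 * m ^ 2) = 1 / 4\<close>.\<close>

lemma cosker_ge:
  assumes "\<bar>z\<bar> \<le> 1 / real m" "0 < m"
  shows "real m / 2 \<le> cosker (m ^ 2) z"
proof -
  let ?N = "m ^ 2"
  have "(real m * real ((2 * ?N) choose ?N)) ^ 2 \<le> real ((2 * ?N) choose ?N) ^ 2 * (2 * real ?N + 1)"
    by (simp add: power_mult_distrib algebra_simps)
  also have "\<dots> \<le> (4 ^ ?N) ^ 2" by (rule central_binomial_upper)
  finally have "real m * real ((2 * ?N) choose ?N) \<le> 4 ^ ?N"
    by (rule power2_le_imp_le) simp
  then have 1: "real m \<le> 4 ^ ?N / real ((2 * ?N) choose ?N)"
    by (simp add: field_simps)
  have z2: "z ^ 2 \<le> 1 / real m ^ 2"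
    using power_mono[OF assms(1), of 2] by (simp add: power_divide)
  have "1 - 1 / (8 * real m ^ 2) \<le> 1 - z ^ 2 / 8" using z2 by simp
  also have "\<dots> = 1 - (z / 2) ^ 2 / 2" by (simp add: power_divide)
  also have "\<dots> \<le> cos (z / 2)"
  proof -
    have "sin (z/4) ^ 2 \<le> (z/4)^2"
      using abs_sin_x_le_abs_x[of "z/4"] abs_le_square_iff by blast
    moreover have "cos (z/2) = 1 - 2 * sin (z/4)^2"
      using cos_double_sin[of "z/4"] by simp
    ultimately show ?thesis by (simp add: power_divide)
  qed
  finally have c: "1 - 1 / (8 * real m ^ 2) \<le> cos (z / 2)" .
  have m1: "1 / (8 * real m ^ 2) \<le> 1 / 8"
    using assms(2) by (simp add: field_simps)
  have "1 / 2 \<le> 1 - real (2 * ?N) * (1 / (8 * real m ^ 2))" using assms(2) by simp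
  also have "\<dots> = 1 + real (2 * ?N) * (- (1 / (8 * real m ^ 2)))" by simp
  also have "\<dots> \<le> (1 + (- (1 / (8 * real m ^ 2)))) ^ (2 * ?N)"
    by (rule Bernoulli_inequality) (use m1 in simp)
  also have "\<dots> \<le> cos (z / 2) ^ (2 * ?N)"
    by (rule power_mono) (use c m1 in auto)
  finally have 2: "1 / 2 \<le> cos (z / 2) ^ (2 * ?N)" .
  have "real m * (1 / 2) \<le> 4 ^ ?N / real ((2 * ?N) choose ?N) * cos (z / 2) ^ (2 * ?N)"
    by (rule mult_mono[OF 1 2]) auto
  then show ?thesis by (simp add: cosker_def)
qed

section \<open>The product kernel in several variables\<close>

definition kern :: "nat \<Rightarrow> real ^ 'n \<Rightarrow> real" where
  "kern N v = (\<Prod>i\<in>UNIV. cosker N (v $ i))"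

definition Wt :: "nat \<Rightarrow> ('n::finite \<Rightarrow> int) \<Rightarrow> real" where
  "Wt N k = (\<Prod>i\<in>UNIV. wt N (k i))"

definition int_box :: "nat \<Rightarrow> ('n::finite \<Rightarrow> int) set" where
  "int_box N = {k. \<forall>i. \<bar>k i\<bar> \<le> int N}"

lemma int_box_PiE: "int_box N = (\<Pi>\<^sub>E i\<in>UNIV. {- int N..int N})"
  by (auto simp: int_box_def PiE_def Pi_def abs_le_iff) (metis minus_le_iff)+

lemma finite_int_box [simp]: "finite (int_box N)"
  unfolding int_box_PiE by (intro finite_PiE) auto

lemma card_int_box: "card (int_box N :: ('n::finite \<Rightarrow> int) set) = (2 * N + 1) ^ CARD('n)"
  unfolding int_box_PiE by (simp add: card_PiE nat_add_distrib nat_mult_distrib)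

lemma Wt_nonneg: "0 \<le> Wt N k"
  unfolding Wt_def by (intro prod_nonneg) (auto simp: wt_nonneg)

lemma Wt_le_1: "Wt N k \<le> 1"
  unfolding Wt_def by (intro prod_le_1) (auto simp: wt_nonneg wt_le_1)

lemma Wt_eq_0: "k \<notin> int_box N \<Longrightarrow> Wt N k = 0"
  by (auto simp: Wt_def int_box_def wt_def)

lemma Wt_tendsto: "(\<lambda>N. Wt N k) \<longlonglongrightarrow> 1"
proof -
  have "(\<lambda>N. \<Prod>i\<in>UNIV. wt N (k i)) \<longlonglongrightarrow> (\<Prod>i\<in>(UNIV::'a set). 1)"
    by (intro tendsto_prod wt_tendsto)
  then show ?thesis unfolding Wt_def by simp
qed

lemma cis_sum: "finite S \<Longrightarrow> cis (sum f S) = (\<Prod>i\<in>S. cis (f i))"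
  by (induction S rule: finite_induct) (auto simp: cis_mult[symmetric])

lemma kern_fourier:
  "complex_of_real (kern N v) = (\<Sum>k\<in>int_box N. Wt N k * cis ((\<chi> i. real_of_int (k i)) \<bullet> v))"
proof -
  have "complex_of_real (kern N v) = (\<Prod>i\<in>UNIV. \<Sum>j\<in>{- int N..int N}. wt N j * cis (of_int j * v $ i))"
    unfolding kern_def by (simp add: cosker_fourier)
  also have "\<dots> = (\<Sum>k\<in>int_box N. \<Prod>i\<in>UNIV. wt N (k i) * cis (of_int (k i) * v $ i))"
    unfolding int_box_PiE by (rule prod_sum_PiE) auto
  also have "\<dots> = (\<Sum>k\<in>int_box N. Wt N k * cis ((\<chi> i. real_of_int (k i)) \<bullet> v))"
    by (simp add: prod.distrib Wt_def inner_vec_def cis_sum)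
  finally show ?thesis .
qed

lemma kern_nonneg: "0 \<le> kern N v"
  unfolding kern_def by (intro prod_nonneg) (auto simp: cosker_nonneg)

lemma kern_ge:
  fixes v :: "real ^ 'n"
  assumes "\<And>i. \<bar>v $ i\<bar> \<le> 1 / real m" "0 < m"
  shows "(real m / 2) ^ CARD('n) \<le> kern (m ^ 2) v"
proof -
  have "(\<Prod>i\<in>(UNIV::'n set). real m / 2) \<le> kern (m ^ 2) v"
    unfolding kern_def by (rule prod_mono) (use cosker_ge[OF assms(1) assms(2)] in auto)
  then show ?thesis by simp
qed

text \<open>Since 3 is less than \<open>pi\<close>, half the argument stays where the cosine is
  nonnegative and decreasing, so the next peak of the periodic kernel is not met.\<close>

lemma cos_half_le:
  fixes z :: real
  assumes "\<rho> \<le> \<bar>z\<bar>" "\<bar>z\<bar> \<le> 3" "0 < \<rho>"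
  shows "\<bar>cos (z / 2)\<bar> \<le> cos (\<rho> / 2)"
proof -
  have "cos (\<bar>z\<bar> / 2) \<le> cos (\<rho> / 2)"
    using assms pi_gt3 by (subst cos_mono_le_eq) auto
  moreover have "cos (\<bar>z\<bar> / 2) = cos (z / 2)" by (cases "z \<ge> 0") auto
  moreover have "0 \<le> cos (\<bar>z\<bar> / 2)"
    using assms pi_gt3 by (intro cos_ge_zero) auto
  ultimately show ?thesis by simp
qed

text \<open>One coordinate away from 0 makes the whole product small: it contributes the exponential
  factor, and each of the others is at most \<open>2 * real N\<close>.\<close>

lemma kern_le:
  fixes v :: "real ^ 'n"
  assumes "\<rho> \<le> \<bar>v $ i\<bar>" "\<And>i. \<bar>v $ i\<bar> \<le> 3" "0 < \<rho>" "0 < N"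
  shows "kern N v \<le> (2 * real N) ^ CARD('n) * cos (\<rho> / 2) ^ (2 * N)"
proof -
  have "kern N v = cosker N (v $ i) * (\<Prod>j\<in>UNIV - {i}. cosker N (v $ j))"
    unfolding kern_def by (subst prod.remove[of _ i]) auto
  also have "\<dots> \<le> (2 * real N * cos (\<rho> / 2) ^ (2 * N)) * (\<Prod>j\<in>UNIV - {i}. 2 * real N)"
  proof (rule mult_mono)
    show "cosker N (v $ i) \<le> 2 * real N * cos (\<rho> / 2) ^ (2 * N)"
      by (intro cosker_le cos_half_le assms)
    have "cosker N z \<le> 2 * real N" for z
      using cosker_le[of z 1 N] assms by simp
    then show "(\<Prod>j\<in>UNIV - {i}. cosker N (v $ j)) \<le> (\<Prod>j\<in>UNIV - {i}. 2 * real N)"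
      by (intro prod_mono) (auto simp: cosker_nonneg)
    show "0 \<le> 2 * real N * cos (\<rho> / 2) ^ (2 * N)" by (simp add: power_mult)
  qed (auto intro!: prod_nonneg simp: cosker_nonneg)
  also have "\<dots> = (2 * real N * cos (\<rho> / 2) ^ (2 * N)) * (2 * real N) ^ (CARD('n) - 1)"
    by simp
  also have "\<dots> = (2 * real N * (2 * real N) ^ (CARD('n) - 1)) * cos (\<rho> / 2) ^ (2 * N)"
    by (simp only: mult_ac)
  also have "2 * real N * (2 * real N) ^ (CARD('n) - 1) = (2 * real N) ^ CARD('n)"
    by (metis power_eq_if zero_less_card_finite less_irrefl)
  finally show ?thesis .
qed

lemma kern_far_tendsto:
  assumes "0 < \<rho>" "\<rho> \<le> 3"
  shows "(\<lambda>N. (2 * real N) ^ d * cos (\<rho> / 2) ^ (2 * N)) \<longlonglongrightarrow> 0"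
proof -
  define q where "q = cos (\<rho> / 2) ^ 2"
  have "0 < cos (\<rho> / 2)" using assms pi_gt3 by (intro cos_gt_zero) auto
  moreover have "cos (\<rho> / 2) < 1"
    using cos_monotone_0_pi[of 0 "\<rho>/2"] assms pi_gt3 by auto
  ultimately have q: "0 < q" "q < 1" unfolding q_def
    by (auto simp: power_less_one_iff)
  have "(\<lambda>N. 2 ^ d * (real N ^ d * q ^ N)) \<longlonglongrightarrow> 2 ^ d * 0"
  proof (rule tendsto_mult_left)
    have "((\<lambda>N. real N ^ d * exp (- (- ln q * real N))) \<longlonglongrightarrow> 0)"
      using q by real_asymp
    moreover have "exp (- (- ln q * real N)) = q ^ N" for N
      using q by (simp add: mult.commute exp_of_nat_mult)
    ultimately show "(\<lambda>N. real N ^ d * q ^ N) \<longlonglongrightarrow> 0" by simp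
  qed
  then show ?thesis by (simp add: q_def power_mult power_mult_distrib mult.assoc)
qed

section \<open>Random functions on one scale\<close>

text \<open>Here the absence of atoms enters: the closed balls about \<open>x\<close> shrink to a
  null set.\<close>

lemma small_ball_measure:
  fixes \<mu> :: "'a::metric_space measure"
  assumes "finite_measure \<mu>" "sets \<mu> = sets borel" "emeasure \<mu> {x} = 0" "0 < \<epsilon>"
  obtains r where "0 < r" "measure \<mu> (cball x r) \<le> \<epsilon>"
proof -
  interpret finite_measure \<mu> by fact
  have "(\<lambda>n. measure \<mu> (cball x (1 / real (Suc n)))) \<longlonglongrightarrow> measure \<mu> (\<Inter>n. cball x (1 / real (Suc n)))"
  proof (rule finite_Lim_measure_decseq)
    show "decseq (\<lambda>n. cball x (1 / real (Suc n)))"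
      unfolding decseq_def by (intro allI impI subset_cball frac_le) auto
  qed (auto simp: assms(2))
  moreover have "(\<Inter>n. cball x (1 / real (Suc n))) = {x}"
  proof -
    have "y = x" if "\<And>n. dist x y \<le> 1 / real (Suc n)" for y
      using that reals_Archimedean[of "dist x y"] by (metis inverse_eq_divide leD zero_less_dist_iff)
    then show ?thesis by auto
  qed
  ultimately have "(\<lambda>n. measure \<mu> (cball x (1 / real (Suc n)))) \<longlonglongrightarrow> 0"
    using assms(3) by (simp add: measure_def)
  then have "\<forall>\<^sub>F n in sequentially. measure \<mu> (cball x (1 / real (Suc n))) < \<epsilon>"
    by (rule order_tendstoD) fact
  then obtain n where "measure \<mu> (cball x (1 / real (Suc n))) < \<epsilon>"
    using eventually_happens'[OF sequentially_bot] by blast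
  then show thesis by (intro that[of "1 / real (Suc n)"]) auto
qed

text \<open>Stick-breaking: \<open>q i\<close> takes its share of what the earlier ones have left
  over, so the shares add up to at most 1 if all \<open>q i\<close> lie between 0 and 1.\<close>

lemma sum_telescope_prod:
  fixes q :: "nat \<Rightarrow> 'b::comm_ring_1"
  shows "(\<Sum>i<k. q i * (\<Prod>j<i. 1 - q j)) = 1 - (\<Prod>j<k. 1 - q j)"
  by (induction k) (auto simp: algebra_simps)

text \<open>A partition of unity up to a set of small measure. What counts are the plateaus where
  one function is 1: each carries little mass, so that random phases attached to them average out,
  and together they miss little mass.\<close>

lemma measure_partition:
  fixes \<mu> :: "'a::metric_space measure"
  assumes cpt: "compact (UNIV :: 'a set)"
    and mu: "finite_measure \<mu>" "sets \<mu> = sets borel" "\<And>x. emeasure \<mu> {x} = 0" and \<epsilon>: "0 < \<epsilon>"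
  obtains k :: nat and p :: "nat \<Rightarrow> 'a \<Rightarrow> real" where
    "\<And>i. continuous_on UNIV (p i)" "\<And>i x. 0 \<le> p i x" "\<And>x. (\<Sum>i<k. p i x) \<le> 1"
    "\<And>i. i < k \<Longrightarrow> measure \<mu> {x. p i x = 1} \<le> \<epsilon>"
    "measure \<mu> {x. \<forall>i<k. p i x \<noteq> 1} \<le> \<epsilon>"
proof -
  interpret finite_measure \<mu> by fact
  have "\<exists>r>0. measure \<mu> (cball x r) \<le> \<epsilon>" for x
    using small_ball_measure[OF mu \<epsilon>] by metis
  then obtain r where r: "\<And>x. 0 < r x" "\<And>x. measure \<mu> (cball x (r x)) \<le> \<epsilon>"
    by metis
  have "UNIV \<subseteq> (\<Union>x\<in>UNIV. ball x (r x))" using r(1) by auto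
  then obtain C where C: "finite C" "UNIV \<subseteq> (\<Union>x\<in>C. ball x (r x))"
    using compactE_image[OF cpt, of UNIV "\<lambda>x. ball x (r x)"] by auto
  obtain c where c: "bij_betw c {0..<card C} C"
    using ex_bij_betw_nat_finite[OF C(1)] by blast
  define k where "k = card C"
  have cov: "\<exists>i<k. dist (c i) x < r (c i)" for x
  proof -
    obtain y where "y \<in> C" "dist y x < r y" using C(2) by (auto simp: subset_iff)
    moreover have "C = c ` {0..<k}" using c unfolding k_def bij_betw_def by simp
    ultimately show ?thesis by auto
  qed
  \<comment> \<open>The cutoff of ball \<open>i\<close> rises from 0 at its boundary to 1 at depth
    \<open>1 / Suc n\<close>.\<close>
  define q where "q = (\<lambda>n i x. max 0 (min 1 ((r (c i) - dist (c i) x) * real (Suc n))))"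
  \<comment> \<open>As the sum of the \<open>p n i\<close> is at most 1, the sets where one of them equals 1 are disjoint.\<close>
  define p where "p = (\<lambda>n i x. q n i x * (\<Prod>j<i. 1 - q n j x))"
  have q01: "0 \<le> q n i x" "q n i x \<le> 1" for n i x
    by (auto simp: q_def)
  have q1: "q n i x = 1 \<longleftrightarrow> 1 \<le> (r (c i) - dist (c i) x) * real (Suc n)" for n i x
  proof -
    have "max 0 (min 1 a) = 1 \<longleftrightarrow> 1 \<le> a" for a :: real by linarith
    then show ?thesis unfolding q_def .
  qed
  have q0: "q n i x = 0" if "r (c i) \<le> dist (c i) x" for n i x
  proof -
    have "(r (c i) - dist (c i) x) * real (Suc n) \<le> 0"
      using that by (intro mult_nonpos_nonneg) auto
    then show ?thesis by (simp add: q_def)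
  qed
  \<comment> \<open>The boundary layers of thickness \<open>1 / Suc n\<close>. There are finitely
    many balls, so the depths of a point in the balls that contain it have a positive minimum; hence
    the layers decrease to the empty set.\<close>
  define B where "B = (\<lambda>n. \<Union>i<k. {x. dist (c i) x < r (c i) \<and> (r (c i) - dist (c i) x) * real (Suc n) < 1})"
  have B_open: "open (B n)" for n
    unfolding B_def by (intro open_UN ballI open_Collect_conj open_Collect_less continuous_intros)
  have "(\<lambda>n. measure \<mu> (B n)) \<longlonglongrightarrow> measure \<mu> (\<Inter>n. B n)"
  proof (rule finite_Lim_measure_decseq)
    show "range B \<subseteq> sets \<mu>" using B_open mu(2) by auto
    have "(r (c i) - dist (c i) x) * real (Suc n) < 1"
      if "dist (c i) x < r (c i)" "(r (c i) - dist (c i) x) * real (Suc m) < 1" "n \<le> m" for i x n m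
    proof -
      have "(r (c i) - dist (c i) x) * real (Suc n) \<le> (r (c i) - dist (c i) x) * real (Suc m)"
        using that by (intro mult_left_mono) auto
      then show ?thesis using that by linarith
    qed
    then show "decseq B" unfolding decseq_def B_def by fastforce
  qed
  moreover have "(\<Inter>n. B n) = {}"
  proof -
    have False if xB: "\<forall>n. x \<in> B n" for x
    proof -
      have "finite {i. i < k \<and> dist (c i) x < r (c i)}" by auto
      define I where "I = {i. i < k \<and> dist (c i) x < r (c i)}"
      have I: "finite I" "I \<noteq> {}" using cov unfolding I_def by auto
      define m where "m = Min ((\<lambda>i. r (c i) - dist (c i) x) ` I)"
      have "0 < m" using I unfolding m_def I_def by (subst Min_gr_iff) auto
      then obtain n where n: "1 < m * real (Suc n)"
        using reals_Archimedean3 by (metis gr0_implies_Suc mult.commute not_less_eq of_nat_0 less_le_trans not_one_less_zero mult_zero_right zero_less_Suc linorder_not_less old.nat.exhaust)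
      obtain i where i: "i \<in> I" "(r (c i) - dist (c i) x) * real (Suc n) < 1"
        using xB[rule_format, of n] unfolding B_def I_def by auto
      have "m \<le> r (c i) - dist (c i) x" unfolding m_def using I i by auto
      then have "m * real (Suc n) \<le> (r (c i) - dist (c i) x) * real (Suc n)" by (intro mult_right_mono) auto
      then show False using n i(2) by linarith
    qed
    then show ?thesis by auto
  qed
  ultimately have "(\<lambda>n. measure \<mu> (B n)) \<longlonglongrightarrow> 0" by simp
  then have "\<forall>\<^sub>F n in sequentially. measure \<mu> (B n) < \<epsilon>"
    by (rule order_tendstoD) fact
  then obtain n where n: "measure \<mu> (B n) < \<epsilon>"
    using eventually_happens'[OF sequentially_bot] by blast
  show thesis
  proof (rule that[where k = k and p = "p n"])
    show "continuous_on UNIV (p n i)" for i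
      unfolding p_def q_def by (intro continuous_intros)
    show "0 \<le> p n i x" for i x
      unfolding p_def using q01 by (intro mult_nonneg_nonneg prod_nonneg) auto
    show "(\<Sum>i<k. p n i x) \<le> 1" for x
      unfolding p_def sum_telescope_prod using q01 by (simp add: prod_nonneg)
    show "measure \<mu> {x. p n i x = 1} \<le> \<epsilon>" if "i < k" for i
    proof -
      have "q n i x = 1" if "p n i x = 1" for x
      proof -
        have "p n i x \<le> q n i x * 1" unfolding p_def
          using q01 by (intro mult_left_mono prod_le_1) auto
        then show ?thesis using that q01[of n i x] by simp
      qed
      then have "x \<in> cball (c i) (r (c i))" if "p n i x = 1" for x
        using that unfolding q1 by (smt (verit) mem_cball mult_nonpos_nonneg of_nat_0_le_iff)
      then have "measure \<mu> {x. p n i x = 1} \<le> measure \<mu> (cball (c i) (r (c i)))"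
        by (intro finite_measure_mono) (auto simp: mu(2))
      then show ?thesis using r(2)[of "c i"] by simp
    qed
    have "x \<in> B n" if x: "\<forall>i<k. p n i x \<noteq> 1" for x
    proof -
      \<comment> \<open>In the first ball that contains \<open>x\<close> the earlier cutoffs vanish,
        so \<open>p n i x = q n i x\<close>, and this differs from 1 only in the boundary
        layer.\<close>
      define i where "i = (LEAST i. i < k \<and> dist (c i) x < r (c i))"
      have i: "i < k" "dist (c i) x < r (c i)"
        using LeastI_ex[OF cov[of x]] unfolding i_def by auto
      have "r (c j) \<le> dist (c j) x" if "j < i" for j
        using not_less_Least[OF that[unfolded i_def]] that i(1) by auto
      then have "(\<Prod>j<i. 1 - q n j x) = 1"
        using q0 by (intro prod.neutral) auto
      then have "q n i x \<noteq> 1" using x i(1) unfolding p_def by auto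
      then show ?thesis using i unfolding q1 B_def by auto
    qed
    then have "measure \<mu> {x. \<forall>i<k. p n i x \<noteq> 1} \<le> measure \<mu> (B n)"
      by (intro finite_measure_mono) (use B_open mu(2) in auto)
    then show "measure \<mu> {x. \<forall>i<k. p n i x \<noteq> 1} \<le> \<epsilon>" using n by simp
  qed
qed

text \<open>Up to normalisation, the characteristic function of a weighted sum of independent
  signs.\<close>

lemma rademacher_sum:
  assumes "finite T"
  shows "(\<Sum>e\<in>(\<Pi>\<^sub>E t\<in>T. {-1, 1}). cis (\<Sum>t\<in>T. \<theta> t * e t)) = (\<Prod>t\<in>T. 2 * cos (\<theta> t))"
proof -
  have "(\<Sum>e\<in>(\<Pi>\<^sub>E t\<in>T. {-1, 1}). cis (\<Sum>t\<in>T. \<theta> t * e t)) = (\<Sum>e\<in>(\<Pi>\<^sub>E t\<in>T. {-1, 1}). \<Prod>t\<in>T. cis (\<theta> t * e t))"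
    using assms by (simp add: cis_sum)
  also have "\<dots> = (\<Prod>t\<in>T. \<Sum>s\<in>{-1, 1}. cis (\<theta> t * s))"
    using assms by (intro prod_sum_PiE[symmetric]) auto
  also have "\<dots> = (\<Prod>t\<in>T. 2 * cos (\<theta> t))"
  proof (subst of_real_prod, rule prod.cong[OF refl])
    fix t show "(\<Sum>s\<in>{-1, 1}. cis (\<theta> t * s)) = complex_of_real (2 * cos (\<theta> t))"
      by (simp add: complex_eq_iff)
  qed
  finally show ?thesis .
qed

text \<open>A second moment bound: once the square is expanded, the pairs \<open>i = j\<close> give
  the sum of squares, and every other pair is damped by its correlation
  \<open>\<kappa>\<close>.\<close>

lemma average_square_bound:
  fixes W :: "'i \<Rightarrow> complex" and \<theta> :: "'i \<Rightarrow> 'e \<Rightarrow> real" and w :: "'i \<Rightarrow> real" and \<kappa> :: real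
  assumes "finite I" "finite S"
    and \<kappa>: "\<And>i j. i \<in> I \<Longrightarrow> j \<in> I \<Longrightarrow> i \<noteq> j \<Longrightarrow> norm (\<Sum>e\<in>S. cis (\<theta> i e - \<theta> j e)) \<le> \<kappa> * card S"
    and w: "\<And>i. i \<in> I \<Longrightarrow> norm (W i) \<le> w i" and "0 \<le> \<kappa>"
  shows "(\<Sum>e\<in>S. (norm (\<Sum>i\<in>I. cis (\<theta> i e) * W i))\<^sup>2) \<le> card S * ((\<Sum>i\<in>I. (w i)\<^sup>2) + \<kappa> * (\<Sum>i\<in>I. w i)\<^sup>2)"
proof -
  have "complex_of_real (\<Sum>e\<in>S. (norm (\<Sum>i\<in>I. cis (\<theta> i e) * W i))\<^sup>2)
      = (\<Sum>e\<in>S. \<Sum>i\<in>I. \<Sum>j\<in>I. cis (\<theta> i e - \<theta> j e) * (W i * cnj (W j)))"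
  proof (subst of_real_sum, rule sum.cong[OF refl])
    fix e
    have "complex_of_real ((norm (\<Sum>i\<in>I. cis (\<theta> i e) * W i))\<^sup>2)
        = (\<Sum>i\<in>I. \<Sum>j\<in>I. (cis (\<theta> i e) * W i) * (cis (- \<theta> j e) * cnj (W j)))"
      by (simp only: complex_norm_square cnj_sum sum_product complex_cnj_mult cis_cnj)
    also have "\<dots> = (\<Sum>i\<in>I. \<Sum>j\<in>I. (cis (\<theta> i e) * cis (- \<theta> j e)) * (W i * cnj (W j)))"
      by (simp only: mult_ac)
    finally show "complex_of_real ((norm (\<Sum>i\<in>I. cis (\<theta> i e) * W i))\<^sup>2)
        = (\<Sum>i\<in>I. \<Sum>j\<in>I. cis (\<theta> i e - \<theta> j e) * (W i * cnj (W j)))"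
      by (simp only: cis_mult add_uminus_conv_diff)
  qed
  also have "\<dots> = (\<Sum>i\<in>I. \<Sum>j\<in>I. (\<Sum>e\<in>S. cis (\<theta> i e - \<theta> j e)) * (W i * cnj (W j)))"
    by (subst sum.swap, rule sum.cong[OF refl], subst sum.swap) (simp add: sum_distrib_right)
  finally have eq: "complex_of_real (\<Sum>e\<in>S. (norm (\<Sum>i\<in>I. cis (\<theta> i e) * W i))\<^sup>2) = \<dots>" .
  have "(\<Sum>e\<in>S. (norm (\<Sum>i\<in>I. cis (\<theta> i e) * W i))\<^sup>2) = norm (complex_of_real (\<Sum>e\<in>S. (norm (\<Sum>i\<in>I. cis (\<theta> i e) * W i))\<^sup>2))"
    by (subst norm_of_real) (simp add: sum_nonneg)
  also have "\<dots> \<le> (\<Sum>i\<in>I. \<Sum>j\<in>I. norm (\<Sum>e\<in>S. cis (\<theta> i e - \<theta> j e)) * (norm (W i) * norm (W j)))"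
    unfolding eq by (intro sum_norm_le order_trans[OF norm_sum] sum_mono) (simp add: norm_mult)
  also have "\<dots> \<le> (\<Sum>i\<in>I. \<Sum>j\<in>I. real (card S) * (if i = j then (w i)\<^sup>2 else 0) + card S * (\<kappa> * (w i * w j)))"
  proof (intro sum_mono)
    fix i j assume ij: "i \<in> I" "j \<in> I"
    have w0: "0 \<le> w i" "0 \<le> w j" using w[OF ij(1)] w[OF ij(2)] norm_ge_zero order_trans by blast+
    have ww: "norm (W i) * norm (W j) \<le> w i * w j"
      using w ij w0 by (intro mult_mono) auto
    show "norm (\<Sum>e\<in>S. cis (\<theta> i e - \<theta> j e)) * (norm (W i) * norm (W j))
       \<le> card S * (if i = j then (w i)\<^sup>2 else 0) + card S * (\<kappa> * (w i * w j))"
    proof (cases "i = j")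
      case True
      have "card S * (norm (W i) * norm (W j)) \<le> card S * (w i * w j)"
        using ww by (intro mult_left_mono) auto
      moreover have "0 \<le> card S * (\<kappa> * (w i * w j))" using w0 \<open>0 \<le> \<kappa>\<close> by simp
      ultimately show ?thesis using True by (simp add: power2_eq_square)
    next
      case False
      have "norm (\<Sum>e\<in>S. cis (\<theta> i e - \<theta> j e)) * (norm (W i) * norm (W j)) \<le> (\<kappa> * card S) * (w i * w j)"
        by (rule mult_mono) (use ww \<kappa>[OF ij False] w0 \<open>0 \<le> \<kappa>\<close> in auto)
      then show ?thesis using False by (simp add: mult_ac)
    qed
  qed
  also have "\<dots> = card S * ((\<Sum>i\<in>I. (w i)\<^sup>2) + \<kappa> * (\<Sum>i\<in>I. w i)\<^sup>2)"
    using assms(1) by (simp add: sum.distrib sum_distrib_left[symmetric] power2_eq_square sum_product distrib_left)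
  finally show ?thesis .
qed


text \<open>The Fourier transform at \<open>u\<close> of the image under \<open>h\<close> of the restriction of \<open>\<mu>\<close> to \<open>V\<close>.\<close>

abbreviation ft :: "'a::metric_space measure \<Rightarrow> 'a set \<Rightarrow> real ^ 'n \<Rightarrow> ('a \<Rightarrow> real ^ 'n) \<Rightarrow> complex" where
  "ft \<mu> V u h \<equiv> (LINT x:V|\<mu>. cis (u \<bullet> h x))"

lemma cis_measurable [measurable]: "cis \<in> borel_measurable borel"
  by (intro borel_measurable_continuous_onI continuous_intros)

lemma cis_integrable:
  fixes h :: "'a \<Rightarrow> real ^ 'n"
  assumes "finite_measure \<mu>" "h \<in> borel_measurable \<mu>" "V \<in> sets \<mu>"
  shows "set_integrable \<mu> V (\<lambda>x. cis (u \<bullet> h x))"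
proof -
  interpret finite_measure \<mu> by fact
  have [measurable]: "h \<in> borel_measurable \<mu>" "V \<in> sets \<mu>" by fact+
  show ?thesis unfolding set_integrable_def
    by (rule integrable_const_bound[where B = 1]) (simp add: indicator_def, measurable)
qed

lemma norm_ft_le:
  fixes h :: "'a::metric_space \<Rightarrow> real ^ 'n"
  assumes "finite_measure \<mu>" "h \<in> borel_measurable \<mu>" "V \<in> sets \<mu>"
  shows "norm (ft \<mu> V u h) \<le> measure \<mu> V"
proof -
  interpret finite_measure \<mu> by fact
  have "norm (ft \<mu> V u h) \<le> (LINT x|\<mu>. norm (indicator V x *\<^sub>R cis (u \<bullet> h x)))"
    unfolding set_lebesgue_integral_def by (rule integral_norm_bound)
  also have "\<dots> = (LINT x|\<mu>. indicator V x)"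
    by (intro Bochner_Integration.integral_cong) (auto simp: indicator_def)
  finally have "norm (ft \<mu> V u h) \<le> (LINT x|\<mu>. indicator V x)" .
  then show ?thesis using assms by simp
qed

text \<open>The scale \<open>(1/4) ^ Suc l\<close> of the random signs is chosen so that the phase \<open>(1/4) ^ Suc l * u $ c0\<close> has
  modulus between 1/4 and 1. The map \<open>\<rho>\<close> only enters through coefficients whose modulus is at most the
  measure of a piece of the partition, which makes the bound independent of \<open>\<rho>\<close>.\<close>

lemma level_average:
  fixes \<mu> :: "'a::metric_space measure" and p :: "nat \<Rightarrow> 'a \<Rightarrow> real" and u :: "real ^ 'n"
    and l k :: nat
  defines "T \<equiv> {..<k} \<times> {..<(2::nat) ^ l} \<times> (UNIV :: 'n set)"
  defines "S \<equiv> \<Pi>\<^sub>E t\<in>T. {-1, 1 :: real}"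
  defines "X \<equiv> \<lambda>i e. (\<chi> c. (1/4) ^ Suc l * (\<Sum>j<2 ^ l. e (i, j, c))) :: real ^ 'n"
  assumes mu: "finite_measure \<mu>" "sets \<mu> = sets borel"
    and p: "\<And>i. continuous_on UNIV (p i)" "\<And>i x. 0 \<le> p i x" "\<And>x. (\<Sum>i<k. p i x) \<le> 1"
      "\<And>i. i < k \<Longrightarrow> measure \<mu> {x. p i x = 1} \<le> \<epsilon>"
    and \<epsilon>: "0 \<le> \<epsilon>" and V: "V \<in> sets \<mu>" "V \<subseteq> {x. \<exists>i<k. p i x = 1}"
    and \<rho>: "\<rho> \<in> borel_measurable \<mu>"
    and u: "4 ^ l \<le> \<bar>u $ c0\<bar>" "\<bar>u $ c0\<bar> < 4 ^ Suc l"
  shows "(\<Sum>e\<in>S. (norm (ft \<mu> V u (\<lambda>x. \<rho> x + (\<Sum>i<k. p i x *\<^sub>R X i e))))\<^sup>2)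
    \<le> card S * (measure \<mu> UNIV * \<epsilon> + cos (1/4) ^ (2 ^ l) * (measure \<mu> UNIV)\<^sup>2)"
proof -
  interpret finite_measure \<mu> by fact
  have space: "space \<mu> = UNIV" using sets_eq_imp_space_eq[OF mu(2)] by simp
  have [measurable]: "V \<in> sets \<mu>" "\<rho> \<in> borel_measurable \<mu>" by fact+
  have [simp]: "finite T" unfolding T_def by simp
  then have [simp]: "finite S" unfolding S_def by (intro finite_PiE) auto
  define P where "P = (\<lambda>i. V \<inter> {x. p i x = 1})"
  have p_other: "p j x = 0" if "p i x = 1" "i < k" "j < k" "j \<noteq> i" for i j x
  proof -
    have "p i x + p j x = (\<Sum>a\<in>{i, j}. p a x)" using that by auto
    also have "\<dots> \<le> (\<Sum>a<k. p a x)" using that p(2) by (intro sum_mono2) auto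
    finally show ?thesis using p(2)[of j x] p(3)[of x] that by simp
  qed
  have P_closed: "closed {x. p i x = 1}" for i
    using continuous_closed_preimage_constant[OF p(1)[of i] closed_UNIV, of 1] by simp
  have P_sets [measurable]: "P i \<in> sets \<mu>" for i
    unfolding P_def using P_closed mu(2) V(1) by auto
  have P_disj: "disjoint_family_on P {..<k}"
    unfolding disjoint_family_on_def P_def using p_other by fastforce
  have V_eq: "V = (\<Union>i<k. P i)"
    using V(2) unfolding P_def by auto
  define W where "W = (\<lambda>i. ft \<mu> (P i) u \<rho>)"
  define \<theta> where "\<theta> = (\<lambda>i e. u \<bullet> X i e)"
  \<comment> \<open>On the plateau of \<open>p i\<close> the other functions vanish, so the random
    map is the constant \<open>X i e\<close> there and leaves the integral as a phase; what remains
    does not depend on \<open>e\<close>.\<close>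
  have split: "ft \<mu> V u (\<lambda>x. \<rho> x + (\<Sum>i<k. p i x *\<^sub>R X i e)) = (\<Sum>i<k. cis (\<theta> i e) * W i)" for e
  proof -
    let ?h = "\<lambda>x. \<rho> x + (\<Sum>i<k. p i x *\<^sub>R X i e)"
    have "p i \<in> borel_measurable \<mu>" for i
      using borel_measurable_continuous_onI[OF p(1)[of i]] measurable_cong_sets[OF mu(2) refl] by blast
    then have h [measurable]: "?h \<in> borel_measurable \<mu>" by measurable
    have "ft \<mu> V u ?h = (\<Sum>i<k. ft \<mu> (P i) u ?h)"
      unfolding V_eq using P_disj
      by (intro set_integral_finite_Union) (auto intro!: cis_integrable[OF mu(1) h])
    also have "\<dots> = (\<Sum>i<k. cis (\<theta> i e) * W i)"
    proof (rule sum.cong[OF refl])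
      fix i assume i: "i \<in> {..<k}"
      have "?h x = \<rho> x + X i e" if "x \<in> P i" for x
      proof -
        have "(\<Sum>j<k. p j x *\<^sub>R X j e) = (\<Sum>j\<in>{i}. p j x *\<^sub>R X j e)"
          using i that p_other[of i x] by (intro sum.mono_neutral_right) (auto simp: P_def)
        then show ?thesis using that by (simp add: P_def)
      qed
      then have "ft \<mu> (P i) u ?h = (LINT x:P i|\<mu>. cis (\<theta> i e) * cis (u \<bullet> \<rho> x))"
        unfolding set_lebesgue_integral_def \<theta>_def
        by (intro Bochner_Integration.integral_cong) (auto simp: indicator_def inner_add_right cis_mult add.commute)
      then show "ft \<mu> (P i) u ?h = cis (\<theta> i e) * W i"
        unfolding W_def by simp
    qed
    finally show ?thesis .
  qed
  define b where "b = (1/4 :: real) ^ Suc l"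
  have q: "0 < cos (1/4 :: real)" "cos (1/4 :: real) \<le> 1" using pi_gt3 by (auto intro!: cos_gt_zero)
  have corr: "norm (\<Sum>e\<in>S. cis (\<theta> i e - \<theta> i' e)) \<le> cos (1/4) ^ (2 ^ l) * card S"
    if ii: "i \<in> {..<k}" "i' \<in> {..<k}" "i \<noteq> i'" for i i'
  proof -
    define \<phi> where "\<phi> = (\<lambda>(a, j :: nat, c). (if a = i then b * u $ c else 0) - (if a = i' then b * u $ c else 0) :: real)"
    have \<theta>: "\<theta> a e = (\<Sum>t\<in>T. (if fst t = a then b * u $ (snd (snd t)) else 0) * e t)" if "a < k" for a e
    proof -
      have "(\<Sum>t\<in>T. (if fst t = a then b * u $ (snd (snd t)) else 0) * e t)
         = (\<Sum>t\<in>{a} \<times> {..<(2::nat) ^ l} \<times> (UNIV :: 'n set). b * u $ (snd (snd t)) * e t)"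
        using that by (intro sum.mono_neutral_cong_right) (auto simp: T_def)
      also have "\<dots> = (\<Sum>j<2^l. \<Sum>c\<in>UNIV. b * u $ c * e (a, j, c))"
      proof -
        have "(\<Sum>t\<in>{a} \<times> {..<(2::nat) ^ l} \<times> (UNIV :: 'n set). b * u $ (snd (snd t)) * e t)
            = (\<Sum>z\<in>{..<(2::nat) ^ l} \<times> (UNIV :: 'n set). b * u $ snd z * e (a, fst z, snd z))"
          by (rule sum.reindex_bij_witness[of _ "\<lambda>z. (a, z)" snd]) auto
        then show ?thesis by (simp add: sum.cartesian_product split_def)
      qed
      also have "\<dots> = \<theta> a e"
        unfolding \<theta>_def X_def inner_vec_def
        by (subst sum.swap) (simp add: sum_distrib_left mult_ac b_def)
      finally show ?thesis by simp
    qed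
    have "\<theta> i e - \<theta> i' e = (\<Sum>t\<in>T. \<phi> t * e t)" for e
      using \<theta> ii by (simp add: sum_subtractf[symmetric] left_diff_distrib[symmetric] \<phi>_def split_def)
    then have "(\<Sum>e\<in>S. cis (\<theta> i e - \<theta> i' e)) = (\<Prod>t\<in>T. 2 * cos (\<phi> t))"
      unfolding S_def using rademacher_sum[of T \<phi>] by simp
    then have "norm (\<Sum>e\<in>S. cis (\<theta> i e - \<theta> i' e)) = (\<Prod>t\<in>T. \<bar>cos (\<phi> t)\<bar>) * 2 ^ card T"
      by (simp only: norm_of_real abs_prod abs_mult prod.distrib) (simp add: mult.commute)
    \<comment> \<open>Only the signs of piece \<open>i\<close> in direction \<open>c0\<close> are
      kept. They give \<open>2 ^ l\<close> factors of modulus at most \<open>cos (1/4)\<close>; all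
      other factors are at most 1.\<close>
    also have "(\<Prod>t\<in>T. \<bar>cos (\<phi> t)\<bar>) \<le> (\<Prod>t\<in>{i} \<times> {..<(2::nat)^l} \<times> {c0}. \<bar>cos (\<phi> t)\<bar>)"
    proof -
      have "(\<Prod>t\<in>T. \<bar>cos (\<phi> t)\<bar>) = (\<Prod>t\<in>T - {i} \<times> {..<(2::nat)^l} \<times> {c0}. \<bar>cos (\<phi> t)\<bar>) * (\<Prod>t\<in>{i} \<times> {..<(2::nat)^l} \<times> {c0}. \<bar>cos (\<phi> t)\<bar>)"
        using ii by (intro prod.subset_diff) (auto simp: T_def)
      also have "\<dots> \<le> 1 * (\<Prod>t\<in>{i} \<times> {..<(2::nat)^l} \<times> {c0}. \<bar>cos (\<phi> t)\<bar>)"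
        by (intro mult_right_mono prod_le_1 prod_nonneg) auto
      finally show ?thesis by simp
    qed
    also have "\<dots> \<le> (\<Prod>t\<in>{i} \<times> {..<(2::nat)^l} \<times> {c0}. cos (1/4))"
    proof (intro prod_mono conjI)
      fix t assume "t \<in> {i} \<times> {..<(2::nat)^l} \<times> {c0}"
      then have t: "\<phi> t = b * u $ c0" using ii by (auto simp: \<phi>_def)
      have "b * 4 ^ Suc l = 1" unfolding b_def by (simp add: power_divide)
      moreover have "b * 4 ^ l \<le> b * \<bar>u $ c0\<bar>" "b * \<bar>u $ c0\<bar> \<le> b * 4 ^ Suc l"
        using u unfolding b_def by (auto intro!: mult_left_mono)
      ultimately have bu: "1/4 \<le> \<bar>b * u $ c0\<bar>" "\<bar>b * u $ c0\<bar> \<le> 1"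
        by (auto simp: abs_mult b_def)
      have "cos \<bar>b * u $ c0\<bar> \<le> cos (1/4)" "0 \<le> cos \<bar>b * u $ c0\<bar>"
        using bu pi_gt3 by (auto intro!: cos_ge_zero simp: cos_mono_le_eq simp del: cos_abs_real)
      then show "\<bar>cos (\<phi> t)\<bar> \<le> cos (1/4)" unfolding t by simp
    qed simp
    also have "\<dots> = cos (1/4) ^ (2 ^ l)" by (simp add: card_cartesian_product)
    also have "2 ^ card T = real (card S)" unfolding S_def by (simp add: card_PiE)
    finally show ?thesis by simp
  qed
  have "(\<Sum>e\<in>S. (norm (\<Sum>i<k. cis (\<theta> i e) * W i))\<^sup>2)
      \<le> card S * ((\<Sum>i<k. (measure \<mu> (P i))\<^sup>2) + cos (1/4) ^ (2 ^ l) * (\<Sum>i<k. measure \<mu> (P i))\<^sup>2)"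
  proof (rule average_square_bound)
    show "norm (W i) \<le> measure \<mu> (P i)" for i
      unfolding W_def by (rule norm_ft_le[OF mu(1) \<rho> P_sets])
    show "norm (\<Sum>e\<in>S. cis (\<theta> i e - \<theta> j e)) \<le> cos (1 / 4) ^ 2 ^ l * real (card S)"
      if "i \<in> {..<k}" "j \<in> {..<k}" "i \<noteq> j" for i j by (rule corr[OF that])
  qed (use q in auto)
  also have "\<dots> \<le> card S * (measure \<mu> UNIV * \<epsilon> + cos (1/4) ^ (2 ^ l) * (measure \<mu> UNIV)\<^sup>2)"
  proof -
    have "(\<Sum>i<k. measure \<mu> (P i)) = measure \<mu> V"
      unfolding V_eq using P_disj by (intro finite_measure_finite_Union[symmetric]) auto
    also have "\<dots> \<le> measure \<mu> UNIV" using space bounded_measure by metis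
    finally have s: "(\<Sum>i<k. measure \<mu> (P i)) \<le> measure \<mu> UNIV" .
    have le: "measure \<mu> (P i) \<le> \<epsilon>" if "i < k" for i
      using p(4)[OF that] finite_measure_mono[of "P i" "{x. p i x = 1}"] P_closed mu(2)
      by (auto simp: P_def intro: order_trans)
    \<comment> \<open>The diagonal is small because no single piece has mass above
      \<open>\<epsilon>\<close>.\<close>
    have "(\<Sum>i<k. (measure \<mu> (P i))\<^sup>2) \<le> (\<Sum>i<k. measure \<mu> (P i) * \<epsilon>)"
      unfolding power2_eq_square by (intro sum_mono mult_left_mono) (auto simp: le)
    also have "\<dots> \<le> measure \<mu> UNIV * \<epsilon>"
      using s \<epsilon> by (simp add: sum_distrib_right[symmetric] mult_right_mono)
    finally have 1: "(\<Sum>i<k. (measure \<mu> (P i))\<^sup>2) \<le> measure \<mu> UNIV * \<epsilon>" .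
    have "(\<Sum>i<k. measure \<mu> (P i))\<^sup>2 \<le> (measure \<mu> UNIV)\<^sup>2"
      using s by (intro power_mono) (auto intro: sum_nonneg)
    then show ?thesis using 1 q by (intro mult_left_mono add_mono) auto
  qed
  finally show ?thesis by (simp only: split)
qed

text \<open>Enumerating the sign patterns turns one level into a uniformly distributed natural
  number, the form in which the levels are combined into a product space.\<close>

lemma level_functions:
  fixes \<mu> :: "'a::metric_space measure" and l :: nat
  assumes cpt: "compact (UNIV :: 'a set)"
    and mu: "finite_measure \<mu>" "sets \<mu> = sets borel" "\<And>x. emeasure \<mu> {x} = 0" and \<epsilon>: "0 < \<epsilon>"
  obtains N :: nat and G :: "nat \<Rightarrow> ('a \<Rightarrow>\<^sub>C (real ^ 'n))" and A :: "'a set"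
  where "0 < N" "closed A" "measure \<mu> (- A) \<le> \<epsilon>" "\<And>e. norm (G e) \<le> real CARD('n) * (1/2) ^ l"
    "\<And>V \<rho> u c0. V \<in> sets \<mu> \<Longrightarrow> V \<subseteq> A \<Longrightarrow> \<rho> \<in> borel_measurable \<mu> \<Longrightarrow> 4 ^ l \<le> \<bar>u $ c0\<bar> \<Longrightarrow> \<bar>u $ c0\<bar> < 4 ^ Suc l \<Longrightarrow>
      (\<Sum>e<N. (norm (ft \<mu> V u (\<lambda>x. \<rho> x + apply_bcontfun (G e) x)))\<^sup>2) \<le> real N * (measure \<mu> UNIV * \<epsilon> + cos (1/4) ^ (2 ^ l) * (measure \<mu> UNIV)\<^sup>2)"
proof -
  obtain k and p :: "nat \<Rightarrow> 'a \<Rightarrow> real" where p: "\<And>i. continuous_on UNIV (p i)" "\<And>i x. 0 \<le> p i x" "\<And>x. (\<Sum>i<k. p i x) \<le> 1"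
    "\<And>i. i < k \<Longrightarrow> measure \<mu> {x. p i x = 1} \<le> \<epsilon>"
    "measure \<mu> {x. \<forall>i<k. p i x \<noteq> 1} \<le> \<epsilon>"
    by (rule measure_partition[OF cpt mu \<epsilon>]) (rule that, assumption+)
  define T where "T = {..<k} \<times> {..<(2::nat) ^ l} \<times> (UNIV :: 'n set)"
  define S where "S = (\<Pi>\<^sub>E t\<in>T. {-1, 1 :: real})"
  define X :: "nat \<Rightarrow> (nat \<times> nat \<times> 'n \<Rightarrow> real) \<Rightarrow> real ^ 'n"
    where "X = (\<lambda>i e. \<chi> c. (1/4) ^ Suc l * (\<Sum>j<2 ^ l. e (i, j, c)))"
  have "finite T" unfolding T_def by simp
  then have S: "finite S" "S \<noteq> {}" unfolding S_def by (auto intro!: finite_PiE simp: PiE_eq_empty_iff)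
  obtain f where f: "bij_betw f {0..<card S} S"
    using ex_bij_betw_nat_finite[OF S(1)] by blast
  \<comment> \<open>Indices from \<open>card S\<close> on repeat the pattern of index 0, so that the
    norm bound holds for every natural number.\<close>
  define g where "g = (\<lambda>e. f (if e < card S then e else 0))"
  have g: "g e \<in> S" for e
  proof -
    have "(if e < card S then e else 0) \<in> {0..<card S}" using S by (auto simp: card_gt_0_iff)
    then show ?thesis using f unfolding g_def bij_betw_def by blast
  qed
  have bij: "bij_betw g {..<card S} S"
    using f by (subst bij_betw_cong[of _ _ f]) (auto simp: g_def atLeast0LessThan)
  define F where "F = (\<lambda>e x. \<Sum>i<k. p i x *\<^sub>R X i e)"
  \<comment> \<open>The \<open>2 ^ l\<close> signs of size \<open>(1/4) ^ Suc l\<close> add up to at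
    most \<open>(1/2) ^ l\<close>, which is summable over the levels.\<close>
  have X_bound: "norm (X i e) \<le> real CARD('n) * (1/2) ^ l" if "e \<in> S" "i < k" for i e
  proof -
    have "\<bar>X i e $ c\<bar> \<le> (1/2) ^ l" for c
    proof -
      have "\<bar>\<Sum>j<(2::nat) ^ l. e (i, j, c)\<bar> \<le> (\<Sum>j<(2::nat) ^ l. 1)"
      proof (intro order_trans[OF sum_abs] sum_mono)
        fix j assume "j \<in> {..<(2::nat) ^ l}"
        then have "(i, j, c) \<in> T" using that by (auto simp: T_def)
        then have "e (i, j, c) \<in> {-1, 1}" using that(1) unfolding S_def by (rule PiE_mem[rotated])
        then show "\<bar>e (i, j, c)\<bar> \<le> 1" by auto
      qed
      then have "(1/4) ^ Suc l * \<bar>\<Sum>j<(2::nat) ^ l. e (i, j, c)\<bar> \<le> (1/4) ^ Suc l * 2 ^ l"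
        by (intro mult_left_mono) auto
      also have "\<dots> = (1/4) * ((1/4) * 2) ^ l" by (simp only: power_Suc power_mult_distrib mult.assoc)
      also have "\<dots> \<le> (1/2) ^ l" by simp
      finally show ?thesis unfolding X_def by (simp add: abs_mult)
    qed
    then have "(\<Sum>c\<in>UNIV. \<bar>X i e $ c\<bar>) \<le> (\<Sum>c\<in>(UNIV::'n set). (1/2) ^ l)" by (intro sum_mono)
    then show ?thesis using norm_le_l1_cart[of "X i e"] by simp
  qed
  have F_bound: "norm (F e x) \<le> real CARD('n) * (1/2) ^ l" if "e \<in> S" for e x
  proof -
    have "norm (F e x) \<le> (\<Sum>i<k. p i x * (real CARD('n) * (1/2) ^ l))"
      unfolding F_def using p(2) X_bound[OF that]
      by (intro order_trans[OF norm_sum] sum_mono) (auto intro: mult_left_mono)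
    also have "\<dots> \<le> 1 * (real CARD('n) * (1/2) ^ l)"
      unfolding sum_distrib_right[symmetric] using p(3) by (intro mult_right_mono) auto
    finally show ?thesis by simp
  qed
  have F_bcont: "F e \<in> bcontfun" if "e \<in> S" for e
    unfolding F_def
    by (rule bcontfun_normI[where b = "real CARD('n) * (1/2) ^ l"])
      (use F_bound[OF that] p(1) in \<open>auto simp: F_def intro!: continuous_intros\<close>)
  define G where "G = (\<lambda>e. Bcontfun (F (g e)))"
  have G: "apply_bcontfun (G e) = F (g e)" for e
    unfolding G_def using F_bcont[OF g] by (simp add: Bcontfun_inverse)
  show thesis
  proof (rule that[of "card S" "{x. \<exists>i<k. p i x = 1}" G])
    show "0 < card S" using S by (simp add: card_gt_0_iff)
    have "closed (\<Union>i<k. {x. p i x = 1})"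
      using continuous_closed_preimage_constant[OF p(1) closed_UNIV, of _ 1] by (intro closed_UN) auto
    moreover have "(\<Union>i<k. {x. p i x = 1}) = {x. \<exists>i<k. p i x = 1}" by auto
    ultimately show "closed {x. \<exists>i<k. p i x = 1}" by simp
    have "- {x. \<exists>i<k. p i x = 1} = {x. \<forall>i<k. p i x \<noteq> 1}" by auto
    then show "measure \<mu> (- {x. \<exists>i<k. p i x = 1}) \<le> \<epsilon>" using p(5) by simp
    show "norm (G e) \<le> real CARD('n) * (1/2) ^ l" for e
      by (rule norm_bound) (use F_bound[OF g] G in auto)
    fix V c0 and u :: "real ^ 'n" and \<rho> :: "'a \<Rightarrow> real ^ 'n" assume *: "V \<in> sets \<mu>" "V \<subseteq> {x. \<exists>i<k. p i x = 1}" "\<rho> \<in> borel_measurable \<mu>"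
      "4 ^ l \<le> \<bar>u $ c0\<bar>" "\<bar>u $ c0\<bar> < 4 ^ Suc l"
    have "(\<Sum>e<card S. (norm (ft \<mu> V u (\<lambda>x. \<rho> x + apply_bcontfun (G e) x)))\<^sup>2) = (\<Sum>e<card S. (norm (ft \<mu> V u (\<lambda>x. \<rho> x + F (g e) x)))\<^sup>2)"
      by (simp add: G)
    also have "\<dots> = (\<Sum>e\<in>S. (norm (ft \<mu> V u (\<lambda>x. \<rho> x + F e x)))\<^sup>2)"
      by (rule sum.reindex_bij_betw[OF bij])
    also have "\<dots> \<le> real (card S) * (measure \<mu> UNIV * \<epsilon> + cos (1/4) ^ (2 ^ l) * (measure \<mu> UNIV)\<^sup>2)"
      unfolding F_def S_def X_def T_def
      by (rule level_average[OF mu(1,2) p(1,2,3,4) less_imp_le[OF \<epsilon>] *])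
    finally show "(\<Sum>e<card S. (norm (ft \<mu> V u (\<lambda>x. \<rho> x + apply_bcontfun (G e) x)))\<^sup>2)
      \<le> real (card S) * (measure \<mu> UNIV * \<epsilon> + cos (1/4) ^ (2 ^ l) * (measure \<mu> UNIV)\<^sup>2)" .
  qed
qed

section \<open>The random series\<close>

instance bcontfun :: (metric_space, banach) banach ..

lemma ft_continuous:
  fixes \<mu> :: "'a::metric_space measure"
  assumes "finite_measure \<mu>" "sets \<mu> = sets borel" "V \<in> sets \<mu>"
  shows "continuous_on UNIV (\<lambda>h :: 'a \<Rightarrow>\<^sub>C (real ^ 'n). ft \<mu> V u h)"
  unfolding continuous_on_sequentially comp_def
proof (intro allI ballI impI, elim conjE)
  fix s :: "nat \<Rightarrow> 'a \<Rightarrow>\<^sub>C (real ^ 'n)" and h assume s: "s \<longlonglongrightarrow> h"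
  interpret finite_measure \<mu> by fact
  have bm [measurable]: "apply_bcontfun f \<in> borel_measurable \<mu>" for f :: "'a \<Rightarrow>\<^sub>C (real ^ 'n)"
    using borel_measurable_continuous_onI[OF continuous_on_apply_bcontfun[of UNIV f]] measurable_cong_sets[OF assms(2) refl] by blast
  have [measurable]: "V \<in> sets \<mu>" by fact
  have pw: "(\<lambda>n. s n x) \<longlonglongrightarrow> h x" for x
  proof (rule metric_tendsto_imp_tendsto[OF s])
    show "\<forall>\<^sub>F n in sequentially. dist (s n x) (h x) \<le> dist (s n) h"
      by (simp add: dist_bounded)
  qed
  show "(\<lambda>n. ft \<mu> V u (s n)) \<longlonglongrightarrow> ft \<mu> V u h"
    unfolding set_lebesgue_integral_def
  proof (rule integral_dominated_convergence[where w = "\<lambda>_. 1"])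
    show "AE x in \<mu>. (\<lambda>n. indicat_real V x *\<^sub>R cis (u \<bullet> s n x)) \<longlonglongrightarrow> indicat_real V x *\<^sub>R cis (u \<bullet> h x)"
      by (intro AE_I2 tendsto_intros pw)
    show "AE x in \<mu>. norm (indicat_real V x *\<^sub>R cis (u \<bullet> s n x)) \<le> 1" for n
      by (auto simp: indicator_def)
  qed measurable
qed

lemma random_series:
  fixes \<mu> :: "'a::metric_space measure" and \<epsilon> :: "nat \<Rightarrow> real"
  assumes cpt: "compact (UNIV :: 'a set)"
    and mu: "finite_measure \<mu>" "sets \<mu> = sets borel" "\<And>x. emeasure \<mu> {x} = 0" and \<epsilon>: "\<And>l. 0 < \<epsilon> l"
  obtains \<nu> :: "('a \<Rightarrow>\<^sub>C (real ^ 'n)) measure" and A :: "nat \<Rightarrow> 'a set"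
  where "prob_space \<nu>" "sets \<nu> = sets borel" "\<And>l. closed (A l)" "\<And>l. measure \<mu> (- A l) \<le> \<epsilon> l"
    "\<And>l V u c0 g. V \<in> sets \<mu> \<Longrightarrow> V \<subseteq> A l \<Longrightarrow> 4 ^ l \<le> \<bar>u $ c0\<bar> \<Longrightarrow> \<bar>u $ c0\<bar> < 4 ^ Suc l \<Longrightarrow>
      (\<integral>\<^sup>+f. ennreal ((norm (ft \<mu> V u (apply_bcontfun (f + g))))\<^sup>2) \<partial>\<nu>)
        \<le> ennreal (measure \<mu> UNIV * \<epsilon> l + cos (1/4) ^ (2 ^ l) * (measure \<mu> UNIV)\<^sup>2)"
proof -
  define good where "good = (\<lambda>l N (G :: nat \<Rightarrow> ('a \<Rightarrow>\<^sub>C (real ^ 'n))) A. 0 < N \<and> closed A \<and> measure \<mu> (- A) \<le> \<epsilon> l \<and>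
    (\<forall>e. norm (G e) \<le> real CARD('n) * (1/2) ^ l) \<and>
    (\<forall>V \<rho> u c0. V \<in> sets \<mu> \<longrightarrow> V \<subseteq> A \<longrightarrow> \<rho> \<in> borel_measurable \<mu> \<longrightarrow> 4 ^ l \<le> \<bar>u $ c0\<bar> \<longrightarrow> \<bar>u $ c0\<bar> < 4 ^ Suc l \<longrightarrow>
      (\<Sum>e<N. (norm (ft \<mu> V u (\<lambda>x. \<rho> x + apply_bcontfun (G e) x)))\<^sup>2) \<le> real N * (measure \<mu> UNIV * \<epsilon> l + cos (1/4) ^ (2 ^ l) * (measure \<mu> UNIV)\<^sup>2)))"
  have "\<exists>N G A. good l N G A" for l
    by (rule level_functions[OF cpt mu \<epsilon>[of l], where l = l and 'n = 'n], intro exI)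
      (unfold good_def, intro conjI allI impI, assumption+)
  then obtain N G A where good: "\<And>l. good l (N l) (G l) (A l)" by metis
  have N: "0 < N l" for l using good unfolding good_def by auto
  have GB: "norm (G l e) \<le> real CARD('n) * (1/2) ^ l" for l e using good unfolding good_def by auto
  interpret finite_measure \<mu> by fact
  define P where "P = (\<lambda>l. measure_pmf (pmf_of_set {..<N l}))"
  define \<Omega> where "\<Omega> = PiM UNIV P"
  interpret P: prob_space "P l" for l unfolding P_def by (rule measure_pmf.prob_space_axioms)
  interpret \<Omega>: prob_space \<Omega> unfolding \<Omega>_def by (intro prob_space_PiM P.prob_space_axioms)
  have coord: "(\<lambda>\<omega>. \<omega> l) \<in> measurable \<Omega> (count_space UNIV)" for l
  proof -
    have "(\<lambda>\<omega>. \<omega> l) \<in> measurable \<Omega> (P l)" unfolding \<Omega>_def by measurable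
    then show ?thesis using measurable_cong_sets[of \<Omega> \<Omega> "P l" "count_space UNIV"] by (simp add: P_def)
  qed
  define F where "F = (\<lambda>\<omega>. \<Sum>l. G l (\<omega> l))"
  have summ: "summable (\<lambda>l. G l (\<omega> l))" for \<omega>
  proof (rule summable_norm_cancel, rule summable_comparison_test'[where N = 0])
    show "summable (\<lambda>l. real CARD('n) * (1/2) ^ l)" by (intro summable_mult summable_geometric) auto
  qed (use GB in auto)
  \<comment> \<open>The next coordinate takes countably many values, so measurability reduces to
    that of translations by the fixed vectors \<open>G n e\<close>.\<close>
  have partial: "(\<lambda>\<omega>. \<Sum>l<n. G l (\<omega> l)) \<in> borel_measurable \<Omega>" for n
  proof (induction n)
    case (Suc n)
    have "(\<lambda>\<omega>. (\<Sum>l<n. G l (\<omega> l)) + G n e) \<in> borel_measurable \<Omega>" for e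
    proof -
      have "(\<lambda>z. z + G n e) \<in> borel_measurable borel"
        by (intro borel_measurable_continuous_onI continuous_intros)
      from measurable_compose[OF Suc this] show ?thesis .
    qed
    from measurable_compose_countable[OF this coord[of n]]
    show ?case by simp
  qed simp
  have F_meas: "F \<in> borel_measurable \<Omega>"
    by (rule borel_measurable_LIMSEQ_metric[OF partial]) (use summable_LIMSEQ[OF summ] in \<open>simp add: F_def\<close>)
  define \<nu> where "\<nu> = distr \<Omega> borel F"
  show thesis
  proof (rule that[of \<nu> A])
    show "prob_space \<nu>" unfolding \<nu>_def by (rule \<Omega>.prob_space_distr[OF F_meas])
    show "sets \<nu> = sets borel" unfolding \<nu>_def by simp
    show "closed (A l)" "measure \<mu> (- A l) \<le> \<epsilon> l" for l using good unfolding good_def by auto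
    fix l V c0 and u :: "real ^ 'n" and g :: "'a \<Rightarrow>\<^sub>C (real ^ 'n)"
    assume *: "V \<in> sets \<mu>" "V \<subseteq> A l" "4 ^ l \<le> \<bar>u $ c0\<bar>" "\<bar>u $ c0\<bar> < 4 ^ Suc l"
    define \<phi> where "\<phi> = (\<lambda>f. ennreal ((norm (ft \<mu> V u (apply_bcontfun (f + g))))\<^sup>2))"
    let ?b = "measure \<mu> UNIV * \<epsilon> l + cos (1/4) ^ (2 ^ l) * (measure \<mu> UNIV)\<^sup>2"
    have "(\<lambda>f. ft \<mu> V u (apply_bcontfun (f + g))) \<in> borel_measurable borel"
      by (intro borel_measurable_continuous_onI continuous_on_compose2[OF ft_continuous[OF mu(1,2) *(1)]] continuous_intros) auto
    then have \<phi>_meas [measurable]: "\<phi> \<in> borel_measurable borel" unfolding \<phi>_def by measurable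
    have pair: "pair_sigma_finite (P l) \<Omega>" by unfold_locales
    have upd [measurable]: "(\<lambda>(x, X). X(l := x)) \<in> measurable (P l \<Otimes>\<^sub>M \<Omega>) \<Omega>"
      unfolding \<Omega>_def split_def by (rule measurable_fun_upd[where J = UNIV]) auto
    \<comment> \<open>replacing the coordinate \<open>l\<close> by an independent copy\<close>
    have resample: "distr (P l \<Otimes>\<^sub>M \<Omega>) \<Omega> (\<lambda>(x, X). X(l := x)) = \<Omega>"
      using distr_pair_PiM_eq_PiM[of UNIV P l] P.prob_space_axioms unfolding \<Omega>_def by simp
    have F_upd: "F (X(l := e)) = (F X - G l (X l)) + G l e" for X e
    proof -
      have "(\<lambda>i. G i ((X(l := e)) i)) sums (F X + (G l e - G l (X l)))"
      proof -
        have "(\<lambda>i. G i (X i) + (if i = l then G l e - G l (X l) else 0)) sums (F X + (G l e - G l (X l)))"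
          by (intro sums_add sums_single) (simp add: F_def summ summable_sums)
        moreover have "(\<lambda>i. G i (X i) + (if i = l then G l e - G l (X l) else 0)) = (\<lambda>i. G i ((X(l := e)) i))"
          by auto
        ultimately show ?thesis by simp
      qed
      then show ?thesis unfolding F_def by (simp add: sums_unique[symmetric] algebra_simps)
    qed
    have inner: "(\<integral>\<^sup>+x. \<phi> (F (X(l := x))) \<partial>P l) \<le> ennreal ?b" for X
    proof -
      have sp: "{..<N l} \<noteq> {}" using N[of l] by auto
      have meas: "apply_bcontfun (F X - G l (X l) + g) \<in> borel_measurable \<mu>"
        using borel_measurable_continuous_onI[OF continuous_on_apply_bcontfun[of UNIV "F X - G l (X l) + g"]] measurable_cong_sets[OF mu(2) refl] by blast
      have "(\<integral>\<^sup>+x. \<phi> (F (X(l := x))) \<partial>P l) = (\<Sum>e<N l. \<phi> (F (X(l := e)))) / ennreal (N l)"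
        unfolding P_def using sp by (subst nn_integral_pmf_of_set) (auto simp: ennreal_of_nat_eq_real_of_nat)
      also have "(\<Sum>e<N l. \<phi> (F (X(l := e)))) = (\<Sum>e<N l. ennreal ((norm (ft \<mu> V u (\<lambda>x. apply_bcontfun (F X - G l (X l) + g) x + apply_bcontfun (G l e) x)))\<^sup>2))"
        unfolding \<phi>_def F_upd by (simp add: plus_bcontfun.rep_eq minus_bcontfun.rep_eq algebra_simps)
      also have "\<dots> = ennreal (\<Sum>e<N l. (norm (ft \<mu> V u (\<lambda>x. apply_bcontfun (F X - G l (X l) + g) x + apply_bcontfun (G l e) x)))\<^sup>2)"
        by (rule sum_ennreal) auto
      also have "\<dots> / ennreal (N l) \<le> ennreal (real (N l) * ?b) / ennreal (N l)"
        using good[of l] * meas unfolding good_def by (intro divide_right_mono_ennreal ennreal_leI) blast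
      also have "\<dots> = ennreal ?b"
      proof (subst divide_ennreal)
        have "0 \<le> cos (1/4 :: real)" using pi_gt3 by (intro cos_ge_zero) auto
        then show "0 \<le> real (N l) * ?b" using \<epsilon>[of l] by simp
      qed (use N[of l] in auto)
      finally show ?thesis .
    qed
    have "(\<integral>\<^sup>+f. \<phi> f \<partial>\<nu>) = (\<integral>\<^sup>+\<omega>. \<phi> (F \<omega>) \<partial>\<Omega>)"
      unfolding \<nu>_def by (rule nn_integral_distr[OF F_meas]) measurable
    also have "\<dots> = (\<integral>\<^sup>+\<omega>. \<phi> (F \<omega>) \<partial>(distr (P l \<Otimes>\<^sub>M \<Omega>) \<Omega> (\<lambda>(x, X). X(l := x))))"
      unfolding resample ..
    also have "\<dots> = (\<integral>\<^sup>+z. \<phi> (F ((\<lambda>(x, X). X(l := x)) z)) \<partial>(P l \<Otimes>\<^sub>M \<Omega>))"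
      using F_meas by (intro nn_integral_distr[OF upd]) measurable
    also have "\<dots> = (\<integral>\<^sup>+X. (\<integral>\<^sup>+x. \<phi> (F (X(l := x))) \<partial>P l) \<partial>\<Omega>)"
      using F_meas upd by (subst pair_sigma_finite.nn_integral_snd[OF pair, symmetric]) auto
    also have "\<dots> \<le> (\<integral>\<^sup>+X. ennreal ?b \<partial>\<Omega>)" by (intro nn_integral_mono inner)
    also have "\<dots> = ennreal ?b" by (simp add: \<Omega>.emeasure_space_1)
    finally show "(\<integral>\<^sup>+f. ennreal ((norm (ft \<mu> V u (apply_bcontfun (f + g))))\<^sup>2) \<partial>\<nu>) \<le> ennreal ?b"
      unfolding \<phi>_def .
  qed
qed

section \<open>The local time\<close>

lemma bcontfun_borel:
  fixes h :: "'a::metric_space \<Rightarrow>\<^sub>C 'b::metric_space"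
  assumes "sets \<mu> = sets borel"
  shows "apply_bcontfun h \<in> borel_measurable \<mu>"
  using borel_measurable_continuous_onI[OF continuous_on_apply_bcontfun[of UNIV h]] measurable_cong_sets[OF assms refl] by blast

definition freq :: "nat \<Rightarrow> ('n::finite \<Rightarrow> int) \<Rightarrow> real ^ 'n" where
  "freq T k = (\<chi> i. real_of_int (k i) / real T)"

text \<open>The l1 norm of the Fourier coefficients on the lattice. It dominates every kernel
  integral over \<open>V\<close>, uniformly in the point \<open>y\<close> and in the order, and so
  bounds the mass that any fiber puts on \<open>V\<close>.\<close>

definition ftsum :: "nat \<Rightarrow> 'a::metric_space measure \<Rightarrow> 'a set \<Rightarrow> ('a \<Rightarrow> real ^ 'n) \<Rightarrow> ennreal" where
  "ftsum T \<mu> V h = (\<integral>\<^sup>+k. ennreal (norm (ft \<mu> V (freq T k) h)) \<partial>count_space UNIV)"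

lemma kern_measurable [measurable]: "kern N \<in> borel_measurable borel"
  unfolding kern_def cosker_def by measurable

lemma kern_abs_le: "\<bar>kern N (v :: real ^ 'n)\<bar> \<le> real (card (int_box N :: ('n \<Rightarrow> int) set))"
proof -
  have "\<bar>kern N v\<bar> = norm (complex_of_real (kern N v))" by simp
  also have "\<dots> \<le> (\<Sum>k\<in>(int_box N :: ('n \<Rightarrow> int) set). 1)"
    unfolding kern_fourier by (intro sum_norm_le) (simp add: norm_mult Wt_nonneg Wt_le_1)
  finally show ?thesis by simp
qed

lemma kern_integrable:
  fixes h :: "'a \<Rightarrow> real ^ 'n"
  assumes "finite_measure \<mu>" "h \<in> borel_measurable \<mu>" "V \<in> sets \<mu>"
  shows "set_integrable \<mu> V (\<lambda>x. kern N (h x))"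
proof -
  interpret finite_measure \<mu> by fact
  have [measurable]: "h \<in> borel_measurable \<mu>" "V \<in> sets \<mu>" by fact+
  show ?thesis unfolding set_integrable_def
  proof (rule integrable_const_bound[where B = "real (card (int_box N :: ('n \<Rightarrow> int) set))"])
    show "AE x in \<mu>. norm (indicat_real V x *\<^sub>R kern N (h x)) \<le> real (card (int_box N :: ('n \<Rightarrow> int) set))"
      using kern_abs_le by (auto simp: indicator_def)
  qed measurable
qed

lemma kern_integral:
  fixes h :: "'a::metric_space \<Rightarrow> real ^ 'n"
  assumes "finite_measure \<mu>" "h \<in> borel_measurable \<mu>" "V \<in> sets \<mu>"
  shows "complex_of_real (LINT x:V|\<mu>. kern N ((1 / real T) *\<^sub>R (h x - y)))
    = (\<Sum>k\<in>int_box N. Wt N k * (cis (- (freq T k \<bullet> y)) * ft \<mu> V (freq T k) h))"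
proof -
  have "complex_of_real (LINT x:V|\<mu>. kern N ((1 / real T) *\<^sub>R (h x - y)))
     = (LINT x:V|\<mu>. complex_of_real (kern N ((1 / real T) *\<^sub>R (h x - y))))"
    by (simp add: set_integral_complex_of_real)
  also have "\<dots> = (LINT x:V|\<mu>. \<Sum>k\<in>int_box N. Wt N k * cis (- (freq T k \<bullet> y)) * cis (freq T k \<bullet> h x))"
  proof (rule set_lebesgue_integral_cong[OF assms(3)], intro allI impI)
    fix x
    show "complex_of_real (kern N ((1 / real T) *\<^sub>R (h x - y))) = (\<Sum>k\<in>int_box N. Wt N k * cis (- (freq T k \<bullet> y)) * cis (freq T k \<bullet> h x))"
      unfolding kern_fourier
    proof (rule sum.cong[OF refl])
      fix k :: "'n \<Rightarrow> int"
      have "(\<chi> i. real_of_int (k i)) \<bullet> ((1 / real T) *\<^sub>R (h x - y)) = - (freq T k \<bullet> y) + freq T k \<bullet> h x"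
        unfolding inner_vec_def freq_def
        by (simp add: sum_negf[symmetric] sum.distrib[symmetric] diff_divide_distrib right_diff_distrib)
      then show "Wt N k * cis ((\<chi> i. real_of_int (k i)) \<bullet> ((1 / real T) *\<^sub>R (h x - y))) =
         Wt N k * cis (- (freq T k \<bullet> y)) * cis (freq T k \<bullet> h x)"
        by (simp add: cis_mult mult.assoc)
    qed
  qed
  also have "\<dots> = (\<Sum>k\<in>int_box N. LINT x:V|\<mu>. Wt N k * cis (- (freq T k \<bullet> y)) * cis (freq T k \<bullet> h x))"
  proof -
    have "set_integrable \<mu> V (\<lambda>x. Wt N k * cis (- (freq T k \<bullet> y)) * cis (freq T k \<bullet> h x))" for k
      by (intro set_integrable_mult_right cis_integrable assms)
    then show ?thesis
      unfolding set_lebesgue_integral_def scaleR_sum_right set_integrable_def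
      by (intro Bochner_Integration.integral_sum) auto
  qed
  also have "\<dots> = (\<Sum>k\<in>int_box N. Wt N k * (cis (- (freq T k \<bullet> y)) * ft \<mu> V (freq T k) h))"
    by (intro sum.cong refl) (simp add: mult.assoc)
  finally show ?thesis .
qed

lemma kern_integral_le_ftsum:
  fixes h :: "'a::metric_space \<Rightarrow> real ^ 'n"
  assumes "finite_measure \<mu>" "h \<in> borel_measurable \<mu>" "V \<in> sets \<mu>"
  shows "ennreal (LINT x:V|\<mu>. kern N ((1 / real T) *\<^sub>R (h x - y))) \<le> ftsum T \<mu> V h"
proof -
  let ?I = "LINT x:V|\<mu>. kern N ((1 / real T) *\<^sub>R (h x - y))"
  have "?I \<le> norm (complex_of_real ?I)" by simp
  also have "\<dots> \<le> (\<Sum>k\<in>(int_box N :: ('n \<Rightarrow> int) set). norm (ft \<mu> V (freq T k) h))"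
    unfolding kern_integral[OF assms]
    by (intro sum_norm_le) (auto simp: norm_mult Wt_nonneg intro: mult_left_le_one_le Wt_le_1)
  finally have "ennreal ?I \<le> ennreal (\<Sum>k\<in>(int_box N :: ('n \<Rightarrow> int) set). norm (ft \<mu> V (freq T k) h))"
    by (rule ennreal_leI)
  also have "\<dots> = (\<Sum>k\<in>(int_box N :: ('n \<Rightarrow> int) set). ennreal (norm (ft \<mu> V (freq T k) h)))"
    by (rule sum_ennreal[symmetric]) auto
  also have "\<dots> = (\<integral>\<^sup>+k. ennreal (norm (ft \<mu> V (freq T k) h)) * indicator (int_box N) k \<partial>count_space UNIV)"
    by (simp add: nn_integral_count_space_indicator[symmetric] nn_integral_count_space_finite)
  also have "\<dots> \<le> ftsum T \<mu> V h"
    unfolding ftsum_def by (intro nn_integral_mono) (auto simp: indicator_def)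
  finally show ?thesis .
qed

text \<open>The frequencies \<open>freq T k\<close> have common period \<open>2 * pi * T\<close>. If the coordinates of \<open>h\<close> are bounded by \<open>T\<close>
  and those of \<open>y\<close> by \<open>2 * T\<close>, then those of \<open>(h - y) / T\<close> are bounded by \<open>3 < pi\<close>, so that no other period
  is seen. The open set is where the density \<open>L\<close> of the image measure is positive.\<close>

lemma fiber_mass:
  fixes \<mu> :: "'a::metric_space measure" and h :: "'a \<Rightarrow>\<^sub>C (real ^ 'n)"
  assumes cpt: "compact (UNIV :: 'a set)" and mu: "finite_measure \<mu>" "sets \<mu> = sets borel"
    and D: "closed D" and T: "0 < T" "\<And>x i. \<bar>h x $ i\<bar> \<le> real T" and fin: "ftsum T \<mu> D h < \<infinity>"
  obtains U where "open U" "emeasure \<mu> (D \<inter> apply_bcontfun h -` (- U)) = 0"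
    "\<And>y. y \<in> U \<Longrightarrow> \<exists>c>0. \<forall>\<W>. (\<forall>W\<in>\<W>. open W) \<longrightarrow> D \<inter> apply_bcontfun h -` {y} \<subseteq> \<Union>\<W> \<longrightarrow>
       (\<exists>\<F>\<subseteq>\<W>. finite \<F> \<and> ennreal c \<le> (\<Sum>W\<in>\<F>. ftsum T \<mu> (D \<inter> W) h))"
proof -
  interpret finite_measure \<mu> by fact
  have space: "space \<mu> = UNIV" using sets_eq_imp_space_eq[OF mu(2)] by simp
  have hm [measurable]: "apply_bcontfun h \<in> borel_measurable \<mu>" by (rule bcontfun_borel[OF mu(2)])
  have op: "open X \<Longrightarrow> X \<in> sets \<mu>" and cl: "closed X \<Longrightarrow> X \<in> sets \<mu>" for X
    unfolding mu(2) by auto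
  have [measurable]: "D \<in> sets \<mu>" by (rule cl[OF D])
  have const_int: "set_integrable \<mu> V (\<lambda>x. c :: real)" if "V \<in> sets \<mu>" for V c
    unfolding set_integrable_def
    by (intro integrable_scaleR_left integrable_real_indicator that) (simp add: emeasure_finite less_top[symmetric])
  define F where "F = (\<lambda>k. ft \<mu> D (freq T k) h)"
  define LN where "LN = (\<lambda>N y. LINT x:D|\<mu>. kern N ((1 / real T) *\<^sub>R (h x - y)))"
  define L where "L = (\<lambda>y. \<integral>k. cis (- (freq T k \<bullet> y)) * F k \<partial>count_space UNIV)"
  \<comment> \<open>A bound for the distance between \<open>LN N\<close> and \<open>L\<close> that
    is uniform in the point. It tends to 0 by dominated convergence, since the coefficients are
    summable and the weights tend to 1.\<close>
  define \<eta> where "\<eta> = (\<lambda>N. \<integral>k. (1 - Wt N k) * norm (F k) \<partial>count_space UNIV)"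
  have F_int: "integrable (count_space UNIV) (\<lambda>k. norm (F k))"
    by (rule integrableI_nonneg) (use fin in \<open>auto simp: ftsum_def F_def\<close>)
  have Fc_int: "integrable (count_space UNIV) (\<lambda>k. cis (- (freq T k \<bullet> y)) * F k)" for y
    by (rule Bochner_Integration.integrable_bound[OF F_int]) (auto simp: norm_mult)
  have W_int: "integrable (count_space UNIV) (\<lambda>k. (1 - Wt N k) * norm (F k))" for N
    by (rule Bochner_Integration.integrable_bound[OF F_int])
      (auto simp: abs_mult Wt_nonneg Wt_le_1 intro!: mult_left_le_one_le)
  have \<eta>_lim: "\<eta> \<longlonglongrightarrow> 0"
  proof -
    have "\<eta> \<longlonglongrightarrow> (\<integral>k. 0 \<partial>count_space (UNIV :: ('n \<Rightarrow> int) set))"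
      unfolding \<eta>_def
    proof (rule integral_dominated_convergence[OF _ _ F_int])
      show "AE k in count_space UNIV. (\<lambda>N. (1 - Wt N k) * norm (F k)) \<longlonglongrightarrow> 0"
      proof (rule AE_I2)
        fix k
        have "(\<lambda>N. (1 - Wt N k) * norm (F k)) \<longlonglongrightarrow> (1 - 1) * norm (F k)"
          by (intro tendsto_intros Wt_tendsto)
        then show "(\<lambda>N. (1 - Wt N k) * norm (F k)) \<longlonglongrightarrow> 0" by simp
      qed
    qed (auto simp: abs_mult Wt_nonneg Wt_le_1 intro!: mult_left_le_one_le)
    then show ?thesis by simp
  qed
  have LN_eq: "complex_of_real (LN N y) = (\<Sum>k\<in>int_box N. Wt N k * (cis (- (freq T k \<bullet> y)) * F k))" for N y
    unfolding LN_def F_def by (rule kern_integral[OF mu(1) hm cl[OF D]])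
  have LN_int: "complex_of_real (LN N y) = (\<integral>k. Wt N k * (cis (- (freq T k \<bullet> y)) * F k) \<partial>count_space UNIV)" for N y
  proof -
    have box: "k \<in> int_box N" if "Wt N k \<noteq> 0" for k :: "'n \<Rightarrow> int" using Wt_eq_0 that by blast
    show ?thesis
      unfolding LN_eq
      by (subst lebesgue_integral_count_space_finite_support)
        (auto intro!: sum.mono_neutral_right finite_subset[OF _ finite_int_box[of N]] simp: box)
  qed
  have close: "norm (complex_of_real (LN N y) - L y) \<le> \<eta> N" for N y
  proof -
    have i: "integrable (count_space UNIV) (\<lambda>k. Wt N k * (cis (- (freq T k \<bullet> y)) * F k))"
      by (rule Bochner_Integration.integrable_bound[OF F_int])
        (auto simp: norm_mult Wt_nonneg Wt_le_1 intro!: mult_left_le_one_le)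
    have "complex_of_real (LN N y) - L y = (\<integral>k. Wt N k * (cis (- (freq T k \<bullet> y)) * F k) - cis (- (freq T k \<bullet> y)) * F k \<partial>count_space UNIV)"
      unfolding LN_int L_def by (rule Bochner_Integration.integral_diff[symmetric, OF i Fc_int])
    also have "norm \<dots> \<le> (\<integral>k. norm (Wt N k * (cis (- (freq T k \<bullet> y)) * F k) - cis (- (freq T k \<bullet> y)) * F k) \<partial>count_space UNIV)"
      by (rule integral_norm_bound)
    also have "\<dots> = \<eta> N"
      unfolding \<eta>_def
    proof (rule Bochner_Integration.integral_cong[OF refl])
      fix k
      have "Wt N k * (cis (- (freq T k \<bullet> y)) * F k) - cis (- (freq T k \<bullet> y)) * F k = complex_of_real (Wt N k - 1) * (cis (- (freq T k \<bullet> y)) * F k)"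
        by (simp add: algebra_simps)
      then show "norm (Wt N k * (cis (- (freq T k \<bullet> y)) * F k) - cis (- (freq T k \<bullet> y)) * F k) = (1 - Wt N k) * norm (F k)"
        using Wt_le_1[of N k] by (simp add: norm_mult del: of_real_diff)
    qed
    finally show ?thesis .
  qed
  have close_Re: "\<bar>LN N y - Re (L y)\<bar> \<le> \<eta> N" for N y
    using order_trans[OF abs_Re_le_cmod close[of N y]] by simp
  have L_cont: "continuous_on UNIV (\<lambda>y. Re (L y))"
  proof -
    have "uniform_limit UNIV (\<lambda>N y. complex_of_real (LN N y)) L sequentially"
    proof (rule uniform_limitI)
      fix e :: real assume "0 < e"
      then have "\<forall>\<^sub>F N in sequentially. \<eta> N < e" using order_tendstoD(2)[OF \<eta>_lim] by auto
      then show "\<forall>\<^sub>F N in sequentially. \<forall>y\<in>UNIV. dist (complex_of_real (LN N y)) (L y) < e"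
      proof (rule eventually_mono, intro ballI)
        fix N y assume "\<eta> N < e"
        have "dist (complex_of_real (LN N y)) (L y) \<le> \<eta> N" unfolding dist_norm by (rule close)
        from this \<open>\<eta> N < e\<close> show "dist (complex_of_real (LN N y)) (L y) < e" by (rule le_less_trans)
      qed
    qed
    moreover have "continuous_on UNIV (\<lambda>y. complex_of_real (LN N y))" for N
      unfolding LN_eq by (intro continuous_intros)
    ultimately have "continuous_on UNIV L"
      by (intro uniform_limit_theorem[where F = sequentially]) auto
    then show ?thesis by (intro continuous_intros)
  qed
  define U where "U = {y. 0 < Re (L y)} \<inter> {y :: real ^ 'n. \<forall>i. \<bar>y $ i\<bar> < 2 * real T}"
  have U_open: "open U"
  proof -
    have eq: "{y :: real ^ 'n. \<forall>i. \<bar>y $ i\<bar> < 2 * real T} = (\<Inter>i. {y. \<bar>y $ i\<bar> < 2 * real T})" by auto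
    show ?thesis
      unfolding U_def eq by (intro open_Int open_INT ballI finite open_Collect_less L_cont continuous_intros)
  qed
  have hU: "h x \<in> U \<longleftrightarrow> 0 < Re (L (h x))" for x
  proof -
    have "\<bar>h x $ i\<bar> < 2 * real T" for i using T(2)[of x i] T(1) by linarith
    then show ?thesis unfolding U_def by auto
  qed
  show thesis
  proof (rule that[OF U_open])
    define Z where "Z = D \<inter> apply_bcontfun h -` (- U)"
    have "closed Z" unfolding Z_def
      using U_open by (intro closed_Int D continuous_closed_vimage continuous_on_imp_continuous_within) auto
    then have Zs [measurable]: "Z \<in> sets \<mu>" by (rule cl)
    \<comment> \<open>At the points of \<open>Z\<close> the limit \<open>L\<close> is not positive,
      so the kernel integral is at most \<open>\<eta>\<close>. On a cell of side
      \<open>T / m\<close> the kernel of order \<open>m ^ 2\<close> is at least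
      \<open>(m / 2) ^ CARD('n)\<close>, which bounds the mass of the cell. There are
      \<open>(2 * m + 1) ^ CARD('n)\<close> cells, and \<open>(2 * m + 1) / (m / 2)\<close> is at
      most 6.\<close>
    have le_m: "measure \<mu> Z \<le> 6 ^ CARD('n) * \<eta> (m ^ 2)" if m: "0 < m" for m
    proof -
      define cell where "cell = (\<lambda>j :: 'n \<Rightarrow> int. {x \<in> Z. \<forall>i. \<lfloor>real m * (h x $ i) / real T\<rfloor> = j i})"
      have cell_sets: "cell j \<in> sets \<mu>" for j
      proof -
        have "cell j = Z \<inter> (\<Inter>i. {x \<in> space \<mu>. real_of_int (j i) \<le> real m * (h x $ i) / real T \<and> real m * (h x $ i) / real T < real_of_int (j i) + 1})"
          unfolding cell_def space by (auto simp: floor_eq_iff)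
        also have "\<dots> \<in> sets \<mu>"
          by (intro sets.Int Zs sets.finite_INT) measurable
        finally show ?thesis .
      qed
      have cover: "Z \<subseteq> (\<Union>j\<in>int_box m. cell j)"
      proof
        fix x assume x: "x \<in> Z"
        have "(\<lambda>i. \<lfloor>real m * (h x $ i) / real T\<rfloor>) \<in> int_box m"
          unfolding int_box_def
        proof (intro CollectI allI)
          fix i
          have "\<bar>real m * (h x $ i) / real T\<bar> \<le> real m"
            using T(2)[of x i] T(1) by (simp add: abs_mult divide_le_eq mult_left_mono)
          then show "\<bar>\<lfloor>real m * (h x $ i) / real T\<rfloor>\<bar> \<le> int m" by linarith
        qed
        then show "x \<in> (\<Union>j\<in>int_box m. cell j)" using x unfolding cell_def by auto
      qed
      have cell_le: "measure \<mu> (cell j) * (real m / 2) ^ CARD('n) \<le> \<eta> (m ^ 2)" for j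
      proof (cases "cell j = {}")
        case True
        have "0 \<le> \<eta> (m ^ 2)" using close[of "m ^ 2" 0] norm_ge_zero order_trans by blast
        then show ?thesis using True by simp
      next
        case False
        then obtain x0 where x0: "x0 \<in> cell j" by auto
        let ?k = "\<lambda>x. kern (m ^ 2) ((1 / real T) *\<^sub>R (h x - h x0))"
        have ge: "(real m / 2) ^ CARD('n) \<le> ?k x" if x: "x \<in> cell j" for x
        proof (rule kern_ge[OF _ m])
          fix i
          have "\<lfloor>real m * (h x $ i) / real T\<rfloor> = \<lfloor>real m * (h x0 $ i) / real T\<rfloor>"
            using x x0 unfolding cell_def by auto
          then have "\<bar>real m * (h x $ i) / real T - real m * (h x0 $ i) / real T\<bar> \<le> 1" by linarith
          moreover have "real m * (((1 / real T) *\<^sub>R (h x - h x0)) $ i) = real m * (h x $ i) / real T - real m * (h x0 $ i) / real T"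
            by (simp add: right_diff_distrib diff_divide_distrib)
          moreover define a where "a = ((1 / real T) *\<^sub>R (h x - h x0)) $ i"
          ultimately have "\<bar>real m * a\<bar> \<le> 1" by metis
          then have "\<bar>a\<bar> \<le> 1 / real m"
            using m by (simp add: abs_mult pos_le_divide_eq mult.commute)
          then show "\<bar>((1 / real T) *\<^sub>R (h x - h x0)) $ i\<bar> \<le> 1 / real m"
            unfolding a_def .
        qed
        have int: "set_integrable \<mu> V ?k" if "V \<in> sets \<mu>" for V
          by (rule kern_integrable[OF mu(1) _ that]) measurable
        have "measure \<mu> (cell j) * (real m / 2) ^ CARD('n) = (LINT x:cell j|\<mu>. (real m / 2) ^ CARD('n))"
          using cell_sets by (simp add: set_integral_const)
        also have "\<dots> \<le> (LINT x:cell j|\<mu>. ?k x)"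
          by (intro set_integral_mono int const_int cell_sets ge)
        also have "\<dots> \<le> LN (m ^ 2) (h x0)"
          using int[OF cell_sets[of j]] int[OF cl[OF D]]
          unfolding LN_def set_integrable_def set_lebesgue_integral_def
          by (intro integral_mono) (auto simp: kern_nonneg cell_def Z_def indicator_def)
        also have "\<dots> \<le> \<eta> (m ^ 2)"
          using close_Re[of "m ^ 2" "h x0"] x0 hU[of x0] unfolding cell_def Z_def by auto
        finally show ?thesis .
      qed
      have "measure \<mu> Z \<le> measure \<mu> (\<Union>j\<in>int_box m. cell j)"
        using cover cell_sets by (intro finite_measure_mono) auto
      also have "\<dots> \<le> (\<Sum>j\<in>(int_box m :: ('n \<Rightarrow> int) set). measure \<mu> (cell j))"
        using cell_sets by (intro finite_measure_subadditive_finite) auto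
      also have "\<dots> \<le> (\<Sum>j\<in>(int_box m :: ('n \<Rightarrow> int) set). \<eta> (m ^ 2) / (real m / 2) ^ CARD('n))"
        using cell_le m by (intro sum_mono) (simp add: pos_le_divide_eq)
      also have "\<dots> = (real (2 * m + 1) / (real m / 2)) ^ CARD('n) * \<eta> (m ^ 2)"
      proof -
        have "a ^ n * (e / b ^ n) = (a / b) ^ n * e" for a b e :: real and n
          by (simp add: power_divide)
        then show ?thesis by (simp only: sum_constant card_int_box of_nat_power)
      qed
      also have "\<dots> \<le> 6 ^ CARD('n) * \<eta> (m ^ 2)"
        using m order_trans[OF norm_ge_zero close[of "m ^ 2" 0]]
        by (intro mult_right_mono power_mono) (auto simp: divide_le_eq)
      finally show ?thesis .
    qed
    have "(\<lambda>m. 6 ^ CARD('n) * \<eta> (m ^ 2)) \<longlonglongrightarrow> 6 ^ CARD('n) * 0"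
      by (intro tendsto_mult_left filterlim_compose[OF \<eta>_lim])
        (auto intro!: filterlim_at_top_mono[OF filterlim_ident] simp: power2_eq_square le_square)
    then have "measure \<mu> Z \<le> 0"
      by (intro LIMSEQ_le_const[where X = "\<lambda>m. 6 ^ CARD('n) * \<eta> (m ^ 2)"]) (auto intro!: exI[of _ 1] le_m)
    then show "emeasure \<mu> (D \<inter> apply_bcontfun h -` (- U)) = 0"
      unfolding Z_def[symmetric] by (simp add: emeasure_eq_measure measure_le_0_iff)
  next
    fix y assume y: "y \<in> U"
    \<comment> \<open>Half of the density at \<open>y\<close>; the other half absorbs the error
      \<open>\<eta> N\<close> and the contribution away from the fiber.\<close>
    define c where "c = Re (L y) / 2"
    have c: "0 < c" using y unfolding U_def c_def by auto
    show "\<exists>c>0. \<forall>\<W>. (\<forall>W\<in>\<W>. open W) \<longrightarrow> D \<inter> apply_bcontfun h -` {y} \<subseteq> \<Union>\<W> \<longrightarrow>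
       (\<exists>\<F>\<subseteq>\<W>. finite \<F> \<and> ennreal c \<le> (\<Sum>W\<in>\<F>. ftsum T \<mu> (D \<inter> W) h))"
    proof (intro exI[of _ c] conjI allI impI c)
      fix \<W> assume \<W>: "\<forall>W\<in>\<W>. open W" "D \<inter> apply_bcontfun h -` {y} \<subseteq> \<Union>\<W>"
      have compact: "closed X \<Longrightarrow> compact X" for X :: "'a set"
        using cpt compact_Int_closed[of UNIV X] by simp
      have hc: "continuous_on X (apply_bcontfun h)" for X by (rule continuous_on_apply_bcontfun)
      have "closed (D \<inter> apply_bcontfun h -` {y})"
        by (intro closed_Int D continuous_closed_vimage continuous_on_imp_continuous_within[OF hc]) auto
      then obtain \<F> where \<F>: "\<F> \<subseteq> \<W>" "finite \<F>" "D \<inter> apply_bcontfun h -` {y} \<subseteq> \<Union>\<F>"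
        by (rule compactE[OF compact \<W>(2)]) (use \<W>(1) in auto)
      \<comment> \<open>The image of the compact set \<open>R\<close> stays away from
        \<open>y\<close>, so the kernel is exponentially small on it. The order \<open>N\<close> may
        depend on the chosen subcover because \<open>c\<close> does not.\<close>
      define R where "R = D - \<Union>\<F>"
      have Wo: "open W" if "W \<in> \<F>" for W using that \<F> \<W> by auto
      have R: "closed R" unfolding R_def using Wo D by (intro closed_Diff open_Union) auto
      then have Rs: "R \<in> sets \<mu>" by (rule cl)
      have "y \<notin> apply_bcontfun h ` R" using \<F>(3) unfolding R_def by auto
      moreover have "closed (apply_bcontfun h ` R)"
        by (rule compact_imp_closed[OF compact_continuous_image[OF hc compact[OF R]]])
      ultimately obtain d where d: "0 < d" "\<And>z. z \<in> apply_bcontfun h ` R \<Longrightarrow> d \<le> dist y z"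
        using separate_point_closed[of "apply_bcontfun h ` R" y] by auto
      \<comment> \<open>Some coordinate of \<open>h x - y\<close> is at least
        \<open>d / CARD('n)\<close> by the l1 bound for the norm; division by \<open>T\<close> is
        the rescaling, and 3 is the range in which the kernel estimates hold.\<close>
      define \<rho> where "\<rho> = min 3 (d / (real CARD('n) * real T))"
      have \<rho>: "0 < \<rho>" "\<rho> \<le> 3" unfolding \<rho>_def using d T by auto
      have far: "kern N ((1 / real T) *\<^sub>R (h x - y)) \<le> (2 * real N) ^ CARD('n) * cos (\<rho> / 2) ^ (2 * N)"
        if x: "x \<in> R" and N: "0 < N" for x N
      proof -
        have "\<exists>i. d / real CARD('n) \<le> \<bar>(h x - y) $ i\<bar>"
        proof (rule ccontr)
          assume "\<not> ?thesis"
          then have "(\<Sum>i\<in>UNIV. \<bar>(h x - y) $ i\<bar>) < (\<Sum>i\<in>(UNIV :: 'n set). d / real CARD('n))"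
            by (intro sum_strict_mono) (auto simp: not_le)
          then have "norm (h x - y) < d" using norm_le_l1_cart[of "h x - y"] by simp
          then show False using d(2)[of "h x"] x by (simp add: dist_norm norm_minus_commute)
        qed
        then obtain i where i: "d / real CARD('n) \<le> \<bar>(h x - y) $ i\<bar>" by auto
        show ?thesis
        proof (rule kern_le[OF _ _ \<rho>(1) N])
          have "\<rho> \<le> (1 / real T) * (d / real CARD('n))" unfolding \<rho>_def by (simp add: mult.commute)
          also have "\<dots> \<le> (1 / real T) * \<bar>(h x - y) $ i\<bar>" using i by (intro mult_left_mono) auto
          also have "\<dots> = \<bar>((1 / real T) *\<^sub>R (h x - y)) $ i\<bar>" by (simp add: abs_mult)
          finally show "\<rho> \<le> \<bar>((1 / real T) *\<^sub>R (h x - y)) $ i\<bar>" .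
          fix j
          have "\<bar>y $ j\<bar> < 2 * real T" using y unfolding U_def by auto
          then have "\<bar>(h x - y) $ j\<bar> \<le> 3 * real T" using T(2)[of x j] by simp
          then show "\<bar>((1 / real T) *\<^sub>R (h x - y)) $ j\<bar> \<le> 3" using T(1) by (simp add: abs_mult field_simps)
        qed
      qed
      define M where "M = measure \<mu> UNIV"
      have "(\<lambda>N. \<eta> N + M * ((2 * real N) ^ CARD('n) * cos (\<rho> / 2) ^ (2 * N))) \<longlonglongrightarrow> 0 + M * 0"
        by (intro tendsto_intros \<eta>_lim kern_far_tendsto \<rho>)
      then have "\<forall>\<^sub>F N in sequentially. \<eta> N + M * ((2 * real N) ^ CARD('n) * cos (\<rho> / 2) ^ (2 * N)) < c"
        using c by (intro order_tendstoD(2)) auto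
      then have "\<forall>\<^sub>F N in sequentially. \<eta> N + M * ((2 * real N) ^ CARD('n) * cos (\<rho> / 2) ^ (2 * N)) < c \<and> 0 < N"
        using eventually_gt_at_top by (rule eventually_conj)
      then obtain N where N: "\<eta> N + M * ((2 * real N) ^ CARD('n) * cos (\<rho> / 2) ^ (2 * N)) < c" "0 < N"
        using eventually_happens'[OF sequentially_bot] by blast
      let ?k = "\<lambda>x. kern N ((1 / real T) *\<^sub>R (h x - y))"
      have int: "set_integrable \<mu> V ?k" if "V \<in> sets \<mu>" for V
        by (rule kern_integrable[OF mu(1) _ that]) measurable
      have DW: "D \<inter> W \<in> sets \<mu>" if "W \<in> \<F>" for W using Wo[OF that] op by auto
      have "2 * c - \<eta> N \<le> LN N y" using close_Re[of N y] unfolding c_def by auto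
      also have "\<dots> \<le> (\<integral>x. (\<Sum>W\<in>\<F>. indicator (D \<inter> W) x *\<^sub>R ?k x) + indicator R x *\<^sub>R ?k x \<partial>\<mu>)"
        unfolding LN_def set_lebesgue_integral_def
      proof (rule integral_mono)
        show "integrable \<mu> (\<lambda>x. indicat_real D x *\<^sub>R ?k x)"
          using int[OF cl[OF D]] unfolding set_integrable_def .
        show "integrable \<mu> (\<lambda>x. (\<Sum>W\<in>\<F>. indicator (D \<inter> W) x *\<^sub>R ?k x) + indicator R x *\<^sub>R ?k x)"
          using int DW Rs unfolding set_integrable_def by auto
        fix x
        have nn: "0 \<le> (\<Sum>W\<in>\<F>. indicat_real (D \<inter> W) x *\<^sub>R ?k x)"
          by (intro sum_nonneg) (auto simp: kern_nonneg)
        show "indicat_real D x *\<^sub>R ?k x \<le> (\<Sum>W\<in>\<F>. indicat_real (D \<inter> W) x *\<^sub>R ?k x) + indicat_real R x *\<^sub>R ?k x"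
        proof (cases "x \<in> D \<and> x \<notin> R")
          case True
          then obtain W where W: "W \<in> \<F>" "x \<in> W" unfolding R_def by auto
          have "indicat_real (D \<inter> W) x *\<^sub>R ?k x \<le> (\<Sum>W\<in>\<F>. indicat_real (D \<inter> W) x *\<^sub>R ?k x)"
            by (rule member_le_sum) (use W \<F>(2) in \<open>auto simp: kern_nonneg\<close>)
          then show ?thesis using True W by (auto simp: kern_nonneg)
        next
          case False
          then have "indicat_real D x = indicat_real R x" by (auto simp: R_def indicator_def)
          then show ?thesis using nn by simp
        qed
      qed
      also have "\<dots> = (\<Sum>W\<in>\<F>. LINT x:D \<inter> W|\<mu>. ?k x) + (LINT x:R|\<mu>. ?k x)"
        using int DW Rs unfolding set_integrable_def set_lebesgue_integral_def
        by (subst Bochner_Integration.integral_add) (auto simp: Bochner_Integration.integral_sum)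
      also have "(LINT x:R|\<mu>. ?k x) \<le> M * ((2 * real N) ^ CARD('n) * cos (\<rho> / 2) ^ (2 * N))" (is "_ \<le> M * ?b")
      proof -
        have "(LINT x:R|\<mu>. ?k x) \<le> (LINT x:R|\<mu>. ?b)"
          by (intro set_integral_mono int const_int Rs far N)
        also have "\<dots> = measure \<mu> R * ?b" using Rs by (simp add: set_integral_const)
        also have "\<dots> \<le> M * ?b"
          unfolding M_def using bounded_measure[of R] space by (intro mult_right_mono) (auto simp: power_mult)
        finally show ?thesis .
      qed
      finally have "c \<le> (\<Sum>W\<in>\<F>. LINT x:D \<inter> W|\<mu>. ?k x)" using N(1) by linarith
      then have "ennreal c \<le> ennreal (\<Sum>W\<in>\<F>. LINT x:D \<inter> W|\<mu>. ?k x)" by (rule ennreal_leI)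
      also have "\<dots> = (\<Sum>W\<in>\<F>. ennreal (LINT x:D \<inter> W|\<mu>. ?k x))"
        by (rule sum_ennreal[symmetric])
          (auto simp: set_lebesgue_integral_def kern_nonneg intro!: Bochner_Integration.integral_nonneg)
      also have "\<dots> \<le> (\<Sum>W\<in>\<F>. ftsum T \<mu> (D \<inter> W) h)"
        by (intro sum_mono kern_integral_le_ftsum mu hm DW)
      finally show "\<exists>\<F>\<subseteq>\<W>. finite \<F> \<and> ennreal c \<le> (\<Sum>W\<in>\<F>. ftsum T \<mu> (D \<inter> W) h)"
        using \<F> by auto
    qed
  qed
qed

section \<open>Decay of the Fourier transform\<close>

text \<open>Once the quotient in the definition is below 1 in modulus, \<open>N(r)\<close> is at
  most \<open>1 / r\<close>. So passing from radius \<open>1 / 2 ^ n\<close> to half of it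
  multiplies the number of balls by at most \<open>2 ^ n\<close>, and the product of these factors
  is at most \<open>2 ^ (n * n)\<close>. The constant \<open>b\<close> accounts for the first few
  radii.\<close>

lemma non_exploding_nets:
  assumes cpt: "compact (UNIV :: 'a::metric_space set)" and ne: "non_exploding (UNIV :: 'a set)"
  shows "\<exists>(b :: nat) (C :: nat \<Rightarrow> 'a set). \<forall>n. finite (C n) \<and> card (C n) \<le> b * 2 ^ (n * n) \<and> UNIV \<subseteq> (\<Union>c\<in>C n. cball c (1 / 2 ^ n))"
proof -
  define N where "N = (\<lambda>r. LEAST n. halving_cover (UNIV :: 'a set) r n)"
  have "\<forall>\<^sub>F r in at_right 0. \<bar>ln (real (N r)) / ln r\<bar> < 1"
    using ne tendstoD[of "\<lambda>r. ln (real (N r)) / ln r" 0 "at_right 0" 1] unfolding non_exploding_def N_def by (auto simp: dist_real_def)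
  moreover have "\<forall>\<^sub>F r in at_right 0. \<exists>n. halving_cover (UNIV :: 'a set) r n"
    using ne unfolding non_exploding_def by auto
  ultimately have "\<forall>\<^sub>F r in at_right 0. \<bar>ln (real (N r)) / ln r\<bar> < 1 \<and> (\<exists>n. halving_cover (UNIV :: 'a set) r n)"
    by (rule eventually_conj)
  then obtain d where d: "0 < d" "\<And>r. 0 < r \<Longrightarrow> r < d \<Longrightarrow> \<bar>ln (real (N r)) / ln r\<bar> < 1 \<and> (\<exists>n. halving_cover (UNIV :: 'a set) r n)"
    unfolding eventually_at_right_field by auto
  obtain n0 where n0: "(1 / 2) ^ n0 < min d 1"
    using real_arch_pow_inv[of "min d 1" "1/2"] d by auto
  have halve: "\<exists>C. finite C \<and> card C \<le> 2 ^ n \<and> cball x (1 / 2 ^ n) \<subseteq> (\<Union>c\<in>C. cball c (1 / 2 ^ Suc n))" if n: "n0 \<le> n" for n and x :: 'a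
  proof -
    define r where "r = (1 / 2 :: real) ^ n"
    have "r \<le> (1 / 2) ^ n0" unfolding r_def using n by (intro power_decreasing) auto
    moreover have "0 < r" unfolding r_def by simp
    ultimately have r: "0 < r" "r < d" "r < 1" using n0 by linarith+
    have hc: "halving_cover (UNIV :: 'a set) r (N r)"
      unfolding N_def by (rule LeastI_ex[OF conjunct2[OF d(2)[OF r(1,2)]]])
    have "real (N r) \<le> 2 ^ n"
    proof (cases "N r = 0")
      case False
      have l: "0 < - ln r" using r by simp
      have "\<bar>ln (real (N r))\<bar> / (- ln r) < 1" using d(2)[OF r(1,2)] l by (simp add: abs_divide)
      then have "\<bar>ln (real (N r))\<bar> < 1 * (- ln r)" unfolding pos_divide_less_eq[OF l] .
      then have "ln (real (N r)) < ln (2 ^ n)" unfolding r_def by (simp add: ln_realpow power_divide ln_div)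
      then show ?thesis using False by simp
    qed simp
    then have "real (N r) \<le> real (2 ^ n)" by simp
    then have "N r \<le> 2 ^ n" by (rule of_nat_le_iff[THEN iffD1])
    moreover obtain C where "finite C" "card C \<le> N r" "cball x r \<inter> UNIV \<subseteq> (\<Union>c\<in>C. cball c (r / 2))"
      using hc unfolding halving_cover_def by blast
    ultimately show ?thesis
      unfolding r_def by (intro exI[of _ C]) (auto simp: power_divide mult.commute)
  qed
  define P where "P = (\<lambda>b n (C :: 'a set). finite C \<and> card C \<le> b * 2 ^ (n * n) \<and> UNIV \<subseteq> (\<Union>c\<in>C. cball c (1 / 2 ^ n)))"
  have "UNIV \<subseteq> (\<Union>x\<in>UNIV. ball x ((1 / 2) ^ n0) :: 'a set)" by auto
  then obtain C0 where "C0 \<subseteq> UNIV" "finite C0" "(UNIV :: 'a set) \<subseteq> (\<Union>x\<in>C0. ball x ((1 / 2) ^ n0))"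
    by (rule compactE_image[OF cpt open_ball]) (rule that, assumption+)
  then have C0: "finite C0" "(UNIV :: 'a set) \<subseteq> (\<Union>x\<in>C0. cball x (1 / 2 ^ n0))"
    by (auto simp: power_divide subset_iff) (meson less_imp_le)
  define b where "b = card C0"
  have ge: "\<exists>C. P b n C" if "n0 \<le> n" for n
    using that
  proof (induction n rule: dec_induct)
    case base
    show ?case unfolding P_def b_def using C0 by (intro exI[of _ C0]) auto
  next
    case (step n)
    then obtain C where C: "P b n C" by auto
    have "\<forall>x :: 'a. \<exists>D. finite D \<and> card D \<le> 2 ^ n \<and> cball x (1 / 2 ^ n) \<subseteq> (\<Union>c\<in>D. cball c (1 / 2 ^ Suc n))"
      using halve[OF \<open>n0 \<le> n\<close>] by (rule allI)
    from choice[OF this] obtain D where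
      D: "\<forall>x :: 'a. finite (D x) \<and> card (D x) \<le> 2 ^ n \<and> cball x (1 / 2 ^ n) \<subseteq> (\<Union>c\<in>D x. cball c (1 / 2 ^ Suc n))" ..
    have "P b (Suc n) (\<Union>x\<in>C. D x)"
      unfolding P_def
    proof (intro conjI)
      show "finite (\<Union>x\<in>C. D x)" using C D unfolding P_def by auto
      have "card (\<Union>x\<in>C. D x) \<le> (\<Sum>x\<in>C. card (D x))" using C unfolding P_def by (intro card_UN_le) auto
      also have "\<dots> \<le> (\<Sum>x\<in>C. 2 ^ n)" using D by (intro sum_mono) auto
      also have "\<dots> \<le> (b * 2 ^ (n * n)) * 2 ^ n" using C unfolding P_def by simp
      also have "\<dots> = b * 2 ^ (n * n + n)" by (simp add: power_add)
      also have "\<dots> \<le> b * 2 ^ (Suc n * Suc n)" by (intro mult_left_mono power_increasing) auto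
      finally show "card (\<Union>x\<in>C. D x) \<le> b * 2 ^ (Suc n * Suc n)" .
      show "UNIV \<subseteq> (\<Union>c\<in>(\<Union>x\<in>C. D x). cball c (1 / 2 ^ Suc n))"
      proof
        fix y :: 'a
        obtain x where "x \<in> C" "y \<in> cball x (1 / 2 ^ n)" using C unfolding P_def by blast
        then show "y \<in> (\<Union>c\<in>(\<Union>x\<in>C. D x). cball c (1 / 2 ^ Suc n))" using D by blast
      qed
    qed
    then show ?case by blast
  qed
  have "\<exists>C. P b n C" for n
  proof (cases "n0 \<le> n")
    case False
    have "cball x (1 / 2 ^ n0) \<subseteq> cball x (1 / 2 ^ n)" for x :: 'a
      using False by (intro subset_cball divide_left_mono power_increasing) auto
    then have "UNIV \<subseteq> (\<Union>c\<in>C0. cball c (1 / 2 ^ n))" using C0(2) by blast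
    then show ?thesis unfolding P_def b_def using C0 by (intro exI[of _ C0]) auto
  qed (rule ge)
  then have "\<forall>n. \<exists>C. P b n C" by blast
  from choice[OF this] obtain C where "\<forall>n. P b n (C n)" ..
  then show ?thesis unfolding P_def by blast
qed

text \<open>A sum over the lattice becomes an increasing countable limit of finite sums, which gives
  measurability in the random map and allows monotone convergence under \<nu>.\<close>

lemma nn_integral_int_box:
  "(\<integral>\<^sup>+k. f k \<partial>count_space (UNIV :: ('n::finite \<Rightarrow> int) set)) = (SUP N. \<Sum>k\<in>int_box N. f k)"
proof -
  have mono: "int_box M \<subseteq> int_box N" if "M \<le> N" for M N
    using that unfolding int_box_def by (auto intro: order_trans)
  have "(\<Union>N. int_box N) = (UNIV :: ('n \<Rightarrow> int) set)"
  proof -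
    have "k \<in> int_box (nat (\<Sum>i\<in>UNIV. \<bar>k i\<bar>))" for k :: "'n \<Rightarrow> int"
      unfolding int_box_def using member_le_sum[of _ UNIV "\<lambda>i. \<bar>k i\<bar>"] by (auto simp: sum_nonneg)
    then show ?thesis by blast
  qed
  then have sup: "(SUP N. f k * indicator (int_box N) k) = f k" for k
  proof -
    obtain N where N: "k \<in> int_box N" using \<open>(\<Union>N. int_box N) = UNIV\<close> by blast
    show ?thesis
    proof (rule antisym)
      show "f k \<le> (SUP N. f k * indicator (int_box N) k)"
        by (rule SUP_upper2[of N]) (use N in auto)
    qed (auto intro!: SUP_least simp: indicator_def)
  qed
  have "(\<integral>\<^sup>+k. f k \<partial>count_space UNIV) = (\<integral>\<^sup>+k. (SUP N. f k * indicator (int_box N) k) \<partial>count_space UNIV)"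
    unfolding sup ..
  also have "\<dots> = (SUP N. \<integral>\<^sup>+k. f k * indicator (int_box N) k \<partial>count_space UNIV)"
    by (intro nn_integral_monotone_convergence_SUP) (auto simp: incseq_def le_fun_def indicator_def dest: mono)
  also have "\<dots> = (SUP N. \<Sum>k\<in>int_box N. f k)"
    by (simp add: nn_integral_count_space_indicator[symmetric] nn_integral_count_space_finite)
  finally show ?thesis .
qed

section \<open>Summability over the lattice and decay in expectation\<close>

lemma summable_exp_sqrt: "0 < a \<Longrightarrow> summable (\<lambda>n. exp (- a * sqrt (real n)))"
proof (rule summable_comparison_test_ev)
  assume "0 < a"
  then have "\<forall>\<^sub>F n in sequentially. exp (- a * sqrt (real n)) \<le> 1 / real n ^ 2" by real_asymp
  then show "\<forall>\<^sub>F n in sequentially. norm (exp (- a * sqrt (real n))) \<le> inverse (real n ^ 2)"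
    by eventually_elim (simp add: inverse_eq_divide)
qed (rule inverse_power_summable, simp)

text \<open>The sum over a box factorises over the coordinates, and each one-dimensional sum
  converges.\<close>

lemma lattice_sum_bound:
  assumes "0 < a"
  obtains S :: real where "0 \<le> S"
    "\<And>N. (\<Sum>k\<in>(int_box N :: ('n::finite \<Rightarrow> int) set). \<Prod>i\<in>UNIV. exp (- a * sqrt \<bar>real_of_int (k i)\<bar>)) \<le> S"
proof -
  define g where "g = (\<lambda>j :: int. exp (- a * sqrt \<bar>real_of_int j\<bar>))"
  define s where "s = (\<Sum>n. exp (- a * sqrt (real n)))"
  have s0: "0 \<le> s" unfolding s_def by (intro suminf_nonneg summable_exp_sqrt assms) auto
  have le: "(\<Sum>j\<in>{- int N..int N}. g j) \<le> 2 * s" for N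
  proof -
    have p: "(\<Sum>n\<le>N. exp (- a * sqrt (real n))) \<le> s"
      unfolding s_def by (intro sum_le_suminf summable_exp_sqrt assms) auto
    have "(\<Sum>j\<in>{- int N..int N}. g j) \<le> (\<Sum>j\<in>int ` {..N} \<union> (\<lambda>n. - int n) ` {..N}. g j)"
    proof (rule sum_mono2)
      show "{- int N..int N} \<subseteq> int ` {..N} \<union> (\<lambda>n. - int n) ` {..N}"
      proof
        fix j assume j: "j \<in> {- int N..int N}"
        show "j \<in> int ` {..N} \<union> (\<lambda>n. - int n) ` {..N}"
        proof (cases "0 \<le> j")
          case True
          then have "j = int (nat j)" "nat j \<le> N" using j by auto
          then show ?thesis by blast
        next
          case False
          then have "j = - int (nat (- j))" "nat (- j) \<le> N" using j by auto
          then show ?thesis by blast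
        qed
      qed
    qed (auto simp: g_def)
    also have "\<dots> \<le> (\<Sum>j\<in>int ` {..N}. g j) + (\<Sum>j\<in>(\<lambda>n. - int n) ` {..N}. g j)"
      by (subst sum.union_inter[symmetric]) (auto intro!: sum_nonneg simp: g_def)
    also have "\<dots> = (\<Sum>n\<le>N. exp (- a * sqrt (real n))) + (\<Sum>n\<le>N. exp (- a * sqrt (real n)))"
      by (simp add: sum.reindex inj_on_def g_def)
    finally show ?thesis using p by simp
  qed
  show thesis
  proof (rule that[of "(2 * s) ^ CARD('n)"])
    show "0 \<le> (2 * s) ^ CARD('n)" using s0 by simp
    fix N
    have "(\<Sum>k\<in>(int_box N :: ('n \<Rightarrow> int) set). \<Prod>i\<in>UNIV. g (k i)) = (\<Prod>i\<in>(UNIV :: 'n set). \<Sum>j\<in>{- int N..int N}. g j)"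
      unfolding int_box_PiE by (rule prod_sum_PiE[symmetric]) auto
    also have "\<dots> \<le> (\<Prod>i\<in>(UNIV :: 'n set). 2 * s)"
      using le by (intro prod_mono) (auto intro!: sum_nonneg simp: g_def)
    finally show "(\<Sum>k\<in>(int_box N :: ('n \<Rightarrow> int) set). \<Prod>i\<in>UNIV. exp (- a * sqrt \<bar>real_of_int (k i)\<bar>)) \<le> (2 * s) ^ CARD('n)"
      unfolding g_def by simp
  qed
qed

lemma decaying_series:
  fixes \<mu> :: "'a::metric_space measure"
  assumes cpt: "compact (UNIV :: 'a set)"
    and mu: "finite_measure \<mu>" "sets \<mu> = sets borel" "\<And>x. emeasure \<mu> {x} = 0"
  obtains \<nu> :: "('a \<Rightarrow>\<^sub>C (real ^ 'n)) measure" and A :: "nat \<Rightarrow> 'a set" and K a :: real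
  where "prob_space \<nu>" "sets \<nu> = sets borel" "\<And>l. closed (A l)" "\<And>l. measure \<mu> (- A l) \<le> (1/2) ^ l" "0 < K" "0 < a"
    "\<And>j V u c0 g. V \<in> sets \<mu> \<Longrightarrow> V \<subseteq> (\<Inter>l\<in>{j..}. A l) \<Longrightarrow> 4 ^ j \<le> \<bar>u $ c0\<bar> \<Longrightarrow>
      (\<integral>\<^sup>+f. ennreal (norm (ft \<mu> V u (apply_bcontfun (f + g)))) \<partial>\<nu>) \<le> ennreal (K * exp (- a * sqrt \<bar>u $ c0\<bar>))"
proof -
  define q where "q = cos (1/4 :: real)"
  have q0: "0 < q" unfolding q_def using pi_gt3 by (intro cos_gt_zero) auto
  have q1: "q < 1" unfolding q_def using cos_monotone_0_pi[of 0 "1/4"] pi_gt3 by auto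
  \<comment> \<open>The factor \<open>(1/2) ^ l\<close> makes the discarded sets summable; the
    factor \<open>q ^ (2 ^ l)\<close> brings the diagonal terms down to the order of the
    off-diagonal ones.\<close>
  define \<epsilon> where "\<epsilon> = (\<lambda>l. (1/2) ^ l * q ^ (2 ^ l))"
  have \<epsilon>: "0 < \<epsilon> l" "\<epsilon> l \<le> (1/2) ^ l" "\<epsilon> l \<le> q ^ (2 ^ l)" for l
  proof -
    have "(1/2 :: real) ^ l \<le> 1" by (simp add: power_le_one)
    then show "\<epsilon> l \<le> q ^ (2 ^ l)" unfolding \<epsilon>_def using q0 by (intro mult_left_le_one_le) auto
    have "q ^ (2 ^ l) \<le> 1" using q0 q1 by (simp add: power_le_one)
    then show "\<epsilon> l \<le> (1/2) ^ l" unfolding \<epsilon>_def using q0 by (intro mult_right_le_one_le) auto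
  qed (use q0 in \<open>simp add: \<epsilon>_def\<close>)
  obtain \<nu> :: "('a \<Rightarrow>\<^sub>C (real ^ 'n)) measure" and A :: "nat \<Rightarrow> 'a set" where
    \<nu>: "prob_space \<nu>" "sets \<nu> = sets borel" and A: "\<And>l. closed (A l)" "\<And>l. measure \<mu> (- A l) \<le> \<epsilon> l"
    and sq: "\<And>l V u c0 g. V \<in> sets \<mu> \<Longrightarrow> V \<subseteq> A l \<Longrightarrow> 4 ^ l \<le> \<bar>u $ c0\<bar> \<Longrightarrow> \<bar>u $ c0\<bar> < 4 ^ Suc l \<Longrightarrow>
      (\<integral>\<^sup>+f. ennreal ((norm (ft \<mu> V u (apply_bcontfun (f + g))))\<^sup>2) \<partial>\<nu>)
        \<le> ennreal (measure \<mu> UNIV * \<epsilon> l + cos (1/4) ^ (2 ^ l) * (measure \<mu> UNIV)\<^sup>2)"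
    by (rule random_series[OF cpt mu \<epsilon>(1), where 'n = 'n]) (rule that, assumption+)
  interpret \<nu>: prob_space \<nu> by fact
  define M where "M = measure \<mu> UNIV"
  have M: "0 \<le> M" unfolding M_def by simp
  \<comment> \<open>A second moment of order \<open>q ^ (2 ^ l)\<close> gives a first moment of
    order \<open>p ^ (2 ^ l)\<close>.\<close>
  define p where "p = sqrt q"
  have p: "0 < p" "p < 1" "p ^ 2 = q" unfolding p_def using q0 q1 by auto
  \<comment> \<open>As \<open>sqrt \<bar>u $ c0\<bar> \<le> 2 ^ Suc l\<close>, the division by 2
    yields \<open>p ^ (2 ^ l) \<le> exp (- a * sqrt \<bar>u $ c0\<bar>)\<close>.\<close>
  define a where "a = - ln p / 2"
  have a: "0 < a" unfolding a_def using p by simp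
  show thesis
  proof (rule that[of \<nu> A "1 + M" a])
    fix j V c0 and u :: "real ^ 'n" and g :: "'a \<Rightarrow>\<^sub>C (real ^ 'n)"
    assume *: "V \<in> sets \<mu>" "V \<subseteq> (\<Inter>l\<in>{j..}. A l)" "4 ^ j \<le> \<bar>u $ c0\<bar>"
    have "\<exists>l. \<bar>u $ c0\<bar> < 4 ^ l" using real_arch_pow[of 4 "\<bar>u $ c0\<bar>"] by auto
    then obtain l' where l': "\<bar>u $ c0\<bar> < 4 ^ l'" "\<And>m. m < l' \<Longrightarrow> 4 ^ m \<le> \<bar>u $ c0\<bar>"
      using exists_least_iff[of "\<lambda>l. \<bar>u $ c0\<bar> < 4 ^ l"] by (auto simp: not_less)
    have "j < l'"
    proof (rule ccontr)
      assume "\<not> j < l'"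
      then have "(4 :: real) ^ l' \<le> 4 ^ j" by (intro power_increasing) auto
      then show False using l'(1) *(3) by linarith
    qed
    then obtain l where l: "l' = Suc l" "j \<le> l" by (cases l') auto
    define b where "b = (1 + M) * p ^ (2 ^ l)"
    have b: "0 < b" unfolding b_def using M p by simp
    have "M * \<epsilon> l + q ^ (2 ^ l) * M\<^sup>2 \<le> M * q ^ (2 ^ l) + q ^ (2 ^ l) * M\<^sup>2"
      using \<epsilon>(3)[of l] M by (intro add_right_mono mult_left_mono) auto
    also have "\<dots> = (M + M\<^sup>2) * q ^ (2 ^ l)" by (simp add: algebra_simps)
    also have "\<dots> \<le> (1 + M)\<^sup>2 * q ^ (2 ^ l)"
      using M q0 by (intro mult_right_mono) (auto simp: power2_eq_square algebra_simps)
    also have "\<dots> = b\<^sup>2" unfolding b_def p(3)[symmetric] by (simp add: power_mult_distrib power_mult[symmetric] mult.commute)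
    finally have le: "M * \<epsilon> l + q ^ (2 ^ l) * M\<^sup>2 \<le> b\<^sup>2" .
    let ?X = "\<lambda>f. norm (ft \<mu> V u (apply_bcontfun (f + g)))"
    have meas: "?X \<in> borel_measurable \<nu>"
    proof -
      have "(\<lambda>f. ft \<mu> V u (apply_bcontfun (f + g))) \<in> borel_measurable borel"
        by (intro borel_measurable_continuous_onI continuous_on_compose2[OF ft_continuous[OF mu(1,2) *(1)]] continuous_intros) auto
      then have "?X \<in> borel_measurable borel" by measurable
      then show ?thesis using measurable_cong_sets[OF \<nu>(2) refl] by blast
    qed
    have VA: "V \<subseteq> A l" using *(2) l(2) by auto
    have ul: "4 ^ l \<le> \<bar>u $ c0\<bar>" "\<bar>u $ c0\<bar> < 4 ^ Suc l" using l'(1) l'(2)[of l] unfolding l(1) by simp_all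
    have square: "(\<integral>\<^sup>+f. ennreal ((?X f)\<^sup>2) \<partial>\<nu>) \<le> ennreal (b\<^sup>2)"
      by (rule order_trans[OF sq[OF *(1) VA ul, folded M_def q_def] ennreal_leI[OF le]])
    \<comment> \<open>AM-GM, in place of the Cauchy-Schwarz inequality\<close>
    have "(\<integral>\<^sup>+f. ennreal (?X f) \<partial>\<nu>) \<le> (\<integral>\<^sup>+f. ennreal (b / 2) + ennreal (1 / (2 * b)) * ennreal ((?X f)\<^sup>2) \<partial>\<nu>)"
    proof (rule nn_integral_mono)
      fix f
      have "0 \<le> (?X f - b)\<^sup>2 / (2 * b)" using b by simp
      also have "\<dots> = b / 2 + 1 / (2 * b) * (?X f)\<^sup>2 - ?X f" using b by (simp add: power2_diff field_simps power2_eq_square)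
      finally have "?X f \<le> b / 2 + 1 / (2 * b) * (?X f)\<^sup>2" by simp
      then have "ennreal (?X f) \<le> ennreal (b / 2 + 1 / (2 * b) * (?X f)\<^sup>2)" by (rule ennreal_leI)
      also have "\<dots> = ennreal (b / 2) + ennreal (1 / (2 * b)) * ennreal ((?X f)\<^sup>2)"
        using b by (subst ennreal_plus, simp, simp) (subst ennreal_mult, auto)
      finally show "ennreal (?X f) \<le> ennreal (b / 2) + ennreal (1 / (2 * b)) * ennreal ((?X f)\<^sup>2)" .
    qed
    also have "\<dots> = ennreal (b / 2) + ennreal (1 / (2 * b)) * (\<integral>\<^sup>+f. ennreal ((?X f)\<^sup>2) \<partial>\<nu>)"
      using meas by (simp add: nn_integral_add nn_integral_cmult \<nu>.emeasure_space_1)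
    also have "\<dots> \<le> ennreal (b / 2) + ennreal (1 / (2 * b)) * ennreal (b\<^sup>2)"
      by (intro add_left_mono mult_left_mono square) auto
    also have "\<dots> = ennreal b"
      using b by (simp add: ennreal_plus[symmetric] ennreal_mult[symmetric] power2_eq_square field_simps del: ennreal_plus)
    also have "\<dots> \<le> ennreal ((1 + M) * exp (- a * sqrt \<bar>u $ c0\<bar>))"
    proof (rule ennreal_leI)
      have "\<bar>u $ c0\<bar> \<le> (2 ^ Suc l)\<^sup>2" using l'(1) unfolding l(1) by (simp add: power_mult[symmetric] power2_eq_square power_mult_distrib[symmetric])
      then have "sqrt \<bar>u $ c0\<bar> \<le> 2 ^ Suc l" by (intro real_le_lsqrt) auto
      then have "- ln p / 2 * sqrt \<bar>u $ c0\<bar> \<le> - ln p / 2 * 2 ^ Suc l" using a unfolding a_def by (intro mult_left_mono) auto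
      then have "2 ^ l * ln p \<le> - a * sqrt \<bar>u $ c0\<bar>" unfolding a_def by (simp add: mult.commute)
      moreover have "p ^ (2 ^ l) = exp (2 ^ l * ln p)" using p by (simp add: exp_of_nat_mult[of "2 ^ l" "ln p", simplified])
      ultimately have "p ^ (2 ^ l) \<le> exp (- a * sqrt \<bar>u $ c0\<bar>)" by simp
      then show "b \<le> (1 + M) * exp (- a * sqrt \<bar>u $ c0\<bar>)" unfolding b_def using M by (intro mult_left_mono) auto
    qed
    finally show "(\<integral>\<^sup>+f. ennreal (?X f) \<partial>\<nu>) \<le> ennreal ((1 + M) * exp (- a * sqrt \<bar>u $ c0\<bar>))" .
  next
    show "measure \<mu> (- A l) \<le> (1/2) ^ l" for l by (rule order_trans[OF A(2) \<epsilon>(2)])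
  qed (use \<nu> A(1) a M in auto)
qed

text \<open>The exponent 8 is large enough for \<open>exp (- a * sqrt ((n + 1) ^ 8))\<close> to beat the \<open>2 ^ (n * n)\<close> balls of
  radius \<open>1 / 2 ^ n\<close>, whereas the number of remaining low frequencies is polynomial in \<open>n\<close>.\<close>

definition high_freqs :: "nat \<Rightarrow> nat \<Rightarrow> nat \<Rightarrow> ('n::finite \<Rightarrow> int) set" where
  "high_freqs T j n = {k. \<exists>i. real T * 4 ^ j * (real n + 1) ^ 8 \<le> \<bar>real_of_int (k i)\<bar>}"

definition high_sum :: "nat \<Rightarrow> nat \<Rightarrow> nat \<Rightarrow> 'a::metric_space measure \<Rightarrow> 'a set \<Rightarrow> ('a \<Rightarrow> real ^ 'n) \<Rightarrow> ennreal" where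
  "high_sum T j n \<mu> V h = (\<integral>\<^sup>+k. ennreal (norm (ft \<mu> V (freq T k) h)) * indicator (high_freqs T j n) k \<partial>count_space UNIV)"

text \<open>Its finiteness is the only random property of \<open>h\<close> that is used; everything
  about the fibers then follows for each single \<open>h\<close>. The weights leave an error of
  order \<open>1 / 2 ^ (n * n)\<close> for each set of level \<open>n\<close>.\<close>

definition total_high :: "nat \<Rightarrow> nat \<Rightarrow> 'a::metric_space measure \<Rightarrow> (nat \<Rightarrow> 'a set set) \<Rightarrow> ('a \<Rightarrow> real ^ 'n) \<Rightarrow> ennreal" where
  "total_high T j \<mu> F h = (\<Sum>n. ennreal (2 ^ (n * n)) * (\<Sum>V\<in>F n. high_sum T j n \<mu> V h))"

section \<open>Almost sure finiteness of the high-frequency sums\<close>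

lemma ft_measurable:
  fixes \<mu> :: "'a::metric_space measure"
  assumes "finite_measure \<mu>" "sets \<mu> = sets borel" "V \<in> sets \<mu>"
  shows "(\<lambda>f :: 'a \<Rightarrow>\<^sub>C (real ^ 'n). ennreal (norm (ft \<mu> V u f))) \<in> borel_measurable borel"
proof -
  have "(\<lambda>f :: 'a \<Rightarrow>\<^sub>C (real ^ 'n). ft \<mu> V u f) \<in> borel_measurable borel"
    by (intro borel_measurable_continuous_onI ft_continuous assms)
  then show ?thesis by measurable
qed

lemma high_sum_measurable:
  fixes \<mu> :: "'a::metric_space measure"
  assumes "finite_measure \<mu>" "sets \<mu> = sets borel" "V \<in> sets \<mu>"
  shows "(\<lambda>f :: 'a \<Rightarrow>\<^sub>C (real ^ 'n). high_sum T j n \<mu> V f) \<in> borel_measurable borel"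
  unfolding high_sum_def nn_integral_int_box
  by (intro borel_measurable_SUP borel_measurable_sum borel_measurable_times_ennreal ft_measurable[OF assms] borel_measurable_const) auto

lemma total_high_measurable:
  fixes \<mu> :: "'a::metric_space measure"
  assumes "finite_measure \<mu>" "sets \<mu> = sets borel" "\<And>n V. V \<in> F n \<Longrightarrow> V \<in> sets \<mu>"
  shows "(\<lambda>f :: 'a \<Rightarrow>\<^sub>C (real ^ 'n). total_high T j \<mu> F f) \<in> borel_measurable borel"
  unfolding total_high_def
  by (intro borel_measurable_suminf_order borel_measurable_times_ennreal borel_measurable_const borel_measurable_sum high_sum_measurable assms)

text \<open>One factor \<open>2 ^ (n * n)\<close> counts the sets of level \<open>n\<close>, the
  other is the weight in \<open>total_high\<close>. The power 4 is half of the exponent 8 in the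
  threshold, because the decay involves a square root.\<close>

lemma summable_superexponential:
  assumes "0 < a"
  shows "summable (\<lambda>n. 2 ^ (n * n) * 2 ^ (n * n) * exp (- a * (real n + 1) ^ 4))"
proof (rule summable_comparison_test_ev)
  have "\<forall>\<^sub>F n in sequentially. exp (ln 2 * (real n * real n)) * exp (ln 2 * (real n * real n)) * exp (- a * (real n + 1) ^ 4) \<le> 1 / real n ^ 2"
    using assms by real_asymp
  moreover have "exp (ln 2 * (real n * real n)) = 2 ^ (n * n)" for n
  proof -
    have "exp (ln 2 * (real n * real n)) = exp (of_nat (n * n) * ln 2)" by (simp add: mult.commute)
    also have "\<dots> = 2 ^ (n * n)" by (subst exp_of_nat_mult) simp
    finally show ?thesis .
  qed
  ultimately show "\<forall>\<^sub>F n in sequentially. norm (2 ^ (n * n) * 2 ^ (n * n) * exp (- a * (real n + 1) ^ 4)) \<le> inverse (real n ^ 2)"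
    by (simp add: inverse_eq_divide abs_mult)
qed (rule inverse_power_summable, simp)

text \<open>The exponent is split into halves. One is bounded by means of the threshold of
  \<open>high_freqs\<close> and pays for the sets of level \<open>n\<close>; the other is spread
  over all coordinates and makes the sum over the lattice converge.\<close>

lemma frequency_decay:
  fixes k :: "'n::finite \<Rightarrow> int"
  assumes T: "0 < T" and k: "k \<in> high_freqs T j n" and a: "0 < a"
  obtains i where "4 ^ j \<le> \<bar>freq T k $ i\<bar>"
    "exp (- a * sqrt \<bar>freq T k $ i\<bar>) \<le> exp (- (a / 2) * (real n + 1) ^ 4) *
      (\<Prod>i\<in>UNIV. exp (- (a / (2 * real CARD('n) * sqrt (real T))) * sqrt \<bar>real_of_int (k i)\<bar>))"
proof -
  \<comment> \<open>The largest coordinate dominates both the one that exceeds the threshold and the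
    mean of the square roots of all of them.\<close>
  define m where "m = Max (range (\<lambda>i. \<bar>k i\<bar>))"
  have "m \<in> range (\<lambda>i. \<bar>k i\<bar>)" unfolding m_def by (intro Max_in) auto
  then obtain i where i: "m = \<bar>k i\<bar>" by auto
  have max: "\<bar>k i'\<bar> \<le> \<bar>k i\<bar>" for i' unfolding i[symmetric] m_def by (intro Max_ge) auto
  define u where "u = \<bar>freq T k $ i\<bar>"
  have u: "u = \<bar>real_of_int (k i)\<bar> / real T" unfolding u_def freq_def by simp
  have ge: "4 ^ j * (real n + 1) ^ 8 \<le> u"
  proof -
    obtain i' where "real T * 4 ^ j * (real n + 1) ^ 8 \<le> \<bar>real_of_int (k i')\<bar>" using k unfolding high_freqs_def by auto
    also have "\<dots> \<le> \<bar>real_of_int (k i)\<bar>" using max[of i'] by linarith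
    finally show ?thesis unfolding u using T by (simp add: pos_le_divide_eq mult_ac)
  qed
  have one: "1 \<le> (real n + 1) ^ 8" "(1 :: real) \<le> 4 ^ j" by simp_all
  have "4 ^ j * 1 \<le> 4 ^ j * (real n + 1) ^ 8" using one by (intro mult_left_mono) auto
  from order_trans[OF this ge] have u4: "4 ^ j \<le> u" by simp
  have "1 * (real n + 1) ^ 8 \<le> 4 ^ j * (real n + 1) ^ 8" using one by (intro mult_right_mono) auto
  from order_trans[OF this ge] have "((real n + 1) ^ 4)\<^sup>2 \<le> u" by (simp add: power_mult[symmetric])
  then have s1: "(real n + 1) ^ 4 \<le> sqrt u" by (rule real_le_rsqrt)
  have s2: "(\<Sum>i'\<in>UNIV. sqrt \<bar>real_of_int (k i')\<bar>) / (real CARD('n) * sqrt (real T)) \<le> sqrt u"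
  proof -
    have "(\<Sum>i'\<in>UNIV. sqrt \<bar>real_of_int (k i')\<bar>) \<le> (\<Sum>i'\<in>(UNIV :: 'n set). sqrt \<bar>real_of_int (k i)\<bar>)"
      using max by (intro sum_mono real_sqrt_le_mono) (metis of_int_abs of_int_le_iff)
    also have "\<dots> = real CARD('n) * sqrt (real T) * sqrt u" unfolding u using T by (simp add: real_sqrt_divide)
    finally show ?thesis using T by (simp add: pos_divide_le_eq mult_ac)
  qed
  have "a / 2 * ((real n + 1) ^ 4 + (\<Sum>i'\<in>UNIV. sqrt \<bar>real_of_int (k i')\<bar>) / (real CARD('n) * sqrt (real T))) \<le> a / 2 * (sqrt u + sqrt u)"
    using s1 s2 a by (intro mult_left_mono add_mono) auto
  then have "- a * sqrt u \<le> - (a / 2) * (real n + 1) ^ 4 + - (a / 2) * ((\<Sum>i'\<in>UNIV. sqrt \<bar>real_of_int (k i')\<bar>) / (real CARD('n) * sqrt (real T)))"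
    by (simp add: algebra_simps)
  also have "- (a / 2) * ((\<Sum>i'\<in>UNIV. sqrt \<bar>real_of_int (k i')\<bar>) / (real CARD('n) * sqrt (real T)))
     = (\<Sum>i'\<in>UNIV. - (a / (2 * real CARD('n) * sqrt (real T))) * sqrt \<bar>real_of_int (k i')\<bar>)"
    by (simp add: sum_distrib_left[symmetric] sum_negf sum_divide_distrib[symmetric] mult_ac)
  finally have "exp (- a * sqrt u) \<le> exp (- (a / 2) * (real n + 1) ^ 4) * exp (\<Sum>i'\<in>UNIV. - (a / (2 * real CARD('n) * sqrt (real T))) * sqrt \<bar>real_of_int (k i')\<bar>)"
    by (simp add: exp_add[symmetric])
  then show thesis using that[of i] u4 unfolding u_def by (simp add: exp_sum)
qed

text \<open>The expectation is finite: it reduces to the decay of single transforms, summed over the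
  lattice, the sets of one level and the levels.\<close>

lemma total_high_finite:
  fixes \<mu> :: "'a::metric_space measure" and \<nu> :: "('a \<Rightarrow>\<^sub>C (real ^ 'n)) measure"
  assumes mu: "finite_measure \<mu>" "sets \<mu> = sets borel" and \<nu>: "prob_space \<nu>" "sets \<nu> = sets borel"
    and K: "0 < K" "0 < a" and T: "0 < T"
    and F: "\<And>n. finite (F n)" "\<And>n. card (F n) \<le> b * 2 ^ (n * n)" "\<And>n V. V \<in> F n \<Longrightarrow> V \<in> sets \<mu>"
    and dec: "\<And>n V u c0. V \<in> F n \<Longrightarrow> 4 ^ j \<le> \<bar>u $ c0\<bar> \<Longrightarrow>
      (\<integral>\<^sup>+f. ennreal (norm (ft \<mu> V u (apply_bcontfun (f + g)))) \<partial>\<nu>) \<le> ennreal (K * exp (- a * sqrt \<bar>u $ c0\<bar>))"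
  shows "AE f in \<nu>. total_high T j \<mu> F (apply_bcontfun (f + g)) < \<infinity>"
proof -
  interpret \<nu>: prob_space \<nu> by fact
  define a' where "a' = a / (2 * real CARD('n) * sqrt (real T))"
  have a': "0 < a'" unfolding a'_def using K T by simp
  obtain S where S: "0 \<le> S" "\<And>N. (\<Sum>k\<in>(int_box N :: ('n \<Rightarrow> int) set). \<Prod>i\<in>UNIV. exp (- a' * sqrt \<bar>real_of_int (k i)\<bar>)) \<le> S"
    by (rule lattice_sum_bound[OF a', where 'n = 'n]) (rule that, assumption+)
  have shift: "(\<lambda>f. f + g) \<in> borel_measurable borel"
    by (intro borel_measurable_continuous_onI continuous_intros)
  have to\<nu>: "\<phi> \<in> borel_measurable borel \<Longrightarrow> (\<lambda>f. \<phi> (f + g)) \<in> borel_measurable \<nu>" for \<phi> :: "_ \<Rightarrow> ennreal"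
    using measurable_compose[OF shift] measurable_cong_sets[OF \<nu>(2) refl] by blast
  define e where "e = (\<lambda>n. exp (- (a / 2) * (real n + 1) ^ 4))"
  have high: "(\<integral>\<^sup>+f. high_sum T j n \<mu> V (apply_bcontfun (f + g)) \<partial>\<nu>) \<le> ennreal (K * e n * S)" if V: "V \<in> F n" for n V
  proof -
    let ?X = "\<lambda>f k. ennreal (norm (ft \<mu> V (freq T k) (apply_bcontfun (f + g)))) * indicator (high_freqs T j n) k"
    have meas: "(\<lambda>f. ennreal (norm (ft \<mu> V u (apply_bcontfun (f + g))))) \<in> borel_measurable \<nu>" for u
      by (rule to\<nu>[OF ft_measurable[OF mu F(3)[OF V]]])
    have mono: "int_box M \<subseteq> (int_box N :: ('n \<Rightarrow> int) set)" if "M \<le> N" for M N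
      using that unfolding int_box_def by (auto intro: order_trans)
    have "(\<integral>\<^sup>+f. high_sum T j n \<mu> V (apply_bcontfun (f + g)) \<partial>\<nu>) = (\<integral>\<^sup>+f. (SUP N. \<Sum>k\<in>int_box N. ?X f k) \<partial>\<nu>)"
      unfolding high_sum_def nn_integral_int_box ..
    also have "\<dots> = (SUP N. \<integral>\<^sup>+f. (\<Sum>k\<in>int_box N. ?X f k) \<partial>\<nu>)"
    proof (rule nn_integral_monotone_convergence_SUP)
      show "incseq (\<lambda>N f. \<Sum>k\<in>int_box N. ?X f k)"
        unfolding incseq_def le_fun_def by (intro allI impI sum_mono2 mono) auto
      show "(\<lambda>f. \<Sum>k\<in>int_box N. ?X f k) \<in> borel_measurable \<nu>" for N
        by (intro borel_measurable_sum borel_measurable_times_ennreal meas borel_measurable_const)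
    qed
    also have "\<dots> \<le> ennreal (K * e n * S)"
    proof (rule SUP_least)
      fix N
      have "(\<integral>\<^sup>+f. (\<Sum>k\<in>int_box N. ?X f k) \<partial>\<nu>) = (\<Sum>k\<in>int_box N. \<integral>\<^sup>+f. ?X f k \<partial>\<nu>)"
        by (intro nn_integral_sum borel_measurable_times_ennreal meas borel_measurable_const)
      also have "\<dots> \<le> (\<Sum>k\<in>(int_box N :: ('n \<Rightarrow> int) set). ennreal (K * e n * (\<Prod>i\<in>UNIV. exp (- a' * sqrt \<bar>real_of_int (k i)\<bar>))))"
      proof (rule sum_mono)
        fix k :: "'n \<Rightarrow> int"
        show "(\<integral>\<^sup>+f. ?X f k \<partial>\<nu>) \<le> ennreal (K * e n * (\<Prod>i\<in>UNIV. exp (- a' * sqrt \<bar>real_of_int (k i)\<bar>)))"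
        proof (cases "k \<in> high_freqs T j n")
          case True
          obtain i where i: "4 ^ j \<le> \<bar>freq T k $ i\<bar>"
            "exp (- a * sqrt \<bar>freq T k $ i\<bar>) \<le> e n * (\<Prod>i\<in>UNIV. exp (- a' * sqrt \<bar>real_of_int (k i)\<bar>))"
            unfolding e_def a'_def by (rule frequency_decay[OF T True K(2)])
          have "(\<integral>\<^sup>+f. ?X f k \<partial>\<nu>) \<le> ennreal (K * exp (- a * sqrt \<bar>freq T k $ i\<bar>))"
            using dec[OF V i(1)] True by simp
          also have "\<dots> \<le> ennreal (K * (e n * (\<Prod>i\<in>UNIV. exp (- a' * sqrt \<bar>real_of_int (k i)\<bar>))))"
            using i(2) K by (intro ennreal_leI mult_left_mono) auto
          finally show ?thesis by (simp add: mult.assoc)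
        qed simp
      qed
      also have "\<dots> = ennreal (\<Sum>k\<in>(int_box N :: ('n \<Rightarrow> int) set). K * e n * (\<Prod>i\<in>UNIV. exp (- a' * sqrt \<bar>real_of_int (k i)\<bar>)))"
        using K by (intro sum_ennreal) (auto simp: e_def intro!: prod_nonneg mult_nonneg_nonneg)
      also have "\<dots> \<le> ennreal (K * e n * S)"
        using S(2)[of N] K unfolding sum_distrib_left[symmetric] by (intro ennreal_leI mult_left_mono) (auto simp: e_def)
      finally show "(\<integral>\<^sup>+f. (\<Sum>k\<in>int_box N. ?X f k) \<partial>\<nu>) \<le> ennreal (K * e n * S)" .
    qed
    finally show ?thesis .
  qed
  have mh: "(\<lambda>f. high_sum T j n \<mu> V (apply_bcontfun (f + g))) \<in> borel_measurable \<nu>" if "V \<in> F n" for n V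
    by (rule to\<nu>[OF high_sum_measurable[OF mu F(3)[OF that]]])
  define B where "B = real b * K * S"
  have B: "0 \<le> B" unfolding B_def using K S by simp
  have "(\<integral>\<^sup>+f. total_high T j \<mu> F (apply_bcontfun (f + g)) \<partial>\<nu>)
      = (\<Sum>n. \<integral>\<^sup>+f. ennreal (2 ^ (n * n)) * (\<Sum>V\<in>F n. high_sum T j n \<mu> V (apply_bcontfun (f + g))) \<partial>\<nu>)"
    unfolding total_high_def by (intro nn_integral_suminf borel_measurable_times_ennreal borel_measurable_const borel_measurable_sum mh)
  also have "\<dots> \<le> (\<Sum>n. ennreal (B * (2 ^ (n * n) * 2 ^ (n * n) * e n)))"
  proof (rule suminf_le)
    fix n
    have "(\<integral>\<^sup>+f. ennreal (2 ^ (n * n)) * (\<Sum>V\<in>F n. high_sum T j n \<mu> V (apply_bcontfun (f + g))) \<partial>\<nu>)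
       = ennreal (2 ^ (n * n)) * (\<Sum>V\<in>F n. \<integral>\<^sup>+f. high_sum T j n \<mu> V (apply_bcontfun (f + g)) \<partial>\<nu>)"
      by (subst nn_integral_cmult, intro borel_measurable_sum mh, assumption)
        (subst nn_integral_sum, erule mh, rule refl)
    also have "\<dots> \<le> ennreal (2 ^ (n * n)) * (\<Sum>V\<in>F n. ennreal (K * e n * S))"
      by (intro mult_left_mono sum_mono high) auto
    also have "\<dots> = ennreal (2 ^ (n * n) * (real (card (F n)) * (K * e n * S)))"
      using K S by (simp add: ennreal_mult ennreal_of_nat_eq_real_of_nat e_def)
    also have "\<dots> \<le> ennreal (2 ^ (n * n) * (real (b * 2 ^ (n * n)) * (K * e n * S)))"
      using F(2)[of n] K S by (intro ennreal_leI mult_left_mono mult_right_mono) (auto simp: e_def of_nat_le_iff simp del: of_nat_mult of_nat_power)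
    also have "\<dots> = ennreal (B * (2 ^ (n * n) * 2 ^ (n * n) * e n))"
      unfolding B_def by (simp add: mult_ac)
    finally show "(\<integral>\<^sup>+f. ennreal (2 ^ (n * n)) * (\<Sum>V\<in>F n. high_sum T j n \<mu> V (apply_bcontfun (f + g))) \<partial>\<nu>)
       \<le> ennreal (B * (2 ^ (n * n) * 2 ^ (n * n) * e n))" .
  qed auto
  also have "\<dots> = ennreal (\<Sum>n. B * (2 ^ (n * n) * 2 ^ (n * n) * e n))"
    using B K unfolding e_def by (intro suminf_ennreal2 summable_mult summable_superexponential) auto
  also have "\<dots> < \<infinity>" by simp
  finally have "(\<integral>\<^sup>+f. total_high T j \<mu> F (apply_bcontfun (f + g)) \<partial>\<nu>) \<noteq> \<infinity>" by simp
  then have "AE f in \<nu>. total_high T j \<mu> F (apply_bcontfun (f + g)) \<noteq> \<infinity>"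
    by (intro nn_integral_PInf_AE to\<nu>[OF total_high_measurable[OF mu F(3)]])
  then show ?thesis by (simp add: less_top)
qed

lemma ftsum_bound:
  fixes \<mu> :: "'a::metric_space measure" and h :: "'a \<Rightarrow> real ^ 'n"
  assumes mu: "finite_measure \<mu>" and h: "h \<in> borel_measurable \<mu>"
    and F: "finite (F n)" "V \<in> F n" "V \<in> sets \<mu>" and T: "0 < T" and fin: "total_high T j \<mu> F h < \<infinity>"
  shows "ftsum T \<mu> V h \<le> ennreal (measure \<mu> V * (3 * real T * 4 ^ j * (real n + 1) ^ 8) ^ CARD('n) + enn2real (total_high T j \<mu> F h) / 2 ^ (n * n))"
proof -
  \<comment> \<open>The threshold of \<open>high_freqs\<close> as a natural number: every lattice
    point that is not high lies in the box of this size. Since \<open>R\<close> is at least 1,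
    \<open>2 * R + 1 \<le> 3 * R\<close>, which explains the factor 3 in the bound.\<close>
  define R where "R = T * 4 ^ j * (n + 1) ^ 8"
  have R: "1 \<le> R" unfolding R_def using T by (simp add: Suc_le_eq)
  have Rr: "real R = real T * 4 ^ j * (real n + 1) ^ 8" unfolding R_def by (simp add: add.commute)
  define P where "P = enn2real (total_high T j \<mu> F h)"
  have P: "total_high T j \<mu> F h = ennreal P" unfolding P_def using fin by (simp add: less_top)
  have "ennreal (2 ^ (n * n)) * high_sum T j n \<mu> V h \<le> ennreal (2 ^ (n * n)) * (\<Sum>V\<in>F n. high_sum T j n \<mu> V h)"
    using F by (intro mult_left_mono member_le_sum) auto
  also have "\<dots> = (\<Sum>n\<in>{n}. ennreal (2 ^ (n * n)) * (\<Sum>V\<in>F n. high_sum T j n \<mu> V h))" by simp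
  also have "\<dots> \<le> total_high T j \<mu> F h" unfolding total_high_def by (rule sum_le_suminf) auto
  also have "\<dots> = ennreal P" by (rule P)
  finally have hs: "ennreal (2 ^ (n * n)) * high_sum T j n \<mu> V h \<le> ennreal P" .
  have "high_sum T j n \<mu> V h = ennreal (1 / 2 ^ (n * n)) * (ennreal (2 ^ (n * n)) * high_sum T j n \<mu> V h)"
    by (simp add: mult.assoc[symmetric] ennreal_mult[symmetric])
  also have "\<dots> \<le> ennreal (1 / 2 ^ (n * n)) * ennreal P" by (intro mult_left_mono hs) auto
  also have "\<dots> = ennreal (P / 2 ^ (n * n))" by (simp add: ennreal_mult[symmetric] P_def)
  finally have hs: "high_sum T j n \<mu> V h \<le> ennreal (P / 2 ^ (n * n))" .
  have low: "k \<in> int_box R" if "k \<notin> high_freqs T j n" for k :: "'n \<Rightarrow> int"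
  proof -
    have "\<bar>real_of_int (k i)\<bar> < real R" for i using that unfolding high_freqs_def Rr by (auto simp: not_le)
    then have "\<bar>k i\<bar> \<le> int R" for i by (metis less_imp_le of_int_abs of_int_le_iff of_int_of_nat_eq)
    then show ?thesis unfolding int_box_def by auto
  qed
  have "ftsum T \<mu> V h \<le> (\<integral>\<^sup>+k. ennreal (measure \<mu> V) * indicator (int_box R) k + ennreal (norm (ft \<mu> V (freq T k) h)) * indicator (high_freqs T j n) k \<partial>count_space UNIV)"
    unfolding ftsum_def
  proof (rule nn_integral_mono)
    fix k :: "'n \<Rightarrow> int"
    show "ennreal (norm (ft \<mu> V (freq T k) h)) \<le> ennreal (measure \<mu> V) * indicator (int_box R) k + ennreal (norm (ft \<mu> V (freq T k) h)) * indicator (high_freqs T j n) k"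
      using low[of k] norm_ft_le[OF mu h F(3), of "freq T k"] by (cases "k \<in> high_freqs T j n") (auto intro: ennreal_leI)
  qed
  also have "\<dots> = (\<integral>\<^sup>+k. ennreal (measure \<mu> V) * indicator (int_box R) k \<partial>count_space (UNIV :: ('n \<Rightarrow> int) set)) + high_sum T j n \<mu> V h"
    unfolding high_sum_def by (rule nn_integral_add) auto
  also have "(\<integral>\<^sup>+k. ennreal (measure \<mu> V) * indicator (int_box R) k \<partial>count_space (UNIV :: ('n \<Rightarrow> int) set)) = ennreal (measure \<mu> V * real (card (int_box R :: ('n \<Rightarrow> int) set)))"
    by (simp add: nn_integral_cmult_indicator emeasure_count_space ennreal_mult ennreal_of_nat_eq_real_of_nat)
  also have "\<dots> + high_sum T j n \<mu> V h \<le> ennreal (measure \<mu> V * (3 * real R) ^ CARD('n)) + ennreal (P / 2 ^ (n * n))"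
  proof (intro add_mono hs ennreal_leI mult_left_mono)
    have "real (2 * R + 1) \<le> 3 * real R" using R by simp
    then show "real (card (int_box R :: ('n \<Rightarrow> int) set)) \<le> (3 * real R) ^ CARD('n)"
      unfolding card_int_box of_nat_power by (intro power_mono) auto
  qed auto
  also have "\<dots> = ennreal (measure \<mu> V * (3 * real R) ^ CARD('n) + P / 2 ^ (n * n))"
    by (simp add: P_def)
  finally show ?thesis unfolding Rr P_def by (simp add: mult.assoc)
qed

section \<open>Dimension of the fibers\<close>

text \<open>A substitute for the mass distribution principle on \<open>D \<inter> X\<close>, with gauge \<open>r powr t\<close>, for covers by balls
  around points at which \<open>\<mu>\<close> has local exponent \<open>s\<close>.\<close>

definition costly_covers :: "'a::metric_space measure \<Rightarrow> 'a set \<Rightarrow> 'a set \<Rightarrow> real \<Rightarrow> real \<Rightarrow> real \<Rightarrow> bool" where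
  "costly_covers \<mu> D X t s \<kappa> \<longleftrightarrow> (\<forall>I. (\<forall>p\<in>I. snd p \<in> D \<and> light \<mu> s (fst p) (snd p)) \<longrightarrow>
     D \<inter> X \<subseteq> (\<Union>p\<in>I. cball (snd p) (1 / 2 ^ fst p)) \<longrightarrow>
     (\<exists>J\<subseteq>I. finite J \<and> \<kappa> \<le> (\<Sum>p\<in>J. 2 powr (- (real (fst p) * t)))))"

lemma costly_coversD:
  assumes "costly_covers \<mu> D X t s \<kappa>" "\<forall>p\<in>I. snd p \<in> D \<and> light \<mu> s (fst p) (snd p)"
    "D \<inter> X \<subseteq> (\<Union>p\<in>I. cball (snd p) (1 / 2 ^ fst p))"
  obtains J where "J \<subseteq> I" "finite J" "\<kappa> \<le> (\<Sum>p\<in>J. 2 powr (- (real (fst p) * t)))"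
  using mp[OF mp[OF spec[OF assms(1)[unfolded costly_covers_def]] assms(2)] assms(3)] by blast

text \<open>The power of \<open>n + 1\<close> is absorbed by the gain
  \<open>2 powr (- (real n * (s - t)))\<close>, and \<open>1 / 2 ^ (n * n)\<close> decays faster
  than any exponential.\<close>

lemma cost_bound:
  fixes A P t s :: real
  assumes "t < s"
  obtains C where "0 < C" "\<And>n. 2 powr (- (real n * s)) * (A * (real n + 1) ^ 8) ^ d + P / 2 ^ (n * n) \<le> C * 2 powr (- (real n * t))"
proof -
  define e where "e = s - t"
  have e: "0 < e" using assms unfolding e_def by simp
  have "(\<lambda>n. A ^ d * ((real n + 1) ^ (8 * d) * exp (- (ln 2 * e) * real n)) + P * exp (- ln 2 * (real n * real n) + ln 2 * t * real n)) \<longlonglongrightarrow> A ^ d * 0 + P * 0"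
  proof (intro tendsto_intros)
    have "(\<lambda>n. (real n + 1) ^ k * exp (- b * real n)) \<longlonglongrightarrow> 0" if "0 < b" for b :: real and k :: nat
      using that by real_asymp
    from this[of "ln 2 * e" "8 * d"] show "(\<lambda>n. (real n + 1) ^ (8 * d) * exp (- (ln 2 * e) * real n)) \<longlonglongrightarrow> 0"
      using e by simp
    show "(\<lambda>n. exp (- ln 2 * (real n * real n) + ln 2 * t * real n)) \<longlonglongrightarrow> 0" by real_asymp
  qed
  then have "Bseq (\<lambda>n. A ^ d * ((real n + 1) ^ (8 * d) * exp (- (ln 2 * e) * real n)) + P * exp (- ln 2 * (real n * real n) + ln 2 * t * real n))"
    by (intro convergent_imp_Bseq convergentI)
  then obtain C where C: "0 < C" "\<And>n. norm (A ^ d * ((real n + 1) ^ (8 * d) * exp (- (ln 2 * e) * real n)) + P * exp (- ln 2 * (real n * real n) + ln 2 * t * real n)) \<le> C"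
    unfolding Bseq_def by auto
  show thesis
  proof (rule that[OF C(1)])
    fix n
    have p: "(2 :: real) powr x = exp (ln 2 * x)" for x by (simp add: powr_def mult.commute)
    have sq: "(2 :: real) ^ (n * n) = exp (ln 2 * (real n * real n))"
      by (subst powr_realpow[symmetric]) (simp_all add: p)
    let ?x = "A ^ d * ((real n + 1) ^ (8 * d) * exp (- (ln 2 * e) * real n)) + P * exp (- ln 2 * (real n * real n) + ln 2 * t * real n)"
    have "2 powr (- (real n * s)) * (A * (real n + 1) ^ 8) ^ d + P / 2 ^ (n * n) = ?x * 2 powr (- (real n * t))"
    proof -
      have 1: "exp (- (ln 2 * e) * real n) * 2 powr (- (real n * t)) = 2 powr (- (real n * s))"
        unfolding p exp_add[symmetric] e_def by (simp add: algebra_simps)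
      have 2: "exp (- ln 2 * (real n * real n) + ln 2 * t * real n) * 2 powr (- (real n * t)) = 1 / 2 ^ (n * n)"
        unfolding p sq exp_add[symmetric] by (simp add: exp_minus inverse_eq_divide[symmetric] algebra_simps)
      have "?x * 2 powr (- (real n * t)) = A ^ d * (real n + 1) ^ (8 * d) * (exp (- (ln 2 * e) * real n) * 2 powr (- (real n * t)))
          + P * (exp (- ln 2 * (real n * real n) + ln 2 * t * real n) * 2 powr (- (real n * t)))" by (simp only: distrib_right mult.assoc)
      moreover have "(A * (real n + 1) ^ 8) ^ d = A ^ d * (real n + 1) ^ (8 * d)"
        by (simp only: power_mult_distrib power_mult)
      ultimately show ?thesis unfolding 1 2 by (simp add: mult_ac)
    qed
    also have "\<dots> \<le> C * 2 powr (- (real n * t))"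
      using C(2)[of n] by (intro mult_right_mono) auto
    finally show "2 powr (- (real n * s)) * (A * (real n + 1) ^ 8) ^ d + P / 2 ^ (n * n) \<le> C * 2 powr (- (real n * t))" .
  qed
qed

text \<open>A covering ball may have any centre, while the transforms are controlled only for balls
  about net points. Passing to a net ball of radius \<open>3 / 2 ^ n\<close> keeps the fiber
  covered, and lightness at the original centre still bounds its mass.\<close>

lemma costly_coversI:
  fixes \<mu> :: "'a::metric_space measure" and h :: "'a \<Rightarrow>\<^sub>C (real ^ 'n)"
  assumes mu: "finite_measure \<mu>" "sets \<mu> = sets borel" and D: "closed D" and T: "0 < T"
    and C: "\<And>n. finite (C n)" "\<And>n. UNIV \<subseteq> (\<Union>c\<in>C n. cball c (1 / 2 ^ n))"
    and F: "\<And>n. finite (F n)" "\<And>n c. c \<in> C n \<Longrightarrow> D \<inter> ball c (3 / 2 ^ n) \<in> F n"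
    and fin: "total_high T j \<mu> F h < \<infinity>" and ts: "t < s" and c: "0 < c"
    and mass: "\<forall>\<W>. (\<forall>W\<in>\<W>. open W) \<longrightarrow> D \<inter> X \<subseteq> \<Union>\<W> \<longrightarrow>
       (\<exists>\<F>\<subseteq>\<W>. finite \<F> \<and> ennreal c \<le> (\<Sum>W\<in>\<F>. ftsum T \<mu> (D \<inter> W) h))"
  shows "\<exists>\<kappa>>0. costly_covers \<mu> D X t s \<kappa>"
proof -
  interpret finite_measure \<mu> by fact
  have hm: "apply_bcontfun h \<in> borel_measurable \<mu>" by (rule bcontfun_borel[OF mu(2)])
  define P where "P = enn2real (total_high T j \<mu> F h)"
  obtain B where B: "0 < B" "\<And>n. 2 powr (- (real n * s)) * ((3 * real T * 4 ^ j) * (real n + 1) ^ 8) ^ CARD('n) + P / 2 ^ (n * n) \<le> B * 2 powr (- (real n * t))"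
    using cost_bound[OF ts, of "3 * real T * 4 ^ j" "CARD('n)" P] by metis
  have "\<forall>p. \<exists>z\<in>C (fst p). dist z (snd p) \<le> 1 / 2 ^ fst p" using C(2) by (fastforce simp: subset_iff)
  then obtain z where z: "\<And>p. z p \<in> C (fst p)" "\<And>p. dist (z p) (snd p) \<le> 1 / 2 ^ fst p" by metis
  define W where "W = (\<lambda>p. ball (z p) (3 / 2 ^ fst p))"
  have sub1: "cball (snd p) (1 / 2 ^ fst p) \<subseteq> W p" for p
  proof
    fix x assume "x \<in> cball (snd p) (1 / 2 ^ fst p)"
    then have "dist (z p) x \<le> 1 / 2 ^ fst p + 1 / 2 ^ fst p"
      using dist_triangle[of "z p" x "snd p"] z(2)[of p] by (simp add: dist_commute)
    also have "\<dots> < 3 / 2 ^ fst p" by (simp add: field_simps)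
    finally show "x \<in> W p" unfolding W_def by simp
  qed
  have sub2: "W p \<subseteq> ball (snd p) (4 / 2 ^ fst p)" for p
  proof
    fix x assume "x \<in> W p"
    then have "dist (snd p) x < 1 / 2 ^ fst p + 3 / 2 ^ fst p"
      using dist_triangle[of "snd p" x "z p"] z(2)[of p] unfolding W_def by (simp add: dist_commute)
    then show "x \<in> ball (snd p) (4 / 2 ^ fst p)" by simp
  qed
  have cost: "ftsum T \<mu> (D \<inter> W p) h \<le> ennreal (B * 2 powr (- (real (fst p) * t)))" if "light \<mu> s (fst p) (snd p)" for p
  proof -
    let ?n = "fst p"
    have V: "D \<inter> W p \<in> F ?n" unfolding W_def by (rule F(2)[OF z(1)])
    have Vs: "D \<inter> W p \<in> sets \<mu>" unfolding mu(2) W_def using D by auto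
    have "measure \<mu> (D \<inter> W p) \<le> measure \<mu> (ball (snd p) (4 / 2 ^ ?n))"
      using sub2[of p] by (intro finite_measure_mono) (auto simp: mu(2))
    also have "\<dots> \<le> 2 powr (- (real ?n * s))" by (rule that)
    finally have m: "measure \<mu> (D \<inter> W p) \<le> 2 powr (- (real ?n * s))" .
    have "ftsum T \<mu> (D \<inter> W p) h \<le> ennreal (measure \<mu> (D \<inter> W p) * (3 * real T * 4 ^ j * (real ?n + 1) ^ 8) ^ CARD('n) + P / 2 ^ (?n * ?n))"
      unfolding P_def by (rule ftsum_bound[where F = F, OF mu(1) hm F(1) V Vs T fin])
    also have "\<dots> \<le> ennreal (2 powr (- (real ?n * s)) * (3 * real T * 4 ^ j * (real ?n + 1) ^ 8) ^ CARD('n) + P / 2 ^ (?n * ?n))"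
      using m by (intro ennreal_leI add_right_mono mult_right_mono) auto
    also have "\<dots> \<le> ennreal (B * 2 powr (- (real ?n * t)))"
      by (rule ennreal_leI[OF B(2)])
    finally show ?thesis .
  qed
  have "costly_covers \<mu> D X t s (c / B)"
    unfolding costly_covers_def
  proof (intro allI impI)
    fix I assume I: "\<forall>p\<in>I. snd p \<in> D \<and> light \<mu> s (fst p) (snd p)" "D \<inter> X \<subseteq> (\<Union>p\<in>I. cball (snd p) (1 / 2 ^ fst p))"
    have DW: "D \<inter> X \<subseteq> \<Union>(W ` I)" using I(2) sub1 by blast
    have Wo: "\<forall>V\<in>W ` I. open V" unfolding W_def by auto
    have "\<exists>\<F>\<subseteq>W ` I. finite \<F> \<and> ennreal c \<le> (\<Sum>V\<in>\<F>. ftsum T \<mu> (D \<inter> V) h)"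
      by (rule mp[OF mp[OF spec[OF mass] Wo] DW])
    then obtain \<F> where \<F>: "\<F> \<subseteq> W ` I" "finite \<F>" "ennreal c \<le> (\<Sum>V\<in>\<F>. ftsum T \<mu> (D \<inter> V) h)"
      by blast
    obtain J where J: "J \<subseteq> I" "finite J" "\<F> = W ` J" using finite_subset_image[OF \<F>(2,1)] by blast
    note \<F>(3)
    also have "(\<Sum>V\<in>\<F>. ftsum T \<mu> (D \<inter> V) h) \<le> (\<Sum>p\<in>J. ftsum T \<mu> (D \<inter> W p) h)"
      unfolding J(3) using sum_image_le[OF J(2), of "\<lambda>V. ftsum T \<mu> (D \<inter> V) h" W] by (simp add: comp_def)
    also have "\<dots> \<le> (\<Sum>p\<in>J. ennreal (B * 2 powr (- (real (fst p) * t))))"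
      using I(1) J(1) by (intro sum_mono cost) auto
    also have "\<dots> = ennreal (B * (\<Sum>p\<in>J. 2 powr (- (real (fst p) * t))))"
      using B(1) by (subst sum_ennreal) (auto simp: sum_distrib_left)
    finally have "c \<le> B * (\<Sum>p\<in>J. 2 powr (- (real (fst p) * t)))"
      using c B(1) by (subst (asm) ennreal_le_iff) (auto intro!: mult_nonneg_nonneg sum_nonneg)
    then show "\<exists>J\<subseteq>I. finite J \<and> c / B \<le> (\<Sum>p\<in>J. 2 powr (- (real (fst p) * t)))"
      using J B(1) by (intro exI[of _ J]) (auto simp: pos_divide_le_eq mult.commute)
  qed
  then show ?thesis using c B(1) by (intro exI[of _ "c / B"]) auto
qed

text \<open>Rounding a diameter up to a power of 1/2 costs at most the factor
  \<open>2 powr t\<close>. A set of diameter 0 has no scale of its own; if \<open>t\<close> is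
  positive, a sufficiently fine level makes its cost fall below the slack
  \<open>\<theta>\<close>.\<close>

lemma dyadic_scale:
  fixes U :: "'a::metric_space set"
  assumes U: "bounded U" "U \<noteq> {}" "diameter U \<le> 1 / 2 ^ m" and t: "0 \<le> t" and \<theta>: "0 < \<theta>"
  obtains n where "m \<le> n" "diameter U \<le> 1 / 2 ^ n"
    "ennreal (2 powr (- (real n * t))) \<le> ennreal (2 powr t) * diam_pow t U + ennreal \<theta>"
proof (cases "t = 0")
  case True
  then show thesis using that[of m] U by (simp add: diam_pow_def ennreal_plus[symmetric] del: ennreal_plus)
next
  case False
  then have t0: "0 < t" using t by simp
  define r where "r = diameter U"
  have r0: "0 \<le> r" unfolding r_def by (rule diameter_ge_0[OF U(1)])
  show thesis
  proof (cases "r = 0")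
    case True
    have "(\<lambda>n. 2 powr (- (real n * t))) \<longlonglongrightarrow> 0" using t0 by real_asymp
    then have "\<forall>\<^sub>F n in sequentially. 2 powr (- (real n * t)) < \<theta> \<and> m \<le> n"
      using \<theta> by (intro eventually_conj order_tendstoD(2) eventually_ge_at_top) auto
    then obtain n where n: "2 powr (- (real n * t)) < \<theta>" "m \<le> n"
      using eventually_happens'[OF sequentially_bot] by blast
    then show thesis using that[of n] True unfolding r_def
      by (metis add_increasing divide_nonneg_nonneg ennreal_leI less_imp_le zero_le zero_le_numeral zero_le_one zero_le_power)
  next
    case False
    then have r: "0 < r" using r0 by simp
    have "\<exists>k. 1 / 2 ^ k < r"
      using real_arch_pow_inv[OF r, of "1/2"] by (auto simp: power_divide)
    then obtain k where k: "1 / 2 ^ k < r" "\<And>i. i < k \<Longrightarrow> r \<le> 1 / 2 ^ i"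
      using exists_least_iff[of "\<lambda>k. 1 / 2 ^ k < r"] by (auto simp: not_less)
    have mk: "m < k"
    proof (rule ccontr)
      assume "\<not> m < k"
      then have "(1 :: real) / 2 ^ m \<le> 1 / 2 ^ k" by (intro divide_left_mono power_increasing) auto
      then show False using k(1) U(3) unfolding r_def by linarith
    qed
    then obtain n where n: "k = Suc n" by (cases k) auto
    have "2 powr (- (real n * t)) = 2 powr t * (1 / 2 ^ k) powr t"
    proof -
      have "(1 / 2 ^ k :: real) = 2 powr (- real (Suc n))"
        unfolding n by (simp only: powr_minus powr_realpow zero_less_numeral inverse_eq_divide)
      then have "2 powr t * (1 / 2 ^ k) powr t = 2 powr (t + - real (Suc n) * t)"
        by (simp only: powr_powr powr_add)
      also have "t + - real (Suc n) * t = - (real n * t)" by (simp add: algebra_simps)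
      finally show ?thesis ..
    qed
    also have "\<dots> \<le> 2 powr t * r powr t" using k(1) t by (intro mult_left_mono powr_mono2) auto
    finally have "ennreal (2 powr (- (real n * t))) \<le> ennreal (2 powr t * r powr t)" by (rule ennreal_leI)
    also have "\<dots> = ennreal (2 powr t) * diam_pow t U"
      using U(2) \<open>t \<noteq> 0\<close> unfolding diam_pow_def r_def by (simp add: ennreal_mult)
    also have "\<dots> \<le> \<dots> + ennreal \<theta>" by simp
    finally show thesis using that[of n] mk n k(2)[of n] unfolding r_def by auto
  qed
qed

text \<open>A cheap cover of \<open>X\<close> would turn into a cheap cover of
  \<open>D \<inter> X\<close> by balls centred at light points of \<open>D\<close>, against
  \<open>costly_covers\<close>. All sets are fine enough that the level \<open>m\<close> of uniform
  lightness has been reached.\<close>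

lemma hausdorff_dim_geI:
  fixes \<mu> :: "'a::metric_space measure"
  assumes X: "X \<noteq> {}"
    and costly: "\<And>t s. 0 \<le> t \<Longrightarrow> t < s \<Longrightarrow> ereal s < a \<Longrightarrow> \<exists>\<kappa>>0. costly_covers \<mu> D X t s \<kappa>"
    and light: "\<forall>s. 0 \<le> s \<and> ereal s < a \<longrightarrow> (\<exists>m. \<forall>x\<in>D. \<forall>n\<ge>m. light \<mu> s n x)"
  shows "a \<le> hausdorff_dim X"
proof (rule ccontr)
  assume "\<not> ?thesis"
  then have "hausdorff_dim X < a" by simp
  then obtain t where t: "0 \<le> t" "ereal t < a" and
    cov: "\<And>\<delta> \<eta>. 0 < \<delta> \<Longrightarrow> 0 < \<eta> \<Longrightarrow> \<exists>U :: nat \<Rightarrow> 'a set. X \<subseteq> (\<Union>i. U i) \<and> (\<forall>i. bounded (U i) \<and> diameter (U i) \<le> \<delta>) \<and> (\<Sum>i. diam_pow t (U i)) < \<eta>"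
    by (rule hausdorff_dim_lessD[OF _ X]) (rule that, assumption+)
  obtain s where s: "ereal t < ereal s" "ereal s < a" using ereal_dense2[OF t(2)] by auto
  then have ts: "t < s" by simp
  obtain \<kappa> where \<kappa>: "0 < \<kappa>" "costly_covers \<mu> D X t s \<kappa>" using costly[OF t(1) ts s(2)] by auto
  obtain m where m: "\<forall>x\<in>D. \<forall>n\<ge>m. light \<mu> s n x" using light s(2) t(1) ts by fastforce
  \<comment> \<open>After the loss of \<open>2 powr t\<close> by rounding, the cover contributes at
    most \<open>\<kappa> / 4\<close>; the slacks of all sets add another
    \<open>\<kappa> / 4\<close>.\<close>
  define \<eta> where "\<eta> = \<kappa> / (4 * 2 powr t)"
  have \<eta>: "0 < \<eta>" unfolding \<eta>_def using \<kappa> by simp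
  obtain U :: "nat \<Rightarrow> 'a set" where U: "X \<subseteq> (\<Union>i. U i)" "\<And>i. bounded (U i) \<and> diameter (U i) \<le> 1 / 2 ^ m" "(\<Sum>i. diam_pow t (U i)) < ennreal \<eta>"
    using cov[of "1 / 2 ^ m" "ennreal \<eta>"] \<eta> by auto
  \<comment> \<open>Only the sets that meet \<open>D\<close> are kept, since each is to be replaced
    by a ball about a point of \<open>D\<close>.\<close>
  define S where "S = {i. U i \<inter> D \<noteq> {}}"
  define good where "good = (\<lambda>i (p :: nat \<times> 'a). snd p \<in> U i \<inter> D \<and> m \<le> fst p \<and> diameter (U i) \<le> 1 / 2 ^ fst p \<and>
    ennreal (2 powr (- (real (fst p) * t))) \<le> ennreal (2 powr t) * diam_pow t (U i) + ennreal (\<kappa> / 4 * (1/2) ^ Suc i))"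
  have "\<exists>p. good i p" if iS: "i \<in> S" for i
  proof -
    obtain x where x: "x \<in> U i \<inter> D" using iS unfolding S_def by auto
    have ne: "U i \<noteq> {}" using x by auto
    have th: "0 < \<kappa> / 4 * (1/2) ^ Suc i" using \<kappa> by simp
    obtain n where "m \<le> n" "diameter (U i) \<le> 1 / 2 ^ n"
      "ennreal (2 powr (- (real n * t))) \<le> ennreal (2 powr t) * diam_pow t (U i) + ennreal (\<kappa> / 4 * (1/2) ^ Suc i)"
      by (rule dyadic_scale[OF conjunct1[OF U(2)] ne conjunct2[OF U(2)] t(1) th])
    then have "good i (n, x)" using x unfolding good_def by simp
    then show ?thesis by (rule exI)
  qed
  then have "\<forall>i. \<exists>p. i \<in> S \<longrightarrow> good i p" by blast
  from choice[OF this] obtain p where p: "\<forall>i. i \<in> S \<longrightarrow> good i (p i)" ..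
  have "\<forall>q\<in>p ` S. snd q \<in> D \<and> light \<mu> s (fst q) (snd q)"
    using p m unfolding good_def by auto
  moreover have "D \<inter> X \<subseteq> (\<Union>q\<in>p ` S. cball (snd q) (1 / 2 ^ fst q))"
  proof
    fix x assume x: "x \<in> D \<inter> X"
    then obtain i where i: "x \<in> U i" using U(1) by auto
    then have "i \<in> S" using x unfolding S_def by auto
    then have g: "good i (p i)" using p by simp
    then have "dist (snd (p i)) x \<le> diameter (U i)"
      using i U(2)[of i] by (intro diameter_bounded_bound) (auto simp: good_def)
    then have "x \<in> cball (snd (p i)) (1 / 2 ^ fst (p i))" using g unfolding good_def by auto
    then show "x \<in> (\<Union>q\<in>p ` S. cball (snd q) (1 / 2 ^ fst q))" using \<open>i \<in> S\<close> by blast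
  qed
  ultimately obtain J where J: "J \<subseteq> p ` S" "finite J" "\<kappa> \<le> (\<Sum>q\<in>J. 2 powr (- (real (fst q) * t)))"
    by (rule costly_coversD[OF \<kappa>(2)])
  obtain I where I: "I \<subseteq> S" "finite I" "J = p ` I" using finite_subset_image[OF J(2,1)] by blast
  have "\<kappa> \<le> (\<Sum>i\<in>I. 2 powr (- (real (fst (p i)) * t)))"
    using J(3) sum_image_le[OF I(2), of "\<lambda>q. 2 powr (- (real (fst q) * t))" p] unfolding I(3) by (simp add: comp_def)
  then have "ennreal \<kappa> \<le> ennreal (\<Sum>i\<in>I. 2 powr (- (real (fst (p i)) * t)))" by (rule ennreal_leI)
  also have "\<dots> = (\<Sum>i\<in>I. ennreal (2 powr (- (real (fst (p i)) * t))))" by (rule sum_ennreal[symmetric]) simp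
  also have "\<dots> \<le> (\<Sum>i\<in>I. ennreal (2 powr t) * diam_pow t (U i) + ennreal (\<kappa> / 4 * (1/2) ^ Suc i))"
    using I(1) p unfolding good_def by (intro sum_mono) blast
  also have "\<dots> \<le> (\<Sum>i. ennreal (2 powr t) * diam_pow t (U i) + ennreal (\<kappa> / 4 * (1/2) ^ Suc i))"
    by (rule sum_le_suminf) (auto simp: I(2))
  also have "\<dots> = ennreal (2 powr t) * (\<Sum>i. diam_pow t (U i)) + (\<Sum>i. ennreal (\<kappa> / 4 * (1/2) ^ Suc i))"
    by (subst suminf_add[symmetric]) auto
  also have "(\<Sum>i. ennreal (\<kappa> / 4 * (1/2) ^ Suc i)) = ennreal (\<kappa> / 4)"
  proof -
    have h: "(\<lambda>i. \<kappa> / 4 * (1/2) ^ Suc i) sums (\<kappa> / 4)" using sums_mult[OF power_half_series, of "\<kappa> / 4"] by simp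
    show ?thesis using \<kappa> h by (subst suminf_ennreal2) (auto simp: sums_iff)
  qed
  also have "ennreal (2 powr t) * (\<Sum>i. diam_pow t (U i)) + ennreal (\<kappa> / 4) \<le> ennreal (2 powr t) * ennreal \<eta> + ennreal (\<kappa> / 4)"
    using U(3) by (intro add_right_mono mult_left_mono) auto
  also have "\<dots> = ennreal (\<kappa> / 2)"
    using \<kappa>(1) unfolding \<eta>_def by (simp add: ennreal_mult[symmetric] ennreal_plus[symmetric] del: ennreal_plus)
  finally show False using \<kappa>(1) by (simp add: ennreal_le_iff)
qed

text \<open>The light levels vary from point to point, so no single scale serves for a cover. Each
  point is covered at one of its own light levels, and the count for a piece sums over all levels.
  This is affordable because a piece of upper box dimension below \<open>r\<close> needs at most
  \<open>2 powr (real n * r)\<close> balls of radius \<open>1 / 2 ^ n\<close>, and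
  \<open>r < t\<close>.\<close>

lemma packing_dim_geI:
  fixes \<mu> :: "'a::metric_space measure"
  assumes cpt: "compact (UNIV :: 'a set)" and X: "X \<noteq> {}"
    and costly: "\<And>t s. 0 \<le> t \<Longrightarrow> t < s \<Longrightarrow> ereal s < a \<Longrightarrow> \<exists>\<kappa>>0. costly_covers \<mu> D X t s \<kappa>"
    and light: "\<forall>s. 0 \<le> s \<and> ereal s < a \<longrightarrow> (\<forall>m. \<forall>x\<in>D. \<exists>n\<ge>m. light \<mu> s n x)"
  shows "a \<le> packing_dim X"
proof (rule ccontr)
  assume "\<not> ?thesis"
  then have "packing_dim X < a" by simp
  then obtain Y :: "nat \<Rightarrow> 'a set" where Y: "X = (\<Union>i. Y i)" "(SUP i. upper_box_dim (Y i)) < a"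
    unfolding packing_dim_def Inf_less_iff by auto
  obtain r where r: "(SUP i. upper_box_dim (Y i)) < ereal r" "ereal r < a" using ereal_dense2[OF Y(2)] by auto
  have Yr: "upper_box_dim (Y i) < ereal r" for i
    by (rule order.strict_trans1[OF SUP_upper r(1)]) simp
  have r0: "0 \<le> r"
  proof -
    obtain i where "Y i \<noteq> {}" using X Y(1) by auto
    then have "0 \<le> upper_box_dim (Y i)" by (rule upper_box_dim_nonneg)
    then have "0 < ereal r" using Yr[of i] by (rule order.strict_trans1)
    then show ?thesis by simp
  qed
  obtain s where s: "ereal r < ereal s" "ereal s < a" using ereal_dense2[OF r(2)] by auto
  \<comment> \<open>\<open>r < t\<close> makes the costs of a piece summable over the levels, and
    \<open>t < s\<close> is what \<open>costly_covers\<close> asks for.\<close>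
  define t where "t = (r + s) / 2"
  have rs: "r < s" using s by simp
  have t: "r < t" "t < s" "0 \<le> t" unfolding t_def using rs r0 by auto
  obtain \<kappa> where \<kappa>: "0 < \<kappa>" "costly_covers \<mu> D X t s \<kappa>" using costly[OF t(3,2) s(2)] by auto
  define q where "q = 2 powr (r - t)"
  have q: "0 < q" "q < 1" unfolding q_def using t by (auto simp: powr_less_one)
  define cov where "cov = (\<lambda>i n C. C \<subseteq> Y i \<and> finite C \<and> real (card C) \<le> 2 powr (real n * r) \<and> Y i \<subseteq> (\<Union>c\<in>C. cball c (1 / 2 ^ n)))"
  \<comment> \<open>Piece \<open>i\<close> starts at a level from which the tail of its geometric
    series is below its share of \<open>\<kappa> / 2\<close>. The factor \<open>2 powr r\<close>
    arises because the covers are taken one level finer.\<close>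
  have "\<exists>k. (\<forall>n\<ge>k. \<exists>C. cov i n C) \<and> 2 powr r / (1 - q) * q ^ k < \<kappa> / 2 * (1/2) ^ Suc i" for i
  proof -
    obtain n0 where n0: "\<forall>n\<ge>n0. \<exists>C. cov i n C"
      using upper_box_dim_lessD[OF Yr totally_bounded_of_compact[OF cpt]] unfolding cov_def by blast
    have "(\<lambda>k. 2 powr r / (1 - q) * q ^ k) \<longlonglongrightarrow> 2 powr r / (1 - q) * 0"
      using q by (intro tendsto_mult_left LIMSEQ_power_zero) simp
    then have "\<forall>\<^sub>F k in sequentially. 2 powr r / (1 - q) * q ^ k < \<kappa> / 2 * (1/2) ^ Suc i \<and> n0 \<le> k"
      using \<kappa>(1) by (intro eventually_conj order_tendstoD(2) eventually_ge_at_top) auto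
    then obtain k where "2 powr r / (1 - q) * q ^ k < \<kappa> / 2 * (1/2) ^ Suc i" "n0 \<le> k"
      using eventually_happens'[OF sequentially_bot] by blast
    then show ?thesis using n0 by (intro exI[of _ k]) auto
  qed
  then have "\<forall>i. \<exists>k. (\<forall>n\<ge>k. \<exists>C. cov i n C) \<and> 2 powr r / (1 - q) * q ^ k < \<kappa> / 2 * (1/2) ^ Suc i" by blast
  from choice[OF this] obtain k where k: "\<forall>i. (\<forall>n\<ge>k i. \<exists>C. cov i n C) \<and> 2 powr r / (1 - q) * q ^ k i < \<kappa> / 2 * (1/2) ^ Suc i" ..
  have "\<forall>i n. \<exists>C. k i \<le> n \<longrightarrow> cov i n C" using k by blast
  then have "\<forall>i. \<exists>C. \<forall>n. k i \<le> n \<longrightarrow> cov i n (C n)" by (intro allI choice) blast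
  from choice[OF this] obtain C where C: "\<forall>i n. k i \<le> n \<longrightarrow> cov i n (C i n)" ..
  \<comment> \<open>The centres in \<open>C i (Suc n)\<close> need not be light or lie in
    \<open>D\<close>, so a light point of \<open>D\<close> is selected in each ball. The ball has
    level \<open>Suc n\<close> because recentering doubles the radius to
    \<open>1 / 2 ^ n\<close>.\<close>
  define good where "good = (\<lambda>(i :: nat, n, c) x. x \<in> D \<and> x \<in> cball c (1 / 2 ^ Suc n) \<and> light \<mu> s n x)"
  define S where "S = {(i, n, c). k i \<le> n \<and> c \<in> C i (Suc n) \<and> (\<exists>x. good (i, n, c) x)}"
  have "\<forall>w. \<exists>x. w \<in> S \<longrightarrow> good w x" unfolding S_def by auto
  from choice[OF this] obtain sel where sel: "\<forall>w. w \<in> S \<longrightarrow> good w (sel w)" ..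
  define p where "p = (\<lambda>w :: nat \<times> nat \<times> 'a. (fst (snd w), sel w))"
  have "\<forall>v\<in>p ` S. snd v \<in> D \<and> light \<mu> s (fst v) (snd v)"
    using sel unfolding p_def good_def by fastforce
  moreover have "D \<inter> X \<subseteq> (\<Union>v\<in>p ` S. cball (snd v) (1 / 2 ^ fst v))"
  proof
    fix x assume x: "x \<in> D \<inter> X"
    then obtain i where i: "x \<in> Y i" using Y(1) by auto
    have "0 \<le> s" using rs r0 by simp
    then obtain n where n: "k i \<le> n" "light \<mu> s n x" using light s(2) x by blast
    have "cov i (Suc n) (C i (Suc n))" using C n(1) by simp
    then obtain c where c: "c \<in> C i (Suc n)" "x \<in> cball c (1 / 2 ^ Suc n)" using i unfolding cov_def by blast
    have "good (i, n, c) x" using x n c unfolding good_def by simp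
    then have w: "(i, n, c) \<in> S" using n c unfolding S_def by blast
    then have "good (i, n, c) (sel (i, n, c))" using sel by blast
    then have "dist (sel (i, n, c)) x \<le> 1 / 2 ^ Suc n + 1 / 2 ^ Suc n"
      using dist_triangle[of "sel (i, n, c)" x c] c(2) unfolding good_def by (simp add: dist_commute)
    also have "\<dots> = 1 / 2 ^ n" by simp
    finally have "x \<in> cball (snd (p (i, n, c))) (1 / 2 ^ fst (p (i, n, c)))" unfolding p_def by simp
    then show "x \<in> (\<Union>v\<in>p ` S. cball (snd v) (1 / 2 ^ fst v))" using w by blast
  qed
  ultimately obtain J where J: "J \<subseteq> p ` S" "finite J" "\<kappa> \<le> (\<Sum>v\<in>J. 2 powr (- (real (fst v) * t)))"
    by (rule costly_coversD[OF \<kappa>(2)])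
  obtain I where I: "I \<subseteq> S" "finite I" "J = p ` I" using finite_subset_image[OF J(2,1)] by blast
  obtain N where N: "fst ` I \<subseteq> {..N}" "(fst \<circ> snd) ` I \<subseteq> {..N}"
  proof -
    obtain N1 where "fst ` I \<subseteq> {..N1}" using finite_nat_iff_bounded_le I(2) by blast
    moreover obtain N2 where "(fst \<circ> snd) ` I \<subseteq> {..N2}" using finite_nat_iff_bounded_le I(2) by blast
    ultimately show thesis using that[of "max N1 N2"] by fastforce
  qed
  \<comment> \<open>A finite set of indices that contains \<open>I\<close> and over which the sum
    splits into pieces and levels.\<close>
  define Z where "Z = (SIGMA i:{..N}. SIGMA n:{k i..N}. C i (Suc n))"
  have finC: "finite (C i (Suc n))" "real (card (C i (Suc n))) \<le> 2 powr (real (Suc n) * r)" if "k i \<le> n" for i n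
    using C[rule_format, of i "Suc n"] that unfolding cov_def by auto
  have fin: "finite Z" unfolding Z_def using finC(1) by (intro finite_SigmaI) auto
  have IZ: "I \<subseteq> Z"
  proof
    fix w assume w: "w \<in> I"
    obtain i n c where e: "w = (i, n, c)" by (cases w) auto
    have "i \<le> N" "n \<le> N" using N w unfolding e by force+
    moreover have "k i \<le> n" "c \<in> C i (Suc n)" using I(1) w unfolding e S_def by auto
    ultimately show "w \<in> Z" unfolding e Z_def by auto
  qed
  have "\<kappa> \<le> (\<Sum>w\<in>I. 2 powr (- (real (fst (snd w)) * t)))"
    using J(3) sum_image_le[OF I(2), of "\<lambda>v. 2 powr (- (real (fst v) * t))" p] unfolding I(3) by (simp add: comp_def p_def)
  also have "\<dots> \<le> (\<Sum>w\<in>Z. 2 powr (- (real (fst (snd w)) * t)))"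
    by (rule sum_mono2[OF fin IZ]) auto
  also have "\<dots> = (\<Sum>i\<le>N. \<Sum>n\<in>{k i..N}. real (card (C i (Suc n))) * 2 powr (- (real n * t)))"
  proof -
    define Zi where "Zi = (\<lambda>i. SIGMA n:{k i..N}. C i (Suc n))"
    have Zi: "finite (Zi i)" for i unfolding Zi_def using finC(1) by (intro finite_SigmaI) auto
    have "(\<Sum>w\<in>Z. 2 powr (- (real (fst (snd w)) * t))) = (\<Sum>i\<le>N. \<Sum>v\<in>Zi i. 2 powr (- (real (fst v) * t)))"
      unfolding Z_def Zi_def[symmetric]
      using sum.Sigma[of "{..N}" Zi "\<lambda>i v. 2 powr (- (real (fst v) * t))"] Zi by (simp add: split_def)
    also have "\<dots> = (\<Sum>i\<le>N. \<Sum>n\<in>{k i..N}. real (card (C i (Suc n))) * 2 powr (- (real n * t)))"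
    proof (rule sum.cong[OF refl])
      fix i
      show "(\<Sum>v\<in>Zi i. 2 powr (- (real (fst v) * t))) = (\<Sum>n\<in>{k i..N}. real (card (C i (Suc n))) * 2 powr (- (real n * t)))"
        unfolding Zi_def
        using sum.Sigma[of "{k i..N}" "\<lambda>n. C i (Suc n)" "\<lambda>n c. 2 powr (- (real n * t))"] finC(1)[of i] by (simp add: split_def)
    qed
    finally show ?thesis .
  qed
  also have "\<dots> \<le> (\<Sum>i\<le>N. \<kappa> / 2 * (1/2) ^ Suc i)"
  proof (rule sum_mono)
    fix i
    have "(\<Sum>n\<in>{k i..N}. real (card (C i (Suc n))) * 2 powr (- (real n * t))) \<le> (\<Sum>n\<in>{k i..N}. 2 powr r * q ^ n)"
    proof (rule sum_mono)
      fix n assume n: "n \<in> {k i..N}"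
      have "real (card (C i (Suc n))) * 2 powr (- (real n * t)) \<le> 2 powr (real (Suc n) * r) * 2 powr (- (real n * t))"
        using finC(2)[of i n] n by (intro mult_right_mono) auto
      also have "\<dots> = 2 powr r * q ^ n"
        unfolding q_def by (simp add: powr_add[symmetric] powr_powr powr_realpow[symmetric] algebra_simps)
      finally show "real (card (C i (Suc n))) * 2 powr (- (real n * t)) \<le> 2 powr r * q ^ n" .
    qed
    also have "\<dots> = (\<Sum>n\<in>(\<lambda>n. n + k i) -` {k i..N}. 2 powr r * q ^ (n + k i))"
      by (rule sum.reindex_bij_witness[of _ "\<lambda>n. n + k i" "\<lambda>n. n - k i"]) auto
    also have "\<dots> \<le> (\<Sum>n. 2 powr r * q ^ (n + k i))"
      using q by (intro sum_le_suminf) (auto simp: power_add intro!: summable_mult summable_mult2 summable_geometric finite_vimageI injI)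
    also have "\<dots> = 2 powr r / (1 - q) * q ^ k i"
      using q by (simp add: power_add suminf_mult suminf_mult2[symmetric] summable_geometric suminf_geometric mult.assoc[symmetric])
    also have "\<dots> \<le> \<kappa> / 2 * (1/2) ^ Suc i" using k by (simp add: less_imp_le)
    finally show "(\<Sum>n\<in>{k i..N}. real (card (C i (Suc n))) * 2 powr (- (real n * t))) \<le> \<kappa> / 2 * (1/2) ^ Suc i" .
  qed
  also have "\<dots> \<le> \<kappa> / 2"
  proof -
    have h: "(\<lambda>i. \<kappa> / 2 * (1/2) ^ Suc i) sums (\<kappa> / 2)" using sums_mult[OF power_half_series, of "\<kappa> / 2"] by simp
    then have "(\<Sum>i\<le>N. \<kappa> / 2 * (1/2) ^ Suc i) \<le> (\<Sum>i. \<kappa> / 2 * (1/2) ^ Suc i)"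
      using \<kappa>(1) by (intro sum_le_suminf) (auto simp: sums_iff)
    then show ?thesis using h by (simp add: sums_iff)
  qed
  finally show False using \<kappa>(1) by simp
qed

section \<open>Prevalence and the assembly of the proof\<close>

lemma prevalentI:
  fixes G :: "'g::topological_ab_group_add set"
  assumes "G \<in> sets borel" "G \<subseteq> A" "prob_space \<nu>" "sets \<nu> = sets borel" "\<And>x. AE f in \<nu>. f + x \<in> G"
  shows "prevalent A"
  unfolding prevalent_def shy_def
proof (intro bexI[of _ "- G"] conjI exI[of _ \<nu>] allI)
  show "- A \<subseteq> - G" "- G \<in> sets borel" using assms by auto
  fix x
  \<comment> \<open>A point lies in the translate exactly if moving it back by \<open>x\<close>
    leads out of \<open>G\<close>, so the almost sure statement is applied to
    \<open>- x\<close>.\<close>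
  have "(\<lambda>b. b + x) ` (- G) = {f. f + - x \<notin> G}"
  proof safe
    fix f assume "f + - x \<notin> G"
    then show "f \<in> (\<lambda>b. b + x) ` (- G)" by (intro image_eqI[of _ _ "f + - x"]) auto
  qed simp
  moreover have "space \<nu> = UNIV" using sets_eq_imp_space_eq[OF assms(4)] by simp
  moreover have "emeasure \<nu> {f \<in> space \<nu>. f + - x \<notin> G} = 0"
    using assms(5)[of "- x"] by (intro emeasure_eq_0_AE) simp
  ultimately show "emeasure \<nu> ((\<lambda>b. b + x) ` (- G)) = 0" by simp
qed (use assms in auto)

theorem corollary4p22:
  fixes \<mu> :: "'a::metric_space measure"
    and Dim :: "'a set \<Rightarrow> ereal"
  assumes "Dim = hausdorff_dim \<or> Dim = packing_dim"
    and "compact (UNIV :: 'a set)"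
    and "non_exploding (UNIV :: 'a set)"
    and "mass_distribution \<mu>"
    and "continuous_measure \<mu>"
    and "measure_dim Dim \<mu> = Dim UNIV"
  shows "prevalent {f :: 'a \<Rightarrow>\<^sub>C (real ^ 'n).
           \<exists>U. open U \<and>
             emeasure \<mu> (apply_bcontfun f -` U) = emeasure \<mu> UNIV \<and>
             (\<forall>y\<in>U. Dim (apply_bcontfun f -` {y}) = Dim UNIV)}"
proof -
  note cpt = assms(2)
  have sets: "sets \<mu> = sets borel" using assms(4) unfolding mass_distribution_def by simp
  have space: "space \<mu> = UNIV" using sets_eq_imp_space_eq[OF sets] by simp
  have fm: "finite_measure \<mu>"
    using assms(4) unfolding mass_distribution_def by (intro finite_measureI) (simp add: space less_top)
  interpret finite_measure \<mu> by fact
  have atomless: "emeasure \<mu> {x} = 0" for x using assms(5) unfolding continuous_measure_def by simp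
  \<comment> \<open>The two dimensions are treated together; they differ only in whether lightness
    holds at all large levels or at infinitely many.\<close>
  define regular where "regular = (\<lambda>E.
    (Dim = hausdorff_dim \<and> (\<forall>s. 0 \<le> s \<and> ereal s < Dim UNIV \<longrightarrow> (\<exists>m. \<forall>x\<in>E. \<forall>n\<ge>m. light \<mu> s n x))) \<or>
    (Dim = packing_dim \<and> (\<forall>s. 0 \<le> s \<and> ereal s < Dim UNIV \<longrightarrow> (\<forall>m. \<forall>x\<in>E. \<exists>n\<ge>m. light \<mu> s n x))))"
  have "\<exists>E. closed E \<and> measure \<mu> (- E) \<le> (1/2) ^ j \<and> regular E" for j :: nat
  proof -
    have e: "0 < (1/2 :: real) ^ j" by simp
    from assms(1) show ?thesis
    proof
      assume "Dim = hausdorff_dim"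
      then show ?thesis using uniformly_light_hausdorff[OF fm sets e] unfolding regular_def assms(6)[symmetric] by blast
    next
      assume "Dim = packing_dim"
      then show ?thesis using frequently_light_packing[OF cpt fm sets e] unfolding regular_def assms(6)[symmetric] by blast
    qed
  qed
  then have "\<forall>j. \<exists>E. closed E \<and> measure \<mu> (- E) \<le> (1/2) ^ j \<and> regular E" by blast
  from choice[OF this] obtain E where E: "\<forall>j. closed (E j) \<and> measure \<mu> (- E j) \<le> (1/2) ^ j \<and> regular (E j)" ..
  obtain b and C :: "nat \<Rightarrow> 'a set" where C: "\<forall>n. finite (C n) \<and> card (C n) \<le> b * 2 ^ (n * n) \<and> UNIV \<subseteq> (\<Union>c\<in>C n. cball c (1 / 2 ^ n))"
    using non_exploding_nets[OF cpt assms(3)] by blast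
  obtain \<nu> :: "('a \<Rightarrow>\<^sub>C (real ^ 'n)) measure" and A :: "nat \<Rightarrow> 'a set" and K a :: real where
    \<nu>: "prob_space \<nu>" "sets \<nu> = sets borel" and A: "\<And>l. closed (A l)" "\<And>l. measure \<mu> (- A l) \<le> (1/2) ^ l" and Ka: "0 < K" "0 < a"
    and decay: "\<And>j V u c0 g. V \<in> sets \<mu> \<Longrightarrow> V \<subseteq> (\<Inter>l\<in>{j..}. A l) \<Longrightarrow> 4 ^ j \<le> \<bar>u $ c0\<bar> \<Longrightarrow>
      (\<integral>\<^sup>+f. ennreal (norm (ft \<mu> V u (apply_bcontfun (f + g)))) \<partial>\<nu>) \<le> ennreal (K * exp (- a * sqrt \<bar>u $ c0\<bar>))"
    by (rule decaying_series[OF cpt fm sets atomless, where 'n = 'n]) (rule that, assumption+)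
  \<comment> \<open>The points of \<open>E j\<close> that lie on plateaus of all levels from
    \<open>j\<close> on. Transforms of subsets decay from frequency \<open>4 ^ j\<close> on, and
    below it the trivial bound is used.\<close>
  define D where "D = (\<lambda>j. E j \<inter> (\<Inter>l\<in>{j..}. A l))"
  have regular_subset: "regular X'" if "regular X" and sub: "X' \<subseteq> X" for X X'
  proof -
    have light_always: "\<exists>m. \<forall>x\<in>X'. \<forall>n\<ge>m. light \<mu> s n x" if "\<exists>m. \<forall>x\<in>X. \<forall>n\<ge>m. light \<mu> s n x" for s using that sub by blast
    have light_often: "\<forall>m. \<forall>x\<in>X'. \<exists>n\<ge>m. light \<mu> s n x" if "\<forall>m. \<forall>x\<in>X. \<exists>n\<ge>m. light \<mu> s n x" for s using that sub by blast
    show ?thesis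
      using \<open>regular X\<close> unfolding regular_def
    proof (elim disjE conjE, goal_cases)
      case 1
      then show ?case using light_always by (intro disjI1 conjI allI impI) blast+
    next
      case 2
      then show ?case using light_often by (intro disjI2 conjI) blast+
    qed
  qed
  have D: "closed (D j)" "regular (D j)" for j
  proof -
    show "closed (D j)" using E A(1) unfolding D_def by auto
    show "regular (D j)" by (rule regular_subset[OF conjunct2[OF conjunct2[OF spec[OF E]]]]) (auto simp: D_def)
  qed
  have Ds: "D j \<in> sets \<mu>" for j unfolding sets using D(1) by simp
  \<comment> \<open>One unit of the constant 3 comes from \<open>E j\<close>, two from the geometric
    tail for the sets \<open>A l\<close>.\<close>
  have D_compl: "measure \<mu> (- D j) \<le> 3 * (1/2) ^ j" for j
  proof -
    have Bo: "- E j \<in> sets \<mu>" "- A l \<in> sets \<mu>" for l unfolding sets using E A(1) by auto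
    have h: "(\<lambda>i. (1/2 :: real) ^ (i + j)) sums (2 * (1/2) ^ j)"
      using sums_mult2[OF geometric_sums[of "1/2 :: real"], of "(1/2) ^ j"] by (simp add: power_add)
    have summ: "summable (\<lambda>i. measure \<mu> (- A (i + j)))"
      using A(2) by (intro summable_comparison_test'[OF sums_summable[OF h], of 0]) auto
    have eq: "- D j = - E j \<union> (\<Union>i. - A (i + j))"
    proof -
      have "(\<Inter>l\<in>{j..}. A l) = (\<Inter>i. A (i + j))"
        by (auto simp: le_iff_add add.commute)
      then show ?thesis unfolding D_def by auto
    qed
    have "measure \<mu> (- D j) \<le> measure \<mu> (- E j) + measure \<mu> (\<Union>i. - A (i + j))"
      unfolding eq using Bo by (intro measure_Un_le) auto
    also have "measure \<mu> (\<Union>i. - A (i + j)) \<le> (\<Sum>i. measure \<mu> (- A (i + j)))"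
      using Bo summ by (intro finite_measure_subadditive_countably) auto
    also have "\<dots> \<le> (\<Sum>i. (1/2) ^ (i + j))"
      by (intro suminf_le A(2) summ sums_summable[OF h])
    also have "\<dots> = 2 * (1/2) ^ j" using h by (simp add: sums_iff)
    finally show ?thesis using E[rule_format, of j] by simp
  qed
  \<comment> \<open>Besides the balls, \<open>D j\<close> itself is a member, so that the finiteness
    of \<open>total_high\<close> also gives that of \<open>ftsum\<close> over \<open>D j\<close>,
    which \<open>fiber_mass\<close> requires.\<close>
  define F where "F = (\<lambda>j n. insert (D j) ((\<lambda>c. D j \<inter> ball c (3 / 2 ^ n)) ` C n))"
  have F: "finite (F j n)" "card (F j n) \<le> (b + 1) * 2 ^ (n * n)" for j n
  proof -
    show "finite (F j n)" using C unfolding F_def by simp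
    have "card (F j n) \<le> Suc (card ((\<lambda>c. D j \<inter> ball c (3 / 2 ^ n)) ` C n))"
      unfolding F_def by (rule card_insert_le_m1) auto
    also have "\<dots> \<le> Suc (card (C n))" using C by (intro Suc_le_mono[THEN iffD2] card_image_le) auto
    also have "\<dots> \<le> 1 * 2 ^ (n * n) + b * 2 ^ (n * n)"
    proof -
      have "card (C n) \<le> b * 2 ^ (n * n)" "(1 :: nat) \<le> 2 ^ (n * n)" using C by auto
      then show ?thesis by linarith
    qed
    finally show "card (F j n) \<le> (b + 1) * 2 ^ (n * n)" by (simp add: algebra_simps)
  qed
  have Fs: "V \<in> sets \<mu>" "V \<subseteq> (\<Inter>l\<in>{j..}. A l)" if "V \<in> F j n" for V j n
  proof -
    have "D j \<inter> ball c r \<in> sets \<mu>" for c r using Ds[of j] unfolding sets by auto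
    then show "V \<in> sets \<mu>" using that Ds unfolding F_def by auto
    show "V \<subseteq> (\<Inter>l\<in>{j..}. A l)" using that unfolding F_def D_def by auto
  qed
  \<comment> \<open>A Borel set given by countably many conditions: integer bounds
    \<open>Suc T\<close> cover every continuous map on the compact space, and they are positive
    because they serve as divisors.\<close>
  define G where "G = {h :: 'a \<Rightarrow>\<^sub>C (real ^ 'n). \<forall>T j. total_high (Suc T) j \<mu> (F j) (apply_bcontfun h) < \<infinity>}"
  show ?thesis
  proof (rule prevalentI[OF _ _ \<nu>])
    have "{h :: 'a \<Rightarrow>\<^sub>C (real ^ 'n). total_high (Suc T) j \<mu> (F j) (apply_bcontfun h) < \<infinity>} \<in> sets borel" for T j
    proof -
      have [measurable]: "(\<lambda>h :: 'a \<Rightarrow>\<^sub>C (real ^ 'n). total_high (Suc T) j \<mu> (F j) (apply_bcontfun h)) \<in> borel_measurable borel"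
        by (rule total_high_measurable[OF fm sets Fs(1)])
      have "{h \<in> space borel. total_high (Suc T) j \<mu> (F j) (apply_bcontfun (h :: 'a \<Rightarrow>\<^sub>C (real ^ 'n))) < \<infinity>} \<in> sets borel" by measurable
      then show ?thesis by simp
    qed
    then have "(\<Inter>T. \<Inter>j. {h :: 'a \<Rightarrow>\<^sub>C (real ^ 'n). total_high (Suc T) j \<mu> (F j) (apply_bcontfun h) < \<infinity>}) \<in> sets borel"
      by (intro sets.countable_INT) auto
    moreover have "G = (\<Inter>T. \<Inter>j. {h. total_high (Suc T) j \<mu> (F j) (apply_bcontfun h) < \<infinity>})" unfolding G_def by auto
    ultimately show "G \<in> sets borel" by simp
  next
    fix g :: "'a \<Rightarrow>\<^sub>C (real ^ 'n)"
    have "AE f in \<nu>. total_high (Suc T) j \<mu> (F j) (apply_bcontfun (f + g)) < \<infinity>" for T j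
    proof (rule total_high_finite[OF fm sets \<nu> Ka _ F Fs(1)])
      fix n V c0 and u :: "real ^ 'n"
      assume "V \<in> F j n" "4 ^ j \<le> \<bar>u $ c0\<bar>"
      then show "(\<integral>\<^sup>+f. ennreal (norm (ft \<mu> V u (apply_bcontfun (f + g)))) \<partial>\<nu>) \<le> ennreal (K * exp (- a * sqrt \<bar>u $ c0\<bar>))"
        by (intro decay Fs)
    qed simp
    then show "AE f in \<nu>. f + g \<in> G" unfolding G_def by (simp add: AE_all_countable)
  next
    show "G \<subseteq> {f. \<exists>U. open U \<and> emeasure \<mu> (apply_bcontfun f -` U) = emeasure \<mu> UNIV \<and>
        (\<forall>y\<in>U. Dim (apply_bcontfun f -` {y}) = Dim UNIV)}"
    proof (rule subsetI, rule CollectI)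
      fix h :: "'a \<Rightarrow>\<^sub>C (real ^ 'n)" assume h: "h \<in> G"
      have hm: "apply_bcontfun h \<in> borel_measurable \<mu>" by (rule bcontfun_borel[OF sets])
      obtain T0 where T0: "norm h \<le> real T0" using real_arch_simple by blast
      define T where "T = Suc T0"
      have T: "0 < T" "\<And>x i. \<bar>h x $ i\<bar> \<le> real T"
      proof -
        fix x i
        have "\<bar>h x $ i\<bar> \<le> norm (h x)" by (rule component_le_norm_cart)
        also have "\<dots> \<le> norm h" by (rule norm_bounded)
        finally show "\<bar>h x $ i\<bar> \<le> real T" using T0 unfolding T_def by simp
      qed (simp add: T_def)
      have fin: "total_high T j \<mu> (F j) (apply_bcontfun h) < \<infinity>" for j using h unfolding G_def T_def by blast
      have ffin: "ftsum T \<mu> (D j) (apply_bcontfun h) < \<infinity>" for j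
      proof -
        have "D j \<in> F j 0" unfolding F_def by simp
        from ftsum_bound[where F = "F j", OF fm hm F(1) this Ds T(1) fin] show ?thesis
          by (rule order.strict_trans1) simp
      qed
      define fib where "fib = (\<lambda>j (U :: (real ^ 'n) set). open U \<and> emeasure \<mu> (D j \<inter> apply_bcontfun h -` (- U)) = 0 \<and>
        (\<forall>y\<in>U. \<exists>c>0. \<forall>\<W>. (\<forall>W\<in>\<W>. open W) \<longrightarrow> D j \<inter> apply_bcontfun h -` {y} \<subseteq> \<Union>\<W> \<longrightarrow>
         (\<exists>\<F>\<subseteq>\<W>. finite \<F> \<and> ennreal c \<le> (\<Sum>W\<in>\<F>. ftsum T \<mu> (D j \<inter> W) h))))"
      have "\<exists>U. fib j U" for j
        by (rule fiber_mass[OF cpt fm sets D(1) T ffin, of j], rule exI) (unfold fib_def, intro conjI ballI, assumption+)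
      then have "\<forall>j. \<exists>U. fib j U" by blast
      from choice[OF this] obtain U where U: "\<forall>j. fib j (U j)" ..
      \<comment> \<open>The complements of the \<open>D j\<close> have measure tending to 0, so the
        union has a preimage of full measure, whereas the dimension of the fiber over
        \<open>y\<close> is obtained from any one \<open>j\<close> with \<open>y\<close> in
        \<open>U j\<close>.\<close>
      define V where "V = (\<Union>j. U j)"
      have V_open: "open V" unfolding V_def using U unfolding fib_def by blast
      have hV: "apply_bcontfun h -` X \<in> sets \<mu>" if "X \<in> sets borel" for X
        using measurable_sets[OF hm that] unfolding space by simp
      have "measure \<mu> (apply_bcontfun h -` (- V)) \<le> 3 * (1/2) ^ j" for j
      proof -
        have "apply_bcontfun h -` (- V) \<subseteq> - D j \<union> (D j \<inter> apply_bcontfun h -` (- U j))" unfolding V_def by auto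
        moreover have m1: "- D j \<in> sets \<mu>" unfolding sets using D(1) by auto
        moreover have m2: "D j \<inter> apply_bcontfun h -` (- U j) \<in> sets \<mu>"
          using Ds hV[of "- U j"] U unfolding fib_def by auto
        ultimately have "measure \<mu> (apply_bcontfun h -` (- V)) \<le> measure \<mu> (- D j \<union> (D j \<inter> apply_bcontfun h -` (- U j)))"
          by (intro finite_measure_mono) auto
        also have "\<dots> \<le> measure \<mu> (- D j) + measure \<mu> (D j \<inter> apply_bcontfun h -` (- U j))"
          by (rule measure_Un_le[OF m1 m2])
        also have "measure \<mu> (D j \<inter> apply_bcontfun h -` (- U j)) = 0" using U unfolding fib_def by (simp add: measure_def)
        finally show ?thesis using D_compl[of j] by simp
      qed
      moreover have "(\<lambda>j. 3 * (1/2 :: real) ^ j) \<longlonglongrightarrow> 3 * 0" by (intro tendsto_mult_left LIMSEQ_power_zero) simp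
      ultimately have "measure \<mu> (apply_bcontfun h -` (- V)) \<le> 0" by (intro LIMSEQ_le_const[where X = "\<lambda>j. 3 * (1/2 :: real) ^ j"]) auto
      then have null: "emeasure \<mu> (apply_bcontfun h -` (- V)) = 0" by (simp add: emeasure_eq_measure measure_le_0_iff)
      have full: "emeasure \<mu> (apply_bcontfun h -` V) = emeasure \<mu> UNIV"
      proof -
        have "emeasure \<mu> (apply_bcontfun h -` V \<union> apply_bcontfun h -` (- V)) = emeasure \<mu> (apply_bcontfun h -` V) + emeasure \<mu> (apply_bcontfun h -` (- V))"
          using V_open by (intro plus_emeasure[symmetric] hV) auto
        moreover have "apply_bcontfun h -` V \<union> apply_bcontfun h -` (- V) = UNIV" by auto
        ultimately show ?thesis using null by simp
      qed
      have "Dim (apply_bcontfun h -` {y}) = Dim UNIV" if y: "y \<in> V" for y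
      proof (rule antisym)
        let ?X = "apply_bcontfun h -` {y}"
        show "Dim ?X \<le> Dim UNIV"
          using assms(1) hausdorff_dim_mono[of ?X UNIV] packing_dim_mono[OF cpt, of ?X UNIV] by auto
        obtain j where j: "y \<in> U j" using y unfolding V_def by auto
        obtain c where c: "0 < c" "\<forall>\<W>. (\<forall>W\<in>\<W>. open W) \<longrightarrow> D j \<inter> ?X \<subseteq> \<Union>\<W> \<longrightarrow>
         (\<exists>\<F>\<subseteq>\<W>. finite \<F> \<and> ennreal c \<le> (\<Sum>W\<in>\<F>. ftsum T \<mu> (D j \<inter> W) h))"
          using U[unfolded fib_def, rule_format, THEN conjunct2, THEN conjunct2, THEN bspec, OF j] by (elim exE conjE)
        \<comment> \<open>The empty family would cover an empty fiber, and its only finite subfamily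
          has sum 0, below \<open>c\<close>.\<close>
        have ne: "?X \<noteq> {}"
        proof
          assume "?X = {}"
          then have "\<exists>\<F>\<subseteq>{}. finite \<F> \<and> ennreal c \<le> (\<Sum>W\<in>\<F>. ftsum T \<mu> (D j \<inter> W) h)"
            using spec[OF c(2), of "{}"] by simp
          then show False using c(1) by simp
        qed
        have costly: "\<exists>\<kappa>>0. costly_covers \<mu> (D j) ?X t s \<kappa>" if "t < s" for t s
        proof (rule costly_coversI[where F = "F j" and C = C, OF fm sets D(1) T(1) _ _ F(1) _ fin that c])
          show "finite (C n)" "UNIV \<subseteq> (\<Union>c\<in>C n. cball c (1 / 2 ^ n))" for n using C by auto
          show "D j \<inter> ball c (3 / 2 ^ n) \<in> F j n" if "c \<in> C n" for n c using that unfolding F_def by auto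
        qed
        from D(2)[of j] show "Dim UNIV \<le> Dim ?X"
          unfolding regular_def
        proof (elim disjE conjE)
          assume "Dim = hausdorff_dim" "\<forall>s. 0 \<le> s \<and> ereal s < Dim UNIV \<longrightarrow> (\<exists>m. \<forall>x\<in>D j. \<forall>n\<ge>m. light \<mu> s n x)"
          then show ?thesis using hausdorff_dim_geI[OF ne costly] by simp
        next
          assume "Dim = packing_dim" "\<forall>s. 0 \<le> s \<and> ereal s < Dim UNIV \<longrightarrow> (\<forall>m. \<forall>x\<in>D j. \<exists>n\<ge>m. light \<mu> s n x)"
          then show ?thesis using packing_dim_geI[OF cpt ne costly] by simp
        qed
      qed
      then show "\<exists>U. open U \<and> emeasure \<mu> (apply_bcontfun h -` U) = emeasure \<mu> UNIV \<and>
        (\<forall>y\<in>U. Dim (apply_bcontfun h -` {y}) = Dim UNIV)"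
        using V_open full by blast
    qed
  qed
qed

end
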